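(* Let $(M,\hat{J},\hat{\theta})$ and $(N,\widetilde{J},\widetilde{\theta})$ be two simply connected pseudohermitian submanifolds of $H_{n}$ with CR dimension $m=n-1$, whose fundamental vector fields are nowhere zero. If they have the same (induced) pseudohermitian structures, then they locally differ by a Heisenberg rigid motion. More explicitly, if there exists a pseudohermitian transformation $\phi:M\rightarrow N$, then $\phi=\Phi|_{M}$ for some Heisenberg rigid motion $\Phi$.
   Context: $H_{n}$ is the Heisenberg group with contact form $\Theta=dt+\sum_{\beta}(x_\beta dy_\beta-y_\beta dx_\beta)$, contact bundle $\xi=\ker\Theta$, standard CR structure $J$, Reeb field $T=\partial_t$ and Levi metric; a Heisenberg rigid motion is an element of the group $PSH(n)$ of pseudohermitian transformations of $H_n$. A pseudohermitian submanifold $(M,\hat J,\hat\theta)$ satisfies $\hat{\xi}=TM\cap\xi$, $\hat{J}=J|_{\hat{\xi}}$, $\hat{\theta}=\Theta|_{M}$. Its fundamental vector field $\nu$ is the unique section of $\hat\xi^\perp$ (Levi-orthogonal complement of $\hat\xi$ in $\xi$) with $T+\nu\in TM$. A pseudohermitian transformation $\phi:M\to N$ is a diffeomorphism with $\phi_*\circ\hat J=\widetilde J\circ\phi_*$ and $\phi^*\widetilde\theta=\hat\theta$. *)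

theory Defs
  imports "HOL-Analysis.Analysis"
begin

text \<open>The Heisenberg group H_n, realised as C^n x R; a point is (z, t) with z_beta = x_beta + i y_beta.
  Tangent vectors at a point are elements of the same vector space.\<close>
type_synonym 'n heis = "(complex ^ 'n) \<times> real"

fun Ck_on :: "nat \<Rightarrow> ('a::real_normed_vector \<Rightarrow> 'b::real_normed_vector) \<Rightarrow> 'a set \<Rightarrow> bool" where
  "Ck_on 0 f S \<longleftrightarrow> continuous_on S f"
| "Ck_on (Suc k) f S \<longleftrightarrow> f differentiable_on S \<and>
      (\<forall>v. Ck_on k (\<lambda>x. frechet_derivative f (at x) v) S)"

definition smooth_on :: "('a::real_normed_vector \<Rightarrow> 'b::real_normed_vector) \<Rightarrow> 'a set \<Rightarrow> bool" where
  "smooth_on f S \<longleftrightarrow> (\<forall>k. Ck_on k f S)"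

definition Theta :: "'n::finite heis \<Rightarrow> 'n heis \<Rightarrow> real" where
  "Theta p v = snd v + (\<Sum>\<beta>\<in>UNIV. Re (fst p $ \<beta>) * Im (fst v $ \<beta>) - Im (fst p $ \<beta>) * Re (fst v $ \<beta>))"

definition xi :: "'n::finite heis \<Rightarrow> 'n heis set" where
  "xi p = {v. Theta p v = 0}"

text \<open>Standard CR structure J on xi: J X_beta = Y_beta, J Y_beta = - X_beta, where
  X_beta = d/dx_beta + y_beta d/dt, Y_beta = d/dy_beta - x_beta d/dt.  On a horizontal vector
  it multiplies the C^n-component by i (the t-component is then fixed by horizontality).\<close>
definition Jst :: "'n::finite heis \<Rightarrow> 'n heis \<Rightarrow> 'n heis" where
  "Jst p v = ((\<chi> \<beta>. \<i> * (fst v $ \<beta>)), - (\<Sum>\<beta>\<in>UNIV. Re (cnj (fst p $ \<beta>) * (fst v $ \<beta>))))"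

definition Reeb :: "'n::finite heis" where
  "Reeb = (0, 1)"

text \<open>Levi metric on xi (X_beta, Y_beta orthonormal).\<close>
definition levi :: "'n::finite heis \<Rightarrow> 'n heis \<Rightarrow> real" where
  "levi v w = (\<Sum>\<beta>\<in>UNIV. Re (cnj (fst v $ \<beta>) * (fst w $ \<beta>)))"

definition embedded_submanifold :: "'a::euclidean_space set \<Rightarrow> nat \<Rightarrow> bool" where
  "embedded_submanifold M k \<longleftrightarrow>
     (\<forall>p\<in>M. \<exists>W V (\<psi>::'a \<Rightarrow> 'a) L. open W \<and> p \<in> W \<and> open V \<and> subspace L \<and> dim L = k \<and>
        smooth_on \<psi> W \<and> bij_betw \<psi> W V \<and> smooth_on (inv_into W \<psi>) V \<and>
        \<psi> ` (M \<inter> W) = V \<inter> L)"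

definition tangent_space :: "'a::real_normed_vector set \<Rightarrow> 'a \<Rightarrow> 'a set" where
  "tangent_space M p = {v. \<exists>\<gamma> (\<epsilon>::real). \<epsilon> > 0 \<and> \<gamma> ` {-\<epsilon><..<\<epsilon>} \<subseteq> M \<and> \<gamma> 0 = p \<and>
        (\<gamma> has_vector_derivative v) (at 0)}"

definition smooth_map_on :: "'a::real_normed_vector set \<Rightarrow> ('a \<Rightarrow> 'b::real_normed_vector) \<Rightarrow> bool" where
  "smooth_map_on M f \<longleftrightarrow>
     (\<forall>p\<in>M. \<exists>g W. open W \<and> p \<in> W \<and> smooth_on g W \<and> (\<forall>q\<in>M \<inter> W. g q = f q))"

definition dmap :: "'a::real_normed_vector set \<Rightarrow> ('a \<Rightarrow> 'b::real_normed_vector) \<Rightarrow> 'a \<Rightarrow> 'a \<Rightarrow> 'b" where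
  "dmap M f p v = (SOME w. \<exists>g W. open W \<and> p \<in> W \<and> smooth_on g W \<and> (\<forall>q\<in>M \<inter> W. g q = f q) \<and>
       w = frechet_derivative g (at p) v)"

definition xi_hat :: "'n::finite heis set \<Rightarrow> 'n heis \<Rightarrow> 'n heis set" where
  "xi_hat M p = tangent_space M p \<inter> xi p"

text \<open>Pseudohermitian submanifold of H_n of CR dimension m: an embedded submanifold of dimension
  2m+1 such that xi-hat is J-invariant of real rank 2m; then J-hat = J restricted and
  theta-hat = Theta restricted give the induced pseudohermitian structure.\<close>
definition pseudohermitian_submanifold :: "'n::finite heis set \<Rightarrow> nat \<Rightarrow> bool" where
  "pseudohermitian_submanifold M m \<longleftrightarrow>
     embedded_submanifold M (2 * m + 1) \<and>
     (\<forall>p\<in>M. Jst p ` xi_hat M p \<subseteq> xi_hat M p \<and> dim (xi_hat M p) = 2 * m)"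

definition fundamental_field :: "'n::finite heis set \<Rightarrow> 'n heis \<Rightarrow> 'n heis" where
  "fundamental_field M p = (THE \<nu>. \<nu> \<in> xi p \<and> (\<forall>X\<in>xi_hat M p. levi \<nu> X = 0) \<and>
       Reeb + \<nu> \<in> tangent_space M p)"

definition ph_transformation :: "'n::finite heis set \<Rightarrow> 'n heis set \<Rightarrow> ('n heis \<Rightarrow> 'n heis) \<Rightarrow> bool" where
  "ph_transformation M N \<phi> \<longleftrightarrow>
     bij_betw \<phi> M N \<and> smooth_map_on M \<phi> \<and> smooth_map_on N (inv_into M \<phi>) \<and>
     (\<forall>p\<in>M. \<forall>v\<in>tangent_space M p. Theta (\<phi> p) (dmap M \<phi> p v) = Theta p v) \<and>
     (\<forall>p\<in>M. \<forall>v\<in>xi_hat M p. dmap M \<phi> p (Jst p v) = Jst (\<phi> p) (dmap M \<phi> p v))"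

definition PSH :: "('n::finite heis \<Rightarrow> 'n heis) set" where
  "PSH = {\<Phi>. bij \<Phi> \<and> smooth_on \<Phi> UNIV \<and> smooth_on (inv \<Phi>) UNIV \<and>
     (\<forall>p v. Theta (\<Phi> p) (frechet_derivative \<Phi> (at p) v) = Theta p v) \<and>
     (\<forall>p. \<forall>v\<in>xi p. frechet_derivative \<Phi> (at p) (Jst p v) = Jst (\<Phi> p) (frechet_derivative \<Phi> (at p) v))}"

end

theory Submission
  imports Defs
begin

text \<open>Write \<open>f\<close> and \<open>g\<close> for the \<open>C\<^sup>n\<close>-components of a local parametrization of \<open>M\<close> and of its
  composition with \<open>\<phi>\<close>.  As the fundamental vector fields vanish nowhere, both are immersions onto real
  hypersurfaces.  They induce the same contact form, hence the same pulled back Kaehler form, and being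
  CR maps they induce the same metric on the contact distribution.  Differentiating these identities
  expresses the difference of the second derivatives of \<open>f\<close> and \<open>g\<close> through the difference
  \<open>del\<close> of the squared lengths of the two fundamental vector fields; the Gauss equation on a
  complex line in the contact distribution then reads \<open>del\<close> times a positive number equals zero.
  So \<open>f\<close> and \<open>g\<close> are isometric with the same second fundamental form, whence \<open>g = U f + c\<close>
  for a locally constant unitary map \<open>U\<close>, and the contact form determines the \<open>t\<close>-component.
  Connectedness of \<open>M\<close> makes the rigid motion global.\<close>

section \<open>Smooth functions\<close>

text \<open>The obstacle is the Reeb direction \<open>T\<close>. The contact form and the CR
  structure control every inner product with a horizontal vector, but not the length of
  \<open>A T\<close>, so the rigidity argument for isometric hypersurfaces cannot start before
  \<open>del = 0\<close> is known. The contact distribution is not integrable, hence no Gauss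
  equation of a submanifold is at hand for it. Instead the vanishing of the horizontal Christoffel
  differences is differentiated along horizontal fields; these turn with the base point, and every
  resulting correction has \<open>T\<close> in one slot and is a multiple of \<open>del\<close>. A
  complex line in the contact hyperplane is needed here, which is why the CR dimension must be
  positive. Afterwards the Levi form supplies a horizontal direction with nonzero second fundamental
  form, and the Gauss equation then fixes the one remaining value, at \<open>T\<close> and
  \<open>T\<close>. Parametrizations are inverse slice charts, so that derivatives are ordinary
  Frechet derivatives of the ambient space, but an identity valid on the slice may be differentiated
  only in directions of \<open>L\<close>.\<close>

abbreviation FD :: "('a::real_normed_vector \<Rightarrow> 'b::real_normed_vector) \<Rightarrow> 'a \<Rightarrow> 'a \<Rightarrow> 'b" where
  "FD f x v \<equiv> frechet_derivative f (at x) v"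

lemma differentiable_on_open_at:
  assumes "open S" "f differentiable_on S" "x \<in> S"
  shows "(f has_derivative FD f x) (at x)"
  using assms differentiable_on_eq_differentiable_at frechet_derivative_works by blast

lemma differentiable_on_openI:
  assumes "open S" "\<And>x. x \<in> S \<Longrightarrow> (f has_derivative f' x) (at x)"
  shows "f differentiable_on S"
  using assms differentiable_on_eq_differentiable_at differentiable_def by blast

lemma FD_eqI: "(f has_derivative f') (at x) \<Longrightarrow> FD f x v = f' v"
  using frechet_derivative_at by metis

section \<open>Stability of C^k functions under the usual operations\<close>

lemma Ck_on_cong:
  assumes "open S" "\<And>x. x \<in> S \<Longrightarrow> f x = g x" "Ck_on k f S"
  shows "Ck_on k g S"
  using assms(2,3)
proof (induction k arbitrary: f g)
  case 0
  then show ?case using continuous_on_cong by force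
next
  case (Suc k)
  have d: "(f has_derivative FD f x) (at x)" if "x \<in> S" for x
    using Suc.prems that by (intro differentiable_on_open_at[OF \<open>open S\<close>]) auto
  have d2: "(g has_derivative FD f x) (at x)" if "x \<in> S" for x
    by (rule has_derivative_transform_within_open[OF d[OF that] \<open>open S\<close> that Suc.prems(1)])
  have "Ck_on k (\<lambda>x. FD g x v) S" for v
    by (rule Suc.IH[where f = "\<lambda>x. FD f x v"]) (use Suc.prems FD_eqI[OF d2] in auto)
  then show ?case using differentiable_on_openI[OF \<open>open S\<close> d2] by simp
qed

text \<open>Any known derivative may replace \<open>frechet_derivative\<close>, which is a choice
  operator; the inductions on \<open>k\<close> for addition, products and composition pass through
  this rule.\<close>

lemma Ck_on_SucI:
  assumes "open S" "\<And>x. x \<in> S \<Longrightarrow> (f has_derivative f' x) (at x)" "\<And>v. Ck_on k (\<lambda>x. f' x v) S"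
  shows "Ck_on (Suc k) f S"
  using assms Ck_on_cong[OF assms(1), of "\<lambda>x. f' x v" "\<lambda>x. FD f x v" k for v]
    differentiable_on_openI[OF assms(1,2)] FD_eqI[OF assms(2)] by simp

lemma Ck_on_SucD: "Ck_on (Suc k) f S \<Longrightarrow> Ck_on k f S"
proof (induction k arbitrary: f)
  case 0
  then show ?case by (simp add: differentiable_imp_continuous_on)
qed auto

lemma Ck_on_Suc_has_derivative:
  assumes "open S" "Ck_on (Suc k) f S" "x \<in> S"
  shows "(f has_derivative FD f x) (at x)"
  using assms by (intro differentiable_on_open_at) auto

lemma Ck_on_subset: "T \<subseteq> S \<Longrightarrow> Ck_on k f S \<Longrightarrow> Ck_on k f T"
  by (induction k arbitrary: f) (auto intro: continuous_on_subset differentiable_on_subset)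

lemma Ck_on_const: "open S \<Longrightarrow> Ck_on k (\<lambda>x. c) S"
proof (induction k arbitrary: c)
  case (Suc k)
  show ?case by (rule Ck_on_SucI[where f' = "\<lambda>x v. 0"]) (use Suc in auto)
qed simp

lemma Ck_on_add:
  assumes "open S" "Ck_on k f S" "Ck_on k g S"
  shows "Ck_on k (\<lambda>x. f x + g x) S"
  using assms(2,3)
proof (induction k arbitrary: f g)
  case 0
  then show ?case by (auto intro: continuous_on_add)
next
  case (Suc k)
  show ?case
    by (rule Ck_on_SucI[OF assms(1) has_derivative_add[OF Ck_on_Suc_has_derivative Ck_on_Suc_has_derivative]])
      (use Suc assms(1) in auto)
qed

lemma Ck_on_sum:
  assumes "open S" "\<And>i. i \<in> I \<Longrightarrow> Ck_on k (f i) S"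
  shows "Ck_on k (\<lambda>x. \<Sum>i\<in>I. f i x) S"
  using assms(2)
proof (induction I rule: infinite_finite_induct)
  case (insert i I)
  then show ?case using Ck_on_add[OF assms(1), of k "f i" "\<lambda>x. \<Sum>i\<in>I. f i x"] by simp
qed (auto intro: Ck_on_const assms)

lemma Ck_on_bounded_linear:
  assumes "open S" "bounded_linear h" "Ck_on k f S"
  shows "Ck_on k (\<lambda>x. h (f x)) S"
  using assms(3)
proof (induction k arbitrary: f)
  case 0
  then show ?case using bounded_linear.continuous_on[OF assms(2)] by auto
next
  case (Suc k)
  show ?case
    by (rule Ck_on_SucI[OF assms(1) bounded_linear.has_derivative[OF assms(2) Ck_on_Suc_has_derivative]])
      (use Suc assms(1) in auto)
qed

lemma Ck_on_bounded_bilinear: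
  assumes "open S" "bounded_bilinear prd" "Ck_on k f S" "Ck_on k g S"
  shows "Ck_on k (\<lambda>x. prd (f x) (g x)) S"
  using assms(3,4)
proof (induction k arbitrary: f g)
  case 0
  then show ?case using bounded_bilinear.continuous_on[OF assms(2)] by auto
next
  case (Suc k)
  show ?case
  proof (rule Ck_on_SucI[OF assms(1)])
    show "((\<lambda>x. prd (f x) (g x)) has_derivative (\<lambda>v. prd (f x) (FD g x v) + prd (FD f x v) (g x))) (at x)"
      if "x \<in> S" for x
      by (rule bounded_bilinear.FDERIV[OF assms(2)])
        (use Suc.prems Ck_on_Suc_has_derivative[OF assms(1)] that in blast)+
    show "Ck_on k (\<lambda>x. prd (f x) (FD g x v) + prd (FD f x v) (g x)) S" for v
      using Suc.IH Suc.prems Ck_on_SucD[OF Suc.prems(1)] Ck_on_SucD[OF Suc.prems(2)]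
      by (intro Ck_on_add[OF assms(1)]) auto
  qed
qed

lemma linear_euclidean_sum:
  fixes h :: "'a::euclidean_space \<Rightarrow> 'b::real_vector"
  assumes "linear h"
  shows "h v = (\<Sum>b\<in>Basis. (v \<bullet> b) *\<^sub>R h b)"
  by (metis (no_types, lifting) assms euclidean_representation linear_scale linear_sum sum.cong)

lemma Ck_on_compose:
  fixes f :: "'c::real_normed_vector \<Rightarrow> 'a::euclidean_space" and g :: "'a \<Rightarrow> 'b::real_normed_vector"
  assumes "open S" "open T" "f ` S \<subseteq> T" "Ck_on k f S" "Ck_on k g T"
  shows "Ck_on k (\<lambda>x. g (f x)) S"
  using assms(4,5)
proof (induction k arbitrary: g)
  case 0
  then show ?case using continuous_on_compose2 assms(3) by auto
next
  case (Suc k)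
  have g: "(g has_derivative FD g y) (at y)" if "y \<in> T" for y
    using Suc that assms by (intro Ck_on_Suc_has_derivative) auto
  have f: "(f has_derivative FD f y) (at y)" if "y \<in> S" for y
    using Suc that assms by (intro Ck_on_Suc_has_derivative) auto
  show ?case
  proof (rule Ck_on_SucI[OF assms(1)])
    show "((\<lambda>x. g (f x)) has_derivative (\<lambda>v. FD g (f x) (FD f x v))) (at x)" if "x \<in> S" for x
      using diff_chain_at[OF f g, of x] that assms(3) by (auto simp: o_def)
    show "Ck_on k (\<lambda>x. FD g (f x) (FD f x v)) S" for v
    proof (rule Ck_on_cong[OF assms(1)])
      \<comment> \<open>The direction \<open>FD f x v\<close> moves with \<open>x\<close>, whereas
        the induction hypothesis for \<open>g\<close> covers fixed directions; expanding in
        \<open>Basis\<close> separates the two.\<close>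
      show "Ck_on k (\<lambda>x. \<Sum>b\<in>Basis. (FD f x v \<bullet> b) *\<^sub>R FD g (f x) b) S"
        using Suc.IH Suc.prems Ck_on_SucD[OF Suc.prems(1)]
        by (intro Ck_on_sum[OF assms(1)] Ck_on_bounded_bilinear[OF assms(1) bounded_bilinear_scaleR]
            Ck_on_bounded_linear[OF assms(1) bounded_linear_inner_left]) auto
      show "(\<Sum>b\<in>Basis. (FD f x v \<bullet> b) *\<^sub>R FD g (f x) b) = FD g (f x) (FD f x v)" if "x \<in> S" for x
        by (rule linear_euclidean_sum[symmetric], rule has_derivative_linear, rule g) (use that assms in auto)
    qed
  qed
qed

lemma smooth_on_FD: "smooth_on f S \<Longrightarrow> smooth_on (\<lambda>x. FD f x v) S"
  by (metis Ck_on.simps(2) smooth_on_def)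

lemma smooth_on_has_derivative:
  "open S \<Longrightarrow> smooth_on f S \<Longrightarrow> x \<in> S \<Longrightarrow> (f has_derivative FD f x) (at x)"
  unfolding smooth_on_def using Ck_on_Suc_has_derivative by blast

lemma smooth_on_linear_FD:
  "open S \<Longrightarrow> smooth_on f S \<Longrightarrow> x \<in> S \<Longrightarrow> linear (FD f x)"
  using smooth_on_has_derivative has_derivative_linear by blast

lemma smooth_on_continuous_on: "smooth_on f S \<Longrightarrow> continuous_on S f"
  by (metis Ck_on.simps(1) smooth_on_def)

lemma smooth_on_subset: "smooth_on f S \<Longrightarrow> T \<subseteq> S \<Longrightarrow> smooth_on f T"
  unfolding smooth_on_def using Ck_on_subset by blast

lemma smooth_on_bounded_linear:
  "open S \<Longrightarrow> bounded_linear h \<Longrightarrow> smooth_on f S \<Longrightarrow> smooth_on (\<lambda>x. h (f x)) S"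
  unfolding smooth_on_def using Ck_on_bounded_linear by blast

lemma smooth_on_bounded_bilinear:
  "open S \<Longrightarrow> bounded_bilinear prd \<Longrightarrow> smooth_on f S \<Longrightarrow> smooth_on g S \<Longrightarrow>
    smooth_on (\<lambda>x. prd (f x) (g x)) S"
  unfolding smooth_on_def using Ck_on_bounded_bilinear by blast

lemma smooth_on_add:
  "open S \<Longrightarrow> smooth_on f S \<Longrightarrow> smooth_on g S \<Longrightarrow> smooth_on (\<lambda>x. f x + g x) S"
  unfolding smooth_on_def using Ck_on_add by blast

lemma smooth_on_compose:
  fixes f :: "'c::real_normed_vector \<Rightarrow> 'a::euclidean_space" and g :: "'a \<Rightarrow> 'b::real_normed_vector"
  shows "open S \<Longrightarrow> open T \<Longrightarrow> f ` S \<subseteq> T \<Longrightarrow> smooth_on f S \<Longrightarrow> smooth_on g T \<Longrightarrow>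
    smooth_on (\<lambda>x. g (f x)) S"
  unfolding smooth_on_def using Ck_on_compose by blast

lemma FD_bounded_linear:
  assumes "open S" "bounded_linear h" "smooth_on f S" "x \<in> S"
  shows "FD (\<lambda>x. h (f x)) x v = h (FD f x v)"
  by (rule FD_eqI, rule bounded_linear.has_derivative[OF assms(2)])
    (rule smooth_on_has_derivative[OF assms(1,3,4)])

lemma FD_compose:
  assumes "open S" "open T" "f ` S \<subseteq> T" "smooth_on f S" "smooth_on g T" "x \<in> S"
  shows "FD (\<lambda>x. g (f x)) x v = FD g (f x) (FD f x v)"
  using diff_chain_at[OF smooth_on_has_derivative[OF assms(1,4,6)] smooth_on_has_derivative[OF assms(2,5)]] assms
  by (intro FD_eqI) (auto simp: o_def)

lemma FD_cong_open:
  assumes "open S" "x \<in> S" "\<And>y. y \<in> S \<Longrightarrow> f y = g y" "(f has_derivative f') (at x)"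
  shows "FD g x v = f' v"
  by (rule FD_eqI[OF has_derivative_transform_within_open[OF assms(4,1,2,3)]])

lemma smooth_on_affine:
  assumes "open S" "bounded_linear h"
  shows "smooth_on (\<lambda>x. h x + c) S"
  unfolding smooth_on_def
proof
  fix k
  show "Ck_on k (\<lambda>x. h x + c) S"
  proof (cases k)
    case 0
    then show ?thesis using bounded_linear.continuous_on[OF assms(2)] by (auto intro!: continuous_intros)
  next
    case (Suc k')
    have "((\<lambda>x. h x + c) has_derivative h) (at x)" for x
      using has_derivative_add_const bounded_linear_imp_has_derivative[OF assms(2)] by blast
    then show ?thesis unfolding Suc
      by (rule Ck_on_SucI[OF assms(1)]) (rule Ck_on_const[OF assms(1)])
  qed
qed

section \<open>Symmetry of second derivatives\<close>

text \<open>Both mixed derivatives are the limit of the second difference quotient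
  \<open>(f (x + hu + hv) - f (x + hu) - f (x + hv) + f x) / h\<^sup>2\<close>, which is symmetric in \<open>u\<close> and \<open>v\<close>.\<close>
lemma second_difference_tendsto:
  fixes f :: "'a::real_normed_vector \<Rightarrow> real"
  assumes "open S" "smooth_on f S" "x \<in> S"
  shows "((\<lambda>h. (f (x + h *\<^sub>R u + h *\<^sub>R v) - f (x + h *\<^sub>R u) - f (x + h *\<^sub>R v) + f x) / h\<^sup>2)
           \<longlongrightarrow> FD (\<lambda>y. FD f y u) x v) (at_right 0)"
proof -
  define G where "G y = FD (\<lambda>y. FD f y u) y v" for y
  have contG: "isCont G x"
    using smooth_on_continuous_on[OF smooth_on_FD[OF smooth_on_FD[OF assms(2)]]] assms
    unfolding G_def by (metis continuous_on_eq_continuous_at)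
  obtain r where r: "r > 0" "ball x r \<subseteq> S" using assms open_contains_ball by blast
  show ?thesis
    unfolding tendsto_iff
  proof (intro allI impI)
    fix e :: real assume e: "e > 0"
    obtain d where d: "d > 0" "\<And>y. dist y x < d \<Longrightarrow> dist (G y) (G x) < e"
      using contG e unfolding continuous_at_eps_delta by blast
    \<comment> \<open>With this bound the whole parallelogram with sides
      \<open>h *\<^sub>R u\<close> and \<open>h *\<^sub>R v\<close> stays within distance
      \<open>min r d\<close> of \<open>x\<close>; the added 1 keeps the denominator positive when
      \<open>u\<close> and \<open>v\<close> are both zero.\<close>
    define c where "c = min r d / (norm u + norm v + 1)"
    have c0: "c > 0" unfolding c_def using r d by (intro divide_pos_pos) (auto simp: add_nonneg_pos)
    have near: "dist (x + s *\<^sub>R u + t *\<^sub>R v) x < min r d" if "0 \<le> s" "s \<le> h" "0 \<le> t" "t \<le> h" "h < c" for s t h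
    proof -
      have "norm (s *\<^sub>R u + t *\<^sub>R v) \<le> s * norm u + t * norm v"
        using norm_triangle_ineq[of "s *\<^sub>R u" "t *\<^sub>R v"] that by simp
      also have "\<dots> \<le> c * norm u + c * norm v" using that by (intro add_mono mult_right_mono) auto
      also have "\<dots> < c * (norm u + norm v + 1)" using c0 by (simp add: algebra_simps)
      also have "\<dots> = min r d" unfolding c_def
        by (simp add: add_nonneg_pos less_imp_neq add_nonneg_pos[THEN less_imp_neq[symmetric]] neq_commute)
      finally show ?thesis by (simp add: dist_norm)
    qed
    then have inS: "x + s *\<^sub>R u + t *\<^sub>R v \<in> S" if "0 \<le> s" "s \<le> h" "0 \<le> t" "t \<le> h" "h < c" for s t h
      using that r by (metis dist_commute mem_ball min_less_iff_conj subsetD)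
    have main: "dist ((f (x + h *\<^sub>R u + h *\<^sub>R v) - f (x + h *\<^sub>R u) - f (x + h *\<^sub>R v) + f x) / h\<^sup>2) (G x) < e"
      if h: "0 < h" "h < c" for h
    proof -
      define g where "g s = f (x + s *\<^sub>R u + h *\<^sub>R v) - f (x + s *\<^sub>R u)" for s
      have fd: "(f has_derivative FD f y) (at y)" if "y \<in> S" for y
        using smooth_on_has_derivative[OF assms(1,2) that] .
      have line: "((\<lambda>s. f (a + s *\<^sub>R u)) has_real_derivative FD f (a + s *\<^sub>R u) u) (at s)"
        if "a + s *\<^sub>R u \<in> S" for a s
      proof -
        have "((\<lambda>s. a + s *\<^sub>R u) has_derivative (\<lambda>s. s *\<^sub>R u)) (at s)"
          by (auto intro!: derivative_eq_intros)
        from diff_chain_at[OF this fd[OF that]]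
        have "((\<lambda>s. f (a + s *\<^sub>R u)) has_derivative (\<lambda>t. FD f (a + s *\<^sub>R u) (t *\<^sub>R u))) (at s)" by (simp add: o_def)
        moreover have "FD f (a + s *\<^sub>R u) (t *\<^sub>R u) = t * FD f (a + s *\<^sub>R u) u" for t
          using linear_scale[OF has_derivative_linear[OF fd[OF that]]] by simp
        ultimately show ?thesis unfolding has_field_derivative_def
          by (elim has_derivative_eq_rhs) (simp add: fun_eq_iff mult.commute)
      qed
      \<comment> \<open>The mean value theorem is used twice: in direction \<open>u\<close> on the
        difference \<open>g\<close>, then in direction \<open>v\<close> on the resulting derivative,
        so that the quotient becomes a value of \<open>G\<close> at a nearby point.\<close>
      have "\<exists>s. 0 < s \<and> s < h \<and> g h - g 0 = (h - 0) * (FD f (x + s *\<^sub>R u + h *\<^sub>R v) u - FD f (x + s *\<^sub>R u) u)"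
      proof (rule MVT2)
        fix s assume s: "0 \<le> s" "s \<le> h"
        have "x + h *\<^sub>R v + s *\<^sub>R u \<in> S" "x + s *\<^sub>R u \<in> S"
          using inS[of s h h] inS[of s h 0] s h by (auto simp: algebra_simps)
        from DERIV_diff[OF line[OF this(1)] line[OF this(2)]]
        show "(g has_real_derivative (FD f (x + s *\<^sub>R u + h *\<^sub>R v) u - FD f (x + s *\<^sub>R u) u)) (at s)"
          unfolding g_def by (simp add: algebra_simps)
      qed (use h in auto)
      then obtain s where s: "0 < s" "s < h"
        "g h - g 0 = h * (FD f (x + s *\<^sub>R u + h *\<^sub>R v) u - FD f (x + s *\<^sub>R u) u)" by auto
      have "\<exists>t. 0 < t \<and> t < h \<and> FD f (x + s *\<^sub>R u + h *\<^sub>R v) u - FD f (x + s *\<^sub>R u + 0 *\<^sub>R v) u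
          = (h - 0) * G (x + s *\<^sub>R u + t *\<^sub>R v)"
      proof (rule MVT2)
        fix t assume t: "0 \<le> t" "t \<le> h"
        let ?y = "x + s *\<^sub>R u + t *\<^sub>R v"
        have y: "?y \<in> S" using inS[of s h t] s t h by auto
        have D: "((\<lambda>y. FD f y u) has_derivative (\<lambda>w. FD (\<lambda>y. FD f y u) ?y w)) (at ?y)"
          using smooth_on_has_derivative[OF assms(1) smooth_on_FD[OF assms(2)] y] .
        have "((\<lambda>t. x + s *\<^sub>R u + t *\<^sub>R v) has_derivative (\<lambda>t. t *\<^sub>R v)) (at t)"
          by (auto intro!: derivative_eq_intros)
        from diff_chain_at[OF this D]
        have "((\<lambda>t. FD f (x + s *\<^sub>R u + t *\<^sub>R v) u) has_derivative (\<lambda>k. FD (\<lambda>y. FD f y u) ?y (k *\<^sub>R v))) (at t)"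
          by (simp add: o_def)
        moreover have "FD (\<lambda>y. FD f y u) ?y (k *\<^sub>R v) = k * G ?y" for k
          unfolding G_def using linear_scale[OF has_derivative_linear[OF D]] by simp
        ultimately show "((\<lambda>t. FD f (x + s *\<^sub>R u + t *\<^sub>R v) u) has_real_derivative G ?y) (at t)"
          unfolding has_field_derivative_def
          by (elim has_derivative_eq_rhs) (simp add: fun_eq_iff mult.commute)
      qed (use h in auto)
      then obtain t where t: "0 < t" "t < h" "FD f (x + s *\<^sub>R u + h *\<^sub>R v) u - FD f (x + s *\<^sub>R u) u
          = h * G (x + s *\<^sub>R u + t *\<^sub>R v)" by auto
      have "g h - g 0 = h\<^sup>2 * G (x + s *\<^sub>R u + t *\<^sub>R v)" using s(3) t(3) by (simp add: power2_eq_square)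
      then have "(f (x + h *\<^sub>R u + h *\<^sub>R v) - f (x + h *\<^sub>R u) - f (x + h *\<^sub>R v) + f x) / h\<^sup>2
        = G (x + s *\<^sub>R u + t *\<^sub>R v)"
        unfolding g_def using h by (simp add: field_simps)
      then show ?thesis using d(2)[of "x + s *\<^sub>R u + t *\<^sub>R v"] near[of s h t] s t h by auto
    qed
    show "\<forall>\<^sub>F h in at_right 0. dist ((f (x + h *\<^sub>R u + h *\<^sub>R v) - f (x + h *\<^sub>R u) - f (x + h *\<^sub>R v) + f x) / h\<^sup>2)
        (FD (\<lambda>y. FD f y u) x v) < e"
      using main c0 unfolding G_def eventually_at_right_field by blast
  qed
qed

text \<open>The mean value theorem gives an exact value only for real functions, so the symmetry is
  checked on each coordinate.\<close>

lemma FD_FD_commute: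
  fixes f :: "'a::real_normed_vector \<Rightarrow> 'b::euclidean_space"
  assumes "open S" "smooth_on f S" "x \<in> S"
  shows "FD (\<lambda>y. FD f y u) x v = FD (\<lambda>y. FD f y v) x u"
proof -
  have real: "FD (\<lambda>y. FD h y u) x v = FD (\<lambda>y. FD h y v) x u" if "smooth_on h S" for h :: "'a \<Rightarrow> real"
  proof (rule tendsto_unique)
    show "((\<lambda>t. (h (x + t *\<^sub>R u + t *\<^sub>R v) - h (x + t *\<^sub>R u) - h (x + t *\<^sub>R v) + h x) / t\<^sup>2)
           \<longlongrightarrow> FD (\<lambda>y. FD h y u) x v) (at_right 0)"
      by (rule second_difference_tendsto[OF assms(1) that assms(3)])
    show "((\<lambda>t. (h (x + t *\<^sub>R u + t *\<^sub>R v) - h (x + t *\<^sub>R u) - h (x + t *\<^sub>R v) + h x) / t\<^sup>2)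
           \<longlongrightarrow> FD (\<lambda>y. FD h y v) x u) (at_right 0)"
      using second_difference_tendsto[OF assms(1) that assms(3), of v u]
      by (simp add: algebra_simps)
  qed simp
  have inner: "FD (\<lambda>y. FD (\<lambda>z. f z \<bullet> b) y p) x q = FD (\<lambda>y. FD f y p) x q \<bullet> b" for b p q
  proof (rule FD_cong_open[OF assms(1,3)])
    show "FD f y p \<bullet> b = FD (\<lambda>z. f z \<bullet> b) y p" if "y \<in> S" for y
      by (rule FD_bounded_linear[OF assms(1) bounded_linear_inner_left assms(2) that, symmetric])
    show "((\<lambda>y. FD f y p \<bullet> b) has_derivative (\<lambda>q. FD (\<lambda>y. FD f y p) x q \<bullet> b)) (at x)"
      by (rule bounded_linear.has_derivative[OF bounded_linear_inner_left])
        (rule smooth_on_has_derivative[OF assms(1) smooth_on_FD[OF assms(2)] assms(3)])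
  qed
  show ?thesis
  proof (rule euclidean_eqI)
    fix b :: 'b assume "b \<in> Basis"
    show "FD (\<lambda>y. FD f y u) x v \<bullet> b = FD (\<lambda>y. FD f y v) x u \<bullet> b"
      using real[OF smooth_on_bounded_linear[OF assms(1) bounded_linear_inner_left assms(2)], of b]
      unfolding inner .
  qed
qed

text \<open>The line through \<open>x\<close> in direction \<open>u\<close> stays in
  \<open>L\<close>, so \<open>h\<close> vanishes along it near \<open>x\<close>. The identities of
  \<open>cr_map_pair\<close>, which hold on a slice only, are differentiated through this lemma;
  nothing is claimed for directions transverse to \<open>L\<close>.\<close>

lemma has_derivative_zero_on_slice:
  fixes h :: "'a::real_normed_vector \<Rightarrow> 'b::real_normed_vector"
  assumes "open S" "subspace L" "x \<in> S \<inter> L" "u \<in> L"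
    and "\<And>y. y \<in> S \<inter> L \<Longrightarrow> h y = 0" "(h has_derivative h') (at x)"
  shows "h' u = 0"
proof -
  have l: "((\<lambda>s::real. x + s *\<^sub>R u) has_derivative (\<lambda>s. s *\<^sub>R u)) (at 0)"
    by (auto intro!: derivative_eq_intros)
  have "((\<lambda>s::real. h (x + s *\<^sub>R u)) has_derivative (\<lambda>s. h' (s *\<^sub>R u))) (at 0)"
    using diff_chain_at[OF l, of h h'] assms(6) by (simp add: o_def)
  moreover have "((\<lambda>s::real. h (x + s *\<^sub>R u)) has_derivative (\<lambda>s. 0)) (at 0)"
  proof (rule has_derivative_transform_within_open[where f = "\<lambda>s::real. 0" and s = "(\<lambda>s::real. x + s *\<^sub>R u) -` S"])
    show "open ((\<lambda>s::real. x + s *\<^sub>R u) -` S)"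
      by (rule open_vimage[OF assms(1)]) (intro continuous_intros)
    show "0 = h (x + s *\<^sub>R u)" if "s \<in> (\<lambda>s::real. x + s *\<^sub>R u) -` S" for s
      using that assms(2-5) by (simp add: subspace_add subspace_mul)
  qed (use assms in auto)
  ultimately have "(\<lambda>s::real. h' (s *\<^sub>R u)) = (\<lambda>s. 0)" by (rule has_derivative_unique)
  then show ?thesis by (metis scaleR_one)
qed

lemma smooth_on_sum:
  "open S \<Longrightarrow> (\<And>i. i \<in> I \<Longrightarrow> smooth_on (f i) S) \<Longrightarrow> smooth_on (\<lambda>x. \<Sum>i\<in>I. f i x) S"
  unfolding smooth_on_def by (auto intro!: Ck_on_sum)

lemma smooth_on_Pair:
  assumes "open S" "smooth_on f S" "smooth_on g S"
  shows "smooth_on (\<lambda>x. (f x, g x)) S"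
proof -
  have "smooth_on (\<lambda>x. (f x, 0) + (0, g x)) S"
    by (rule smooth_on_add[OF assms(1) smooth_on_bounded_linear[OF assms(1) _ assms(2)]
          smooth_on_bounded_linear[OF assms(1) _ assms(3)]])
      (auto intro!: bounded_linear_Pair bounded_linear_ident bounded_linear_zero)
  then show ?thesis by simp
qed

lemma smooth_on_apply:
  fixes F :: "'c::real_normed_vector \<Rightarrow> 'a::euclidean_space \<Rightarrow> 'b::real_normed_vector"
  assumes "open S" "\<And>v. smooth_on (\<lambda>x. F x v) S" "smooth_on Y S" "\<And>x. x \<in> S \<Longrightarrow> linear (F x)"
  shows "smooth_on (\<lambda>x. F x (Y x)) S"
proof -
  have s: "smooth_on (\<lambda>x. \<Sum>b\<in>Basis. (Y x \<bullet> b) *\<^sub>R F x b) S"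
    by (intro smooth_on_sum[OF assms(1)] smooth_on_bounded_bilinear[OF assms(1) bounded_bilinear_scaleR]
        smooth_on_bounded_linear[OF assms(1) bounded_linear_inner_left] assms)
  have eq: "(\<Sum>b\<in>Basis. (Y x \<bullet> b) *\<^sub>R F x b) = F x (Y x)" if "x \<in> S" for x
    by (rule linear_euclidean_sum[OF assms(4)[OF that], symmetric])
  show ?thesis unfolding smooth_on_def
    by (intro allI Ck_on_cong[OF assms(1) eq s[unfolded smooth_on_def, THEN spec]])
qed

text \<open>A basis expansion of the moving vector reduces this to the product rule for scalars
  times the known derivatives at fixed vectors.\<close>

lemma has_derivative_apply:
  fixes \<phi> :: "'c::real_normed_vector \<Rightarrow> 'a::euclidean_space" and F :: "'c \<Rightarrow> 'a \<Rightarrow> 'b::real_normed_vector"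
  assumes F: "\<And>v. ((\<lambda>y. F y v) has_derivative (\<lambda>u. F' u v)) (at x)"
    and S: "open S" "x \<in> S" and lin: "\<And>y. y \<in> S \<Longrightarrow> linear (F y)"
    and phi: "(\<phi> has_derivative \<phi>') (at x)"
  shows "((\<lambda>y. F y (\<phi> y)) has_derivative (\<lambda>u. F' u (\<phi> x) + F x (\<phi>' u))) (at x)"
proof -
  have d: "((\<lambda>y. \<Sum>b\<in>Basis. (\<phi> y \<bullet> b) *\<^sub>R F y b) has_derivative
     (\<lambda>u. \<Sum>b\<in>Basis. (\<phi> x \<bullet> b) *\<^sub>R F' u b + (\<phi>' u \<bullet> b) *\<^sub>R F x b)) (at x)"
    by (intro has_derivative_sum has_derivative_scaleR F has_derivative_inner_left phi)
  have e: "((\<lambda>y. \<Sum>b\<in>Basis. (\<phi> x \<bullet> b) *\<^sub>R F y b) has_derivative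
     (\<lambda>u. \<Sum>b\<in>Basis. (\<phi> x \<bullet> b) *\<^sub>R F' u b)) (at x)"
    by (intro has_derivative_sum has_derivative_scaleR_right F)
  have "((\<lambda>y. F y (\<phi> x)) has_derivative (\<lambda>u. \<Sum>b\<in>Basis. (\<phi> x \<bullet> b) *\<^sub>R F' u b)) (at x)"
    by (rule has_derivative_transform_within_open[OF e S]) (use linear_euclidean_sum[OF lin] in auto)
  \<comment> \<open>Linearity of \<open>F' u\<close> in its vector argument is not assumed;
    uniqueness of derivatives yields what is needed of it at \<open>\<phi> x\<close>.\<close>
  from has_derivative_unique[OF this F]
  have F'x: "(\<Sum>b\<in>Basis. (\<phi> x \<bullet> b) *\<^sub>R F' u b) = F' u (\<phi> x)" for u by metis
  have "((\<lambda>y. F y (\<phi> y)) has_derivative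
     (\<lambda>u. \<Sum>b\<in>Basis. (\<phi> x \<bullet> b) *\<^sub>R F' u b + (\<phi>' u \<bullet> b) *\<^sub>R F x b)) (at x)"
    by (rule has_derivative_transform_within_open[OF d S]) (use linear_euclidean_sum[OF lin] in auto)
  then show ?thesis
    by (rule has_derivative_eq_rhs) (simp add: fun_eq_iff sum.distrib F'x linear_euclidean_sum[OF lin[OF S(2)], symmetric])
qed

text \<open>Testing membership by scalar products with the orthogonal complement turns it into
  equations, and equations can be differentiated along a slice.\<close>

lemma mem_subspace_if_perp:
  fixes s :: "'a::euclidean_space"
  assumes "subspace L" "\<And>p. (\<And>q. q \<in> L \<Longrightarrow> q \<bullet> p = 0) \<Longrightarrow> s \<bullet> p = 0"
  shows "s \<in> L"
proof -
  obtain y z where yz: "y \<in> span L" "\<And>w. w \<in> span L \<Longrightarrow> orthogonal z w" "s = y + z"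
    using orthogonal_subspace_decomp_exists by blast
  have "s \<bullet> z = 0" using assms(2)[of z] yz(2) by (metis inner_commute orthogonal_def span_base)
  moreover have "y \<bullet> z = 0" using yz(1,2) by (metis inner_commute orthogonal_def)
  ultimately have "z = 0" unfolding yz(3) by (simp add: inner_add_left)
  then show ?thesis using yz assms(1) span_eq_iff by fastforce
qed

text \<open>Since \<open>\<alpha>\<close> vanishes at \<open>x\<close> and is of order
  \<open>norm (y - x)\<close>, continuity of \<open>\<beta>\<close> at \<open>x\<close> suffices for
  the product rule. This is what allows a merely continuous field of unitary maps to be
  differentiated in \<open>local_rigidity\<close>.\<close>

lemma has_derivative_vanishing_scaleR:
  fixes \<alpha> :: "'a::real_normed_vector \<Rightarrow> real" and \<beta> :: "'a \<Rightarrow> 'b::real_normed_vector"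
  assumes \<alpha>: "(\<alpha> has_derivative \<alpha>') (at x within S)" "\<alpha> x = 0"
    and \<beta>: "(\<beta> \<longlongrightarrow> \<beta> x) (at x within S)"
  shows "((\<lambda>y. \<alpha> y *\<^sub>R \<beta> y) has_derivative (\<lambda>h. \<alpha>' h *\<^sub>R \<beta> x)) (at x within S)"
proof -
  have 1: "((\<lambda>y. \<alpha> y *\<^sub>R \<beta> x) has_derivative (\<lambda>h. \<alpha>' h *\<^sub>R \<beta> x)) (at x within S)"
    by (rule has_derivative_scaleR_left[OF \<alpha>(1)])
  have "((\<lambda>y. \<alpha> y *\<^sub>R (\<beta> y - \<beta> x)) has_derivative (\<lambda>h. 0)) (at x within S)"
    unfolding has_derivative_within_alt2
  proof (intro conjI allI impI)
    fix e :: real assume e: "e > 0"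
    obtain B where B: "B > 0" "\<And>h. norm (\<alpha>' h) \<le> norm h * B"
      using has_derivative_bounded_linear[OF \<alpha>(1)] bounded_linear.pos_bounded by blast
    have "\<forall>\<^sub>F y in at x within S. norm (\<alpha> y - \<alpha> x - \<alpha>' (y - x)) \<le> 1 * norm (y - x)"
      using \<alpha>(1) unfolding has_derivative_within_alt2 by (metis zero_less_one)
    moreover have "\<forall>\<^sub>F y in at x within S. dist (\<beta> y) (\<beta> x) < e / (B + 1)"
      using \<beta> e B(1) unfolding tendsto_iff by simp
    ultimately show "\<forall>\<^sub>F y in at x within S.
       norm (\<alpha> y *\<^sub>R (\<beta> y - \<beta> x) - \<alpha> x *\<^sub>R (\<beta> x - \<beta> x) - 0) \<le> e * norm (y - x)"
    proof eventually_elim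
      case (elim y)
      have "\<bar>\<alpha> y\<bar> \<le> norm (y - x) * (B + 1)"
        using elim(1) B(2)[of "y - x"] \<alpha>(2) by (simp add: algebra_simps)
      then have "\<bar>\<alpha> y\<bar> * norm (\<beta> y - \<beta> x) \<le> norm (y - x) * (B + 1) * (e / (B + 1))"
        using elim(2) B(1) by (intro mult_mono) (auto simp: dist_norm)
      also have "\<dots> = e * norm (y - x)" using B(1) by simp
      finally show ?case by simp
    qed
  qed simp
  from has_derivative_add[OF 1 this] show ?thesis by (simp add: scaleR_diff_right)
qed

text \<open>Inside \<open>S\<close> only increments \<open>y - x\<close> in \<open>L\<close> occur,
  so the values of \<open>h'\<close> elsewhere are invisible.\<close>

lemma has_derivative_zero_within_subspace:
  assumes h: "(h has_derivative h') (at x within S)" and L: "subspace L" "S \<subseteq> L" "x \<in> S"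
    and 0: "\<And>u. u \<in> L \<Longrightarrow> h' u = 0"
  shows "(h has_derivative (\<lambda>_. 0)) (at x within S)"
proof -
  have "\<forall>\<^sub>F y in at x within S. norm (h y - h x - 0) \<le> e * norm (y - x)" if "e > 0" for e
  proof -
    have "\<forall>\<^sub>F y in at x within S. norm (h y - h x - h' (y - x)) \<le> e * norm (y - x)"
      using h that unfolding has_derivative_within_alt2 by blast
    moreover have "\<forall>\<^sub>F y in at x within S. y \<in> S" by (simp add: eventually_at_filter)
    ultimately show ?thesis
    proof eventually_elim
      case (elim y)
      then have "h' (y - x) = 0" using 0 L subspace_diff by blast
      then show ?case using elim(1) by simp
    qed
  qed
  then show ?thesis unfolding has_derivative_within_alt2 by simp
qed

lemma isometry_inner:
  fixes U :: "'a::euclidean_space \<Rightarrow> 'a"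
  assumes "linear U" "\<And>p. norm (U p) = norm p"
  shows "U p \<bullet> U q = p \<bullet> q"
proof -
  have "orthogonal_transformation U" using assms orthogonal_transformation by blast
  then show ?thesis unfolding orthogonal_transformation_def by blast
qed

lemma has_derivative_zero_eq:
  assumes "convex S" "\<And>x. x \<in> S \<Longrightarrow> (h has_derivative (\<lambda>_. 0)) (at x within S)" "x \<in> S" "y \<in> S"
  shows "h y = h x"
  using has_derivative_zero_constant[OF assms(1,2)] assms(3,4) by metis

section \<open>Pairs of CR jets\<close>

text \<open>After multiplication by \<open>R * R'\<close> the last hypothesis collapses to
  \<open>del\<close> times the sum of \<open>4 * R * R'\<close> and twice two squares, and this
  factor is positive. The quantities are those of \<open>del_zero\<close>: \<open>R\<close> and
  \<open>R'\<close> are the squared lengths of \<open>A T\<close> and \<open>B T\<close>, while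
  \<open>c\<close>, \<open>d\<close>, \<open>e\<close> are values of \<open>eta\<close> and
  \<open>s\<close>, \<open>l\<close> components of a second derivative.\<close>

lemma gauss_algebra:
  fixes R R' del c d e s l :: real
  assumes "R > 0" "R' > 0" "R' = R + del"
    and "((s + del * (e - 1))\<^sup>2 + l\<^sup>2 - (l + c * R + del * c) * (d * R - l + del * d)
           - (e * R - s + del) * (s - (e - 2) * R + del)) / R'
       - (s\<^sup>2 + l\<^sup>2 - (l + c * R) * (d * R - l) - (e * R - s) * (s - (e - 2) * R)) / R
       = del * (2 - (e - 2) + e * (e - 1) - d * c)"
  shows "del = 0"
proof -
  have "((s + del * (e - 1))\<^sup>2 + l\<^sup>2 - (l + c * R + del * c) * (d * R - l + del * d)
           - (e * R - s + del) * (s - (e - 2) * R + del)) * R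
       - (s\<^sup>2 + l\<^sup>2 - (l + c * R) * (d * R - l) - (e * R - s) * (s - (e - 2) * R)) * R'
       = del * (2 - (e - 2) + e * (e - 1) - d * c) * (R * R')"
  proof -
    have "X / R' - Y / R = Z \<Longrightarrow> X * R - Y * R' = Z * (R * R')" for X Y Z
      using assms(1,2) by (auto simp: field_simps)
    from this[OF assms(4)] show ?thesis .
  qed
  then have "del * (4 * R * R' + 2 * ((s - (e - 1) * R)\<^sup>2 + l\<^sup>2)) = 0"
    unfolding assms(3) by algebra
  moreover have "4 * R * R' + 2 * ((s - (e - 1) * R)\<^sup>2 + l\<^sup>2) > 0"
    using assms(1,2) by (simp add: add_pos_nonneg)
  ultimately show ?thesis by simp
qed

locale hermitian_space =
  fixes J :: "'f::euclidean_space \<Rightarrow> 'f"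
  assumes J_linear: "linear J"
    and J_J: "J (J p) = - p"
    and J_inner: "J p \<bullet> J q = p \<bullet> q"
begin

lemma J_skew: "J p \<bullet> q = - (p \<bullet> J q)"
  using J_inner[of "J p" q] J_J by simp

lemma J_inner_self: "J p \<bullet> p = 0" "p \<bullet> J p = 0"
  using J_skew[of p p] by (auto simp: inner_commute)

end

text \<open>The 2-jets at one point of two maps into a Hermitian space: \<open>A, B\<close> are the first and
  \<open>a, b\<close> the second derivatives, \<open>th\<close> is the common pulled back contact form and \<open>eta\<close> its derivative.
  \<open>j\<close> is the CR structure and \<open>T\<close> the Reeb direction, so \<open>A T\<close> and \<open>B T\<close> represent the two
  fundamental vector fields.  The last assumption is the derivative of \<open>A (j v) = J (A v)\<close> and
  \<open>B (j v) = J (B v)\<close>; the witness \<open>z\<close> is the derivative of \<open>j v\<close>.\<close>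
locale cr_jet_pair = hermitian_space J for J :: "'f::euclidean_space \<Rightarrow> 'f" +
  fixes L :: "'e::euclidean_space set" and A B :: "'e \<Rightarrow> 'f" and th :: "'e \<Rightarrow> real"
    and a b :: "'e \<Rightarrow> 'e \<Rightarrow> 'f" and eta :: "'e \<Rightarrow> 'e \<Rightarrow> real" and j :: "'e \<Rightarrow> 'e" and T :: 'e
  assumes L: "subspace L" and linA: "linear A" and linB: "linear B" and linth: "linear th"
    and lina: "linear (a u)" and linb: "linear (b u)"
    and a_sym: "a u v = a v u" and b_sym: "b u v = b v u"
    and symp: "\<lbrakk>v \<in> L; w \<in> L\<rbrakk> \<Longrightarrow> J (A v) \<bullet> A w = J (B v) \<bullet> B w"
    and dsymp: "\<lbrakk>u \<in> L; v \<in> L; w \<in> L\<rbrakk> \<Longrightarrow>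
      J (a u v) \<bullet> A w + J (A v) \<bullet> a u w = J (b u v) \<bullet> B w + J (B v) \<bullet> b u w"
    and eta_alt: "\<lbrakk>u \<in> L; v \<in> L\<rbrakk> \<Longrightarrow> eta u v - eta v u = 2 * (J (A u) \<bullet> A v)"
    and j_in: "\<lbrakk>v \<in> L; th v = 0\<rbrakk> \<Longrightarrow> j v \<in> L" and th_j: "\<lbrakk>v \<in> L; th v = 0\<rbrakk> \<Longrightarrow> th (j v) = 0"
    and j_j: "\<lbrakk>v \<in> L; th v = 0\<rbrakk> \<Longrightarrow> j (j v) = - v"
    and A_j: "\<lbrakk>v \<in> L; th v = 0\<rbrakk> \<Longrightarrow> A (j v) = J (A v)"
    and B_j: "\<lbrakk>v \<in> L; th v = 0\<rbrakk> \<Longrightarrow> B (j v) = J (B v)"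
    and T_in: "T \<in> L" and th_T: "th T = 1"
    and AT_perp: "\<lbrakk>v \<in> L; th v = 0\<rbrakk> \<Longrightarrow> A T \<bullet> A v = 0"
    and AT_nz: "A T \<noteq> 0" and BT_nz: "B T \<noteq> 0"
    and A_inj: "\<lbrakk>v \<in> L; th v = 0; A v = 0\<rbrakk> \<Longrightarrow> v = 0"
    and dim_K: "dim {v\<in>L. th v = 0} + 2 = DIM('f)"
    and dCR: "\<lbrakk>u \<in> L; v \<in> L; th v = 0\<rbrakk> \<Longrightarrow> \<exists>z\<in>L. th z = - eta u (j v)
      \<and> a u (j v) = J (a u v) - eta u v *\<^sub>R J (A T) - A z
      \<and> b u (j v) = J (b u v) - eta u v *\<^sub>R J (B T) - B z"
begin

definition K where "K = {v\<in>L. th v = 0}"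

text \<open>Each of the two terms is a Christoffel symbol of the first kind of an induced
  metric.\<close>

definition Q where "Q u v w = b u v \<bullet> B w - a u v \<bullet> A w"

definition del where "del = (B T \<bullet> B T) - (A T \<bullet> A T)"

section \<open>The contact hyperplane and its complement spanned by \<open>T\<close>\<close>

lemma K_L: "v \<in> K \<Longrightarrow> v \<in> L" unfolding K_def by simp

lemma K_th: "v \<in> K \<Longrightarrow> th v = 0" unfolding K_def by simp

lemma K_subspace: "subspace K"
  using L linth unfolding K_def subspace_def
  by (auto simp: linear_add linear_scale linear_0)

lemma j_K: "v \<in> K \<Longrightarrow> j v \<in> K" using j_in th_j unfolding K_def by simp

lemma j_j_K: "v \<in> K \<Longrightarrow> j (j v) = - v" using j_j unfolding K_def by simp

lemma A_j_K: "v \<in> K \<Longrightarrow> A (j v) = J (A v)" using A_j unfolding K_def by simp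

lemma B_j_K: "v \<in> K \<Longrightarrow> B (j v) = J (B v)" using B_j unfolding K_def by simp

text \<open>Inserting \<open>j w\<close> in \<open>symp\<close> turns the common Kaehler form into a
  common metric, as both maps carry \<open>j\<close> to \<open>J\<close>. One horizontal argument is
  enough, so the only inner product left open is that of \<open>T\<close> with itself, measured by
  \<open>del\<close>.\<close>

lemma inner_K:
  assumes "v \<in> L" "w \<in> K"
  shows "A v \<bullet> A w = B v \<bullet> B w"
  using symp[OF assms(1) K_L[OF j_K[OF assms(2)]]] by (simp add: A_j_K B_j_K assms J_inner)

lemma B_inj: "v \<in> K \<Longrightarrow> B v = 0 \<Longrightarrow> v = 0"
  using inner_K[of v v] A_inj[of v] K_L K_th by auto

lemma BT_perp: "v \<in> K \<Longrightarrow> B T \<bullet> B v = 0"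
  using inner_K[OF T_in] AT_perp K_L K_th by metis

lemma L_decomp: assumes "v \<in> L" obtains k where "k \<in> K" "v = k + th v *\<^sub>R T"
proof
  show "v - th v *\<^sub>R T \<in> K" unfolding K_def using assms T_in L linth th_T
    by (simp add: subspace_diff subspace_mul linear_diff linear_scale)
qed simp

lemma A_T_J: "v \<in> K \<Longrightarrow> J (A T) \<bullet> A v = 0"
  using AT_perp[OF K_L[OF j_K] K_th[OF j_K]] A_j_K J_skew by simp

lemma B_T_J: "v \<in> K \<Longrightarrow> J (B T) \<bullet> B v = 0"
  using BT_perp[OF j_K] B_j_K J_skew by simp

lemma linear_L_decomp:
  assumes "linear M" "v \<in> L"
  obtains k where "k \<in> K" "M v = M k + th v *\<^sub>R M T"
  using L_decomp[OF assms(2)] by (metis assms(1) linear_add linear_scale)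

lemma A_inner_T: assumes "v \<in> L" shows "A v \<bullet> A T = th v * (A T \<bullet> A T)"
proof -
  obtain k where "k \<in> K" "A v = A k + th v *\<^sub>R A T" using linear_L_decomp[OF linA assms] .
  then show ?thesis using AT_perp[OF K_L K_th, of k] by (simp add: inner_add_left inner_commute[of "A k"])
qed

lemma B_inner_T: assumes "v \<in> L" shows "B v \<bullet> B T = th v * (B T \<bullet> B T)"
proof -
  obtain k where "k \<in> K" "B v = B k + th v *\<^sub>R B T" using linear_L_decomp[OF linB assms] .
  then show ?thesis using BT_perp[of k] by (simp add: inner_add_left inner_commute[of "B k"])
qed

text \<open>\<open>J (A T)\<close> is normal to the hypersurface, so
  \<open>a u v \<bullet> J (A T)\<close> is its second fundamental form up to normalization.\<close>

lemma A_inner_JT: assumes "v \<in> L" shows "A v \<bullet> J (A T) = 0"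
proof -
  obtain k where "k \<in> K" "A v = A k + th v *\<^sub>R A T" using linear_L_decomp[OF linA assms] .
  then show ?thesis using A_T_J[of k] by (simp add: inner_add_left inner_commute[of "A k"] J_inner_self)
qed

lemma B_inner_JT: assumes "v \<in> L" shows "B v \<bullet> J (B T) = 0"
proof -
  obtain k where "k \<in> K" "B v = B k + th v *\<^sub>R B T" using linear_L_decomp[OF linB assms] .
  then show ?thesis using B_T_J[of k] by (simp add: inner_add_left inner_commute[of "B k"] J_inner_self)
qed

section \<open>Tangential and normal differences of the second derivatives\<close>

lemma Q_sym: "Q u v w = Q v u w" unfolding Q_def using a_sym[of u v] b_sym[of u v] by simp

lemma Q_minus: "Q u v (- w) = - Q u v w"
  unfolding Q_def by (simp add: linear_neg[OF linA] linear_neg[OF linB])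

text \<open>Pairing the two identities of \<open>dCR\<close> with horizontal vectors kills the
  \<open>eta\<close> terms, since \<open>J (A T)\<close> and \<open>J (B T)\<close> are normal, and
  the terms in \<open>z\<close> cancel because the metrics agree there.\<close>

lemma Q_j:
  assumes "u \<in> L" "v \<in> K" "w \<in> K"
  shows "Q u (j v) w = - Q u v (j w)"
proof -
  obtain z where z: "z \<in> L"
    "a u (j v) = J (a u v) - eta u v *\<^sub>R J (A T) - A z"
    "b u (j v) = J (b u v) - eta u v *\<^sub>R J (B T) - B z"
    using dCR[OF assms(1) K_L[OF assms(2)] K_th[OF assms(2)]] by blast
  have "a u (j v) \<bullet> A w = - (a u v \<bullet> A (j w)) - A z \<bullet> A w"
    unfolding z(2) using A_T_J[OF assms(3)] by (simp add: inner_diff_left J_skew A_j_K assms)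
  moreover have "b u (j v) \<bullet> B w = - (b u v \<bullet> B (j w)) - B z \<bullet> B w"
    unfolding z(3) using B_T_J[OF assms(3)] by (simp add: inner_diff_left J_skew B_j_K assms)
  ultimately show ?thesis unfolding Q_def using inner_K[OF z(1) assms(3)] by simp
qed

text \<open>This is the derivative of the common Kaehler form, with \<open>J\<close> moved onto the
  first derivatives, where it becomes \<open>j\<close>.\<close>

lemma Q_symp:
  assumes "u \<in> L" "v \<in> K" "w \<in> K"
  shows "Q u v (j w) = Q u w (j v)"
  using dsymp[OF assms(1) K_L[OF assms(2)] K_L[OF assms(3)]] assms
  unfolding Q_def by (simp add: A_j_K B_j_K J_skew inner_commute)

text \<open>\<open>P u v w = Q u v (j w)\<close> is totally symmetric, and moving \<open>j\<close> from one slot to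
  another changes the sign; three such moves return to the start.\<close>
lemma Q_zero:
  assumes "u \<in> K" "v \<in> K" "w \<in> K"
  shows "Q u v w = 0"
proof -
  note [simp] = K_L j_K
  have P: "Q x y (j (j z)) = - Q x (j y) (j z)" if "x \<in> K" "y \<in> K" "z \<in> K" for x y z
    using Q_j[of x y "j z"] that by simp
  have s: "Q x y (j z) = Q x z (j y)" if "x \<in> K" "y \<in> K" "z \<in> K" for x y z
    using Q_symp that by simp
  have "Q u v (j (j w)) = - Q u (j v) (j w)" using P assms by simp
  also have "\<dots> = - Q (j v) w (j u)" using s[of "j v" u w] Q_sym assms by (metis j_K)
  also have "\<dots> = - Q w (j v) (j u)" using Q_sym by metis
  also have "\<dots> = Q w v (j (j u))" using P[of w v u] assms by simp
  also have "\<dots> = Q v w (j (j u))" using Q_sym by metis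
  also have "\<dots> = - Q v (j w) (j u)" using P[of v w u] assms by simp
  also have "\<dots> = - Q v u (j (j w))" using s[of v "j w" u] assms by simp
  also have "\<dots> = - Q u v (j (j w))" using Q_sym by metis
  finally have "Q u v (j (j w)) = 0" by simp
  then show ?thesis using j_j_K assms Q_minus by simp
qed

text \<open>\<open>dCR\<close> is paired with the normal \<open>J (A T)\<close>, to which
  \<open>A z\<close> is orthogonal, and with \<open>A T\<close>, where \<open>A z\<close>
  contributes through \<open>th z = - eta u (j v)\<close>; likewise for \<open>B\<close>. The CR
  condition thus trades normal components for components along \<open>A T\<close> and
  \<open>B T\<close>.\<close>

lemma aJT:
  assumes "u \<in> L" "v \<in> K"
  shows "a u (j v) \<bullet> J (A T) = a u v \<bullet> A T - eta u v * (A T \<bullet> A T)"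
    and "b u (j v) \<bullet> J (B T) = b u v \<bullet> B T - eta u v * (B T \<bullet> B T)"
    and "a u v \<bullet> J (A T) = - (a u (j v) \<bullet> A T) + eta u (j v) * (A T \<bullet> A T)"
    and "b u v \<bullet> J (B T) = - (b u (j v) \<bullet> B T) + eta u (j v) * (B T \<bullet> B T)"
proof -
  obtain z where z: "z \<in> L" "th z = - eta u (j v)"
    "a u (j v) = J (a u v) - eta u v *\<^sub>R J (A T) - A z"
    "b u (j v) = J (b u v) - eta u v *\<^sub>R J (B T) - B z"
    using dCR[OF assms(1) K_L[OF assms(2)] K_th[OF assms(2)]] by blast
  show "a u (j v) \<bullet> J (A T) = a u v \<bullet> A T - eta u v * (A T \<bullet> A T)"
    unfolding z(3) by (simp add: inner_diff_left J_inner A_inner_JT z)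
  show "b u (j v) \<bullet> J (B T) = b u v \<bullet> B T - eta u v * (B T \<bullet> B T)"
    unfolding z(4) by (simp add: inner_diff_left J_inner B_inner_JT z)
  show "a u v \<bullet> J (A T) = - (a u (j v) \<bullet> A T) + eta u (j v) * (A T \<bullet> A T)"
    unfolding z(3) by (simp add: inner_diff_left J_skew A_inner_T z J_inner_self)
  show "b u v \<bullet> J (B T) = - (b u (j v) \<bullet> B T) + eta u (j v) * (B T \<bullet> B T)"
    unfolding z(4) by (simp add: inner_diff_left J_skew B_inner_T z J_inner_self)
qed

text \<open>This is \<open>dsymp\<close> with \<open>T\<close> as its last argument: the term
  pairing a second derivative with \<open>T\<close> is the normal component, and the other term has
  \<open>T\<close> as a direction of differentiation.\<close>

lemma JT_component:
  assumes "u \<in> K" "v \<in> K"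
  shows "b u v \<bullet> J (B T) - a u v \<bullet> J (A T) = Q T u (j v)"
  using dsymp[OF K_L K_L T_in, OF assms] assms
  unfolding Q_def by (simp add: J_skew A_j_K B_j_K inner_commute a_sym[of T] b_sym[of T])

text \<open>\<open>Q T\<close> is skew on \<open>K\<close> by \<open>Q_symp\<close> and
  \<open>Q_j\<close>. Its skew part can also be computed from \<open>JT_component\<close> and
  \<open>aJT\<close>: there the symmetric second derivatives drop out, and
  \<open>eta v w - eta w v\<close>, twice the Kaehler form, remains with the factor
  \<open>del\<close>.\<close>

lemma Q_T: assumes "v \<in> K" "w \<in> K" shows "Q T v w = del * (J (A v) \<bullet> A w)"
proof -
  have *: "Q T v w = - (b v (j w) \<bullet> J (B T) - a v (j w) \<bullet> J (A T))"
    if "v \<in> K" "w \<in> K" for v w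
    using JT_component[of v "j w"] that j_j_K Q_minus j_K by simp
  have "Q T v w - Q T w v = (eta v w - eta w v) * del"
    unfolding *[OF assms] *[OF assms(2,1)] aJT(1,2)[OF K_L[OF assms(1)] assms(2)]
      aJT(1,2)[OF K_L[OF assms(2)] assms(1)] del_def a_sym[of w v] b_sym[of w v]
    by (simp add: algebra_simps)
  moreover have "Q T w v = - Q T v w"
  proof -
    have "- Q T v w = Q T v (j (j w))" using j_j_K assms Q_minus by simp
    also have "\<dots> = Q T (j w) (j v)" using Q_symp[OF T_in] assms j_K by simp
    also have "\<dots> = - Q T w (j (j v))" using Q_j[OF T_in] assms j_K by simp
    also have "\<dots> = Q T w v" using j_j_K assms Q_minus by simp
    finally show ?thesis by simp
  qed
  ultimately show ?thesis using eta_alt[OF K_L K_L, OF assms] by (simp add: algebra_simps)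
qed

text \<open>The same expressions for the normal component are used, now solved for the component
  along \<open>T\<close> instead of antisymmetrized.\<close>

lemma Q_TT:
  assumes "v \<in> K" "w \<in> K"
  shows "Q v w T = del * (eta v w - J (A v) \<bullet> A w)"
proof -
  have "Q T v w = - (b v (j w) \<bullet> J (B T) - a v (j w) \<bullet> J (A T))"
    using JT_component[of v "j w"] assms j_j_K Q_minus j_K by simp
  also have "\<dots> = - (Q v w T - eta v w * del)"
    unfolding aJT(1,2)[OF K_L[OF assms(1)] assms(2)] Q_def del_def by (simp add: algebra_simps)
  finally show ?thesis using Q_T[OF assms] by (simp add: algebra_simps)
qed

lemma JT_component':
  assumes "u \<in> K" "v \<in> K"
  shows "b u v \<bullet> J (B T) = a u v \<bullet> J (A T) + del * (A u \<bullet> A v)"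
  using JT_component[OF assms] Q_T[OF assms(1) j_K[OF assms(2)]] by (simp add: A_j_K assms J_inner)

text \<open>When the values at \<open>x\<close> and \<open>j x\<close> are added, the components
  along \<open>A T\<close> cancel by symmetry of \<open>a\<close>, and only the skew part of
  \<open>eta\<close>, the Levi form, is left. The right-hand side is positive for nonzero
  \<open>x\<close>, which later guarantees a direction with nonzero second fundamental form.\<close>

lemma JT_trace:
  assumes "x \<in> K"
  shows "a x x \<bullet> J (A T) + a (j x) (j x) \<bullet> J (A T) = 2 * (A T \<bullet> A T) * (A x \<bullet> A x)"
proof -
  note jx = j_K[OF assms]
  have 1: "a (j x) (j x) \<bullet> J (A T) = a (j x) x \<bullet> A T - eta (j x) x * (A T \<bullet> A T)"
    by (rule aJT(1)[OF K_L[OF jx] assms])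
  have 2: "a x (j (j x)) \<bullet> J (A T) = a x (j x) \<bullet> A T - eta x (j x) * (A T \<bullet> A T)"
    by (rule aJT(1)[OF K_L[OF assms] jx])
  have "a x (j (j x)) = - a x x" using j_j_K[OF assms] linear_neg[OF lina] by simp
  then have "a x x \<bullet> J (A T) + a (j x) (j x) \<bullet> J (A T) = (eta x (j x) - eta (j x) x) * (A T \<bullet> A T)"
    using 1 2 a_sym[of x "j x"] by (simp add: algebra_simps)
  then show ?thesis
    using eta_alt[OF K_L[OF assms] K_L[OF jx]] by (simp add: A_j_K assms J_inner)
qed

text \<open>The image of \<open>K\<close>, the vector \<open>M T\<close> and the vector
  \<open>J (M T)\<close> are mutually orthogonal, and by \<open>dim_K\<close> their dimensions add
  up to that of the whole space.\<close>

lemma full_span: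
  assumes M: "linear M" "\<And>v. v \<in> K \<Longrightarrow> M v = 0 \<Longrightarrow> v = 0" and nz: "M T \<noteq> 0"
    and perp: "\<And>v. v \<in> K \<Longrightarrow> M T \<bullet> M v = 0" "\<And>v. v \<in> K \<Longrightarrow> J (M T) \<bullet> M v = 0"
    and p: "\<And>v. v \<in> K \<Longrightarrow> p \<bullet> M v = 0" "p \<bullet> M T = 0" "p \<bullet> J (M T) = 0"
  shows "p = 0"
proof -
  have inj: "inj_on M (span K)"
    unfolding span_eq_iff[THEN iffD2, OF K_subspace]
  proof (rule inj_onI)
    fix x y assume xy: "x \<in> K" "y \<in> K" "M x = M y"
    then have "M (x - y) = 0" by (simp add: linear_diff[OF M(1)])
    then show "x = y" using M(2)[of "x - y"] K_subspace xy subspace_diff by fastforce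
  qed
  have perp_span: "q \<bullet> r = 0" if "\<And>s. s \<in> S \<Longrightarrow> q \<bullet> s = 0" "r \<in> span S" for q r :: 'f and S
    using orthogonal_to_span[OF that(2), of q] that(1) unfolding orthogonal_def by auto
  have dK: "dim (M ` K) = dim K" by (rule dim_image_eq[OF M(1) inj])
  have 1: "M T \<notin> span (M ` K)" using perp_span[of "M ` K" "M T" "M T"] perp(1) nz by auto
  have 2: "J (M T) \<notin> span (insert (M T) (M ` K))"
    using perp_span[of "insert (M T) (M ` K)" "J (M T)" "J (M T)"] perp(2) nz J_inner_self J_inner by auto
  have "dim (insert (J (M T)) (insert (M T) (M ` K))) = DIM('f)"
    using 1 2 dK dim_K by (simp add: dim_insert K_def)
  then have "span (insert (J (M T)) (insert (M T) (M ` K))) = UNIV" by (simp add: dim_eq_full)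
  then show ?thesis using perp_span[of "insert (J (M T)) (insert (M T) (M ` K))" p p] p by auto
qed

lemma A_full:
  assumes "\<And>v. v \<in> K \<Longrightarrow> p \<bullet> A v = 0" "p \<bullet> A T = 0" "p \<bullet> J (A T) = 0"
  shows "p = 0"
  by (rule full_span[OF linA _ AT_nz]) (use assms A_inj AT_perp A_T_J K_L K_th in auto)

lemma B_full:
  assumes "\<And>v. v \<in> K \<Longrightarrow> p \<bullet> B v = 0" "p \<bullet> B T = 0" "p \<bullet> J (B T) = 0"
  shows "p = 0"
  by (rule full_span[OF linB _ BT_nz]) (use assms B_inj BT_perp B_T_J in auto)

lemma normal_decomp:
  assumes M: "linear M" "M T \<noteq> 0"
    and perp: "\<And>v. v \<in> K \<Longrightarrow> M T \<bullet> M v = 0" "\<And>v. v \<in> K \<Longrightarrow> J (M T) \<bullet> M v = 0"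
    and full: "\<And>p. (\<And>v. v \<in> K \<Longrightarrow> p \<bullet> M v = 0) \<Longrightarrow> p \<bullet> M T = 0 \<Longrightarrow> p \<bullet> J (M T) = 0 \<Longrightarrow> p = 0"
  obtains k where "k \<in> K"
    "p = M k + (p \<bullet> M T / (M T \<bullet> M T)) *\<^sub>R M T + (p \<bullet> J (M T) / (M T \<bullet> M T)) *\<^sub>R J (M T)"
proof -
  obtain y z where yz: "y \<in> span (M ` K)" "\<And>w. w \<in> span (M ` K) \<Longrightarrow> orthogonal z w" "p = y + z"
    using orthogonal_subspace_decomp_exists by blast
  have "span (M ` K) = M ` K"
    by (simp only: span_eq_iff linear_subspace_image[OF M(1) K_subspace])
  then obtain k where k: "k \<in> K" "y = M k" using yz(1) by (metis imageE)
  let ?r = "z - (z \<bullet> M T / (M T \<bullet> M T)) *\<^sub>R M T - (z \<bullet> J (M T) / (M T \<bullet> M T)) *\<^sub>R J (M T)"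
  have "?r = 0"
  proof (rule full)
    fix v assume v: "v \<in> K"
    have "z \<bullet> M v = 0" using yz(2)[of "M v"] v by (simp add: orthogonal_def span_base)
    then show "?r \<bullet> M v = 0" using perp v by (simp add: inner_diff_left)
  qed (use M(2) J_inner J_inner_self in \<open>auto simp: inner_diff_left\<close>)
  moreover have "p \<bullet> M T = z \<bullet> M T" "p \<bullet> J (M T) = z \<bullet> J (M T)"
    using perp[OF k(1)] k(2) yz(3) by (auto simp: inner_add_left inner_commute[of "M k"])
  ultimately have "p = M k + (p \<bullet> M T / (M T \<bullet> M T)) *\<^sub>R M T + (p \<bullet> J (M T) / (M T \<bullet> M T)) *\<^sub>R J (M T)"
    using yz(3) k by (simp add: algebra_simps)
  then show ?thesis using that k by blast
qed

text \<open>After removal of the components along \<open>A T\<close> and \<open>J (A T)\<close>,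
  what remains lies in the image of \<open>K\<close> and is determined by its pairings with that
  image. \<open>A\<close> and \<open>B\<close> induce the same metric on \<open>K\<close>, so equal
  pairings give equal inner products.\<close>

lemma inner_horizontal_parts:
  assumes p: "\<And>w. w \<in> K \<Longrightarrow> p' \<bullet> B w = p \<bullet> A w" and q: "\<And>w. w \<in> K \<Longrightarrow> q' \<bullet> B w = q \<bullet> A w"
  shows "p' \<bullet> q' - ((p' \<bullet> B T) * (q' \<bullet> B T) + (p' \<bullet> J (B T)) * (q' \<bullet> J (B T))) / (B T \<bullet> B T)
       = p \<bullet> q - ((p \<bullet> A T) * (q \<bullet> A T) + (p \<bullet> J (A T)) * (q \<bullet> J (A T))) / (A T \<bullet> A T)"
proof -
  define pn where "pn = (p \<bullet> A T / (A T \<bullet> A T)) *\<^sub>R A T + (p \<bullet> J (A T) / (A T \<bullet> A T)) *\<^sub>R J (A T)"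
  define pn' where "pn' = (p' \<bullet> B T / (B T \<bullet> B T)) *\<^sub>R B T + (p' \<bullet> J (B T) / (B T \<bullet> B T)) *\<^sub>R J (B T)"
  obtain k where k: "k \<in> K" "p = A k + pn"
  proof (rule normal_decomp[of A p])
    fix k assume "k \<in> K"
      "p = A k + (p \<bullet> A T / (A T \<bullet> A T)) *\<^sub>R A T + (p \<bullet> J (A T) / (A T \<bullet> A T)) *\<^sub>R J (A T)"
    then show ?thesis using that[of k] unfolding pn_def by (simp only: add.assoc)
  qed (use linA AT_nz AT_perp K_L K_th A_T_J A_full in auto)
  obtain k' where k': "k' \<in> K" "p' = B k' + pn'"
  proof (rule normal_decomp[of B p'])
    fix k assume "k \<in> K"
      "p' = B k + (p' \<bullet> B T / (B T \<bullet> B T)) *\<^sub>R B T + (p' \<bullet> J (B T) / (B T \<bullet> B T)) *\<^sub>R J (B T)"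
    then show ?thesis using that[of k] unfolding pn'_def by (simp only: add.assoc)
  qed (use linB BT_nz BT_perp B_T_J B_full in auto)
  have pn0: "pn \<bullet> A w = 0" "pn' \<bullet> B w = 0" if "w \<in> K" for w
    unfolding pn_def pn'_def using that AT_perp K_L K_th BT_perp A_T_J B_T_J
    by (auto simp: inner_add_left)
  have "B (k' - k) \<bullet> B w = 0" if w: "w \<in> K" for w
  proof -
    have "B k' \<bullet> B w = p' \<bullet> B w" unfolding k'(2) using pn0 w by (simp add: inner_add_left)
    moreover have "A k \<bullet> A w = p \<bullet> A w" unfolding k(2) using pn0 w by (simp add: inner_add_left)
    ultimately show ?thesis using p[OF w] inner_K[OF K_L[OF k(1)] w]
      by (simp add: linear_diff[OF linB] inner_diff_left)
  qed
  from this[of "k' - k"] have "k' = k" using B_inj[of "k' - k"] k k' K_subspace subspace_diff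
    by (metis eq_iff_diff_eq_0 inner_eq_zero_iff)
  then have "q' \<bullet> B k' = q \<bullet> A k" using q k by simp
  moreover have "p' \<bullet> q' = q' \<bullet> B k' + pn' \<bullet> q'" unfolding k'(2) by (simp add: inner_add_left inner_commute[of q'])
  moreover have "p \<bullet> q = q \<bullet> A k + pn \<bullet> q" unfolding k(2) by (simp add: inner_add_left inner_commute[of q])
  moreover have "pn \<bullet> q = ((p \<bullet> A T) * (q \<bullet> A T) + (p \<bullet> J (A T)) * (q \<bullet> J (A T))) / (A T \<bullet> A T)"
    unfolding pn_def by (simp add: inner_add_left add_divide_distrib inner_commute[of "A T" q] inner_commute[of "J (A T)" q])
  moreover have "pn' \<bullet> q' = ((p' \<bullet> B T) * (q' \<bullet> B T) + (p' \<bullet> J (B T)) * (q' \<bullet> J (B T))) / (B T \<bullet> B T)"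
    unfolding pn'_def by (simp add: inner_add_left add_divide_distrib inner_commute[of "B T" q'] inner_commute[of "J (B T)" q'])
  ultimately show ?thesis by simp
qed

lemma inner_second_derivatives:
  assumes "u \<in> K" "v \<in> K" "u' \<in> K" "v' \<in> K"
  shows "b u v \<bullet> b u' v' - ((b u v \<bullet> B T) * (b u' v' \<bullet> B T) + (b u v \<bullet> J (B T)) * (b u' v' \<bullet> J (B T))) / (B T \<bullet> B T)
       = a u v \<bullet> a u' v' - ((a u v \<bullet> A T) * (a u' v' \<bullet> A T) + (a u v \<bullet> J (A T)) * (a u' v' \<bullet> J (A T))) / (A T \<bullet> A T)"
  by (rule inner_horizontal_parts) (use Q_zero assms in \<open>auto simp: Q_def\<close>)

text \<open>The hypothesis is the Gauss equation; it is evaluated on the complex line spanned by \<open>x\<close> and \<open>j x\<close>.\<close>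
lemma del_zero:
  assumes gauss: "\<And>x y v w. \<lbrakk>x \<in> K; y \<in> K; v \<in> K; w \<in> K\<rbrakk> \<Longrightarrow>
      b y v \<bullet> b x w - b x v \<bullet> b y w - (a y v \<bullet> a x w - a x v \<bullet> a y w)
      = (eta x y - eta y x) * Q T v w + (eta x v * Q y T w - eta y v * Q x T w)
        + (eta x w * Q y v T - eta y w * Q x v T)"
    and x0: "x0 \<in> K" "x0 \<noteq> 0"
  shows "del = 0"
proof -
  \<comment> \<open>The normalization makes \<open>A x\<close> and \<open>A y\<close> orthonormal
    and gives the Kaehler form the value 1 on \<open>x\<close>, \<open>y\<close>.\<close>
  define x where "x = (1 / norm (A x0)) *\<^sub>R x0"
  have xK: "x \<in> K" unfolding x_def using K_subspace x0 subspace_mul by blast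
  have "A x0 \<noteq> 0" using A_inj x0 K_L K_th by blast
  then have "norm (A x) = 1" unfolding x_def by (simp add: linear_scale[OF linA])
  then have Ax: "A x \<bullet> A x = 1" by (simp add: norm_eq_1)
  define y where "y = j x"
  have yK: "y \<in> K" unfolding y_def using j_K xK by blast
  have jy: "j y = - x" unfolding y_def using j_j_K xK by blast
  have Ay: "A y = J (A x)" unfolding y_def using A_j_K xK by blast
  define R where "R = A T \<bullet> A T"
  define R' where "R' = B T \<bullet> B T"
  have R: "R > 0" "R' > 0" "R' = R + del" unfolding R_def R'_def del_def using AT_nz BT_nz by auto
  define e where "e = eta x y"
  define c where "c = eta x x"
  define d where "d = eta y y"
  \<comment> \<open>The 2 is the factor in \<open>eta_alt\<close>, the Kaehler form being 1
    here.\<close>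
  have e2: "eta y x = e - 2"
    using eta_alt[OF K_L K_L, OF xK yK] unfolding e_def by (simp add: Ay J_inner Ax)
  define l where "l = a x y \<bullet> J (A T)"
  define s where "s = a x y \<bullet> A T"
  have pxx: "a x x \<bullet> A T = l + c * R"
    using aJT(1)[OF K_L[OF xK] xK] unfolding l_def c_def R_def y_def by simp
  have pyy: "a y y \<bullet> A T = d * R - l"
    using aJT(1)[OF K_L[OF yK] yK] unfolding jy l_def d_def R_def
    by (simp add: linear_neg[OF lina] a_sym[of y x])
  have qyy: "a y y \<bullet> J (A T) = s - (e - 2) * R"
    using aJT(1)[OF K_L[OF yK] xK] unfolding y_def[symmetric] e2 s_def R_def a_sym[of y x] .
  have qxx: "a x x \<bullet> J (A T) = e * R - s"
    using aJT(1)[OF K_L[OF xK] yK] unfolding jy e_def s_def R_def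
    by (simp add: linear_neg[OF lina])
  have xy: "A x \<bullet> A y = 0" "A y \<bullet> A y = 1" unfolding Ay by (auto simp: J_inner_self J_inner Ax)
  have Om: "J (A x) \<bullet> A y = 1" "J (A y) \<bullet> A x = - 1" "J (A x) \<bullet> A x = 0" "J (A y) \<bullet> A y = 0"
    unfolding Ay by (auto simp: J_inner Ax J_inner_self J_J)
  have pb: "b x y \<bullet> B T = s + del * (e - 1)" "b x x \<bullet> B T = l + c * R + del * c"
     "b y y \<bullet> B T = d * R - l + del * d"
    using Q_TT[OF xK yK] Q_TT[OF xK xK] Q_TT[OF yK yK] pxx pyy
    unfolding Q_def s_def e_def c_def d_def Om by auto
  have qb: "b x y \<bullet> J (B T) = l" "b x x \<bullet> J (B T) = e * R - s + del"
     "b y y \<bullet> J (B T) = s - (e - 2) * R + del"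
    using JT_component'[OF xK yK] JT_component'[OF xK xK] JT_component'[OF yK yK] qxx qyy
    unfolding l_def xy Ax by auto
  \<comment> \<open>Horizontal parts of the second derivatives have equal inner products, so only
    the components along \<open>T\<close> and the normal have to be tracked.\<close>
  have 1: "b x y \<bullet> b x y - ((s + del * (e - 1)) * (s + del * (e - 1)) + l * l) / R'
     = a x y \<bullet> a x y - (s * s + l * l) / R"
    using inner_second_derivatives[OF xK yK xK yK]
    unfolding pb qb s_def[symmetric] l_def[symmetric] R_def[symmetric] R'_def[symmetric] .
  have 2: "b x x \<bullet> b y y - ((l + c * R + del * c) * (d * R - l + del * d)
        + (e * R - s + del) * (s - (e - 2) * R + del)) / R'
     = a x x \<bullet> a y y - ((l + c * R) * (d * R - l) + (e * R - s) * (s - (e - 2) * R)) / R"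
    using inner_second_derivatives[OF xK xK yK yK]
    unfolding pb qb pxx pyy qxx qyy R_def[symmetric] R'_def[symmetric] .
  \<comment> \<open>The Gauss equation with \<open>v\<close> equal to \<open>x\<close> and
    \<open>w\<close> equal to \<open>y\<close>; the 0 in \<open>c * 0\<close> is the value of
    \<open>Q y T y\<close>.\<close>
  have g: "b x y \<bullet> b x y - b x x \<bullet> b y y - (a x y \<bullet> a x y - a x x \<bullet> a y y)
      = 2 * del + (c * 0 - (e - 2) * del) + (e * (del * (e - 2 + 1)) - d * (del * c))"
    using gauss[OF xK yK xK yK] Q_T[OF xK yK] Q_T[OF yK yK] Q_TT[OF yK xK] Q_TT[OF xK xK]
    unfolding a_sym[of y x] b_sym[of y x] Q_sym[of y T] Q_sym[of x T] Om e2 e_def[symmetric]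
      c_def[symmetric] d_def[symmetric] by simp
  show ?thesis
  proof (rule gauss_algebra[OF R])
    show "((s + del * (e - 1))\<^sup>2 + l\<^sup>2 - (l + c * R + del * c) * (d * R - l + del * d)
           - (e * R - s + del) * (s - (e - 2) * R + del)) / R'
       - (s\<^sup>2 + l\<^sup>2 - (l + c * R) * (d * R - l) - (e * R - s) * (s - (e - 2) * R)) / R
       = del * (2 - (e - 2) + e * (e - 1) - d * c)"
    proof -
      have "(X - Y - Z) / W = X / W - (Y + Z) / W" for X Y Z W :: real
        by (simp add: diff_divide_distrib add_divide_distrib)
      note * = this
      have "del * (2 - (e - 2) + e * (e - 1) - d * c)
        = 2 * del + (c * 0 - (e - 2) * del) + (e * (del * (e - 2 + 1)) - d * (del * c))"
        by (simp add: algebra_simps)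
      then show ?thesis using 1 2 g unfolding * power2_eq_square by linarith
    qed
  qed
qed

section \<open>Equality of the second fundamental forms once \<open>del\<close> vanishes\<close>

lemma inner_L:
  assumes "del = 0" "v \<in> L" "w \<in> L"
  shows "A v \<bullet> A w = B v \<bullet> B w"
proof -
  obtain k where k: "k \<in> K" "w = k + th w *\<^sub>R T" using L_decomp[OF assms(3)] .
  have "A w = A k + th w *\<^sub>R A T" "B w = B k + th w *\<^sub>R B T"
    using linear_add[OF linA, of k "th w *\<^sub>R T"] linear_add[OF linB, of k "th w *\<^sub>R T"]
    unfolding k(2)[symmetric] by (auto simp: linear_scale[OF linA] linear_scale[OF linB])
  then show ?thesis using inner_K[OF assms(2) k(1)] A_inner_T[OF assms(2)] B_inner_T[OF assms(2)] assms(1)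
    by (simp add: inner_add_right del_def)
qed

text \<open>For a horizontal second argument \<open>aJT\<close> expresses the normal component
  through tangential ones, which already agree. The value at \<open>T\<close>, \<open>T\<close>
  comes from the Gauss equation for \<open>T\<close> and a horizontal \<open>y\<close>: it fixes the
  product with the value at \<open>y\<close>, \<open>y\<close>, so \<open>y\<close> must be chosen
  where the form does not vanish.\<close>

lemma second_fundamental_forms_agree:
  assumes del: "del = 0"
    and QL: "\<And>u v w. \<lbrakk>u \<in> L; v \<in> L; w \<in> L\<rbrakk> \<Longrightarrow> Q u v w = 0"
    and gauss: "\<And>x y v w. \<lbrakk>x \<in> L; y \<in> L; v \<in> L; w \<in> L\<rbrakk> \<Longrightarrow>
      b y v \<bullet> b x w - b x v \<bullet> b y w = a y v \<bullet> a x w - a x v \<bullet> a y w"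
    and x0: "x0 \<in> K" "x0 \<noteq> 0" and uv: "u \<in> L" "v \<in> L"
  shows "b u v \<bullet> J (B T) = a u v \<bullet> J (A T)"
proof -
  have R: "B T \<bullet> B T = A T \<bullet> A T" using del unfolding del_def by simp
  have K: "b u v \<bullet> J (B T) = a u v \<bullet> J (A T)" if "u \<in> L" "v \<in> K" for u v
    using aJT(3,4)[OF that] QL[OF that(1) K_L[OF j_K[OF that(2)]] T_in] R unfolding Q_def by simp
  \<comment> \<open>By \<open>JT_trace\<close> the form cannot vanish at both \<open>x0\<close> and
    \<open>j x0\<close>.\<close>
  have "\<exists>y\<in>K. a y y \<bullet> J (A T) \<noteq> 0"
  proof (rule ccontr)
    assume "\<not> ?thesis"
    then have "2 * (A T \<bullet> A T) * (A x0 \<bullet> A x0) = 0"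
      using JT_trace[OF x0(1)] x0(1) j_K by simp
    then show False using AT_nz A_inj x0 K_L K_th by auto
  qed
  then obtain y where y: "y \<in> K" "a y y \<bullet> J (A T) \<noteq> 0" by blast
  have eq: "b u v \<bullet> b u' v' - (b u v \<bullet> J (B T)) * (b u' v' \<bullet> J (B T)) / (A T \<bullet> A T)
       = a u v \<bullet> a u' v' - (a u v \<bullet> J (A T)) * (a u' v' \<bullet> J (A T)) / (A T \<bullet> A T)"
    if "u \<in> L" "v \<in> L" "u' \<in> L" "v' \<in> L" for u v u' v'
  proof -
    have QL': "b u v \<bullet> B w = a u v \<bullet> A w" if "u \<in> L" "v \<in> L" "w \<in> L" for u v w
      using QL[OF that] unfolding Q_def by simp
    show ?thesis
      using inner_horizontal_parts[of "b u v" "a u v" "b u' v'" "a u' v'"] that QL' K_L T_in R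
      by (simp add: add_divide_distrib)
  qed
  have TT: "b T T \<bullet> J (B T) = a T T \<bullet> J (A T)"
  proof -
    have "b y T \<bullet> J (B T) = a y T \<bullet> J (A T)" using K[OF T_in y(1)] a_sym[of y T] b_sym[of y T] by simp
    then have "b y T \<bullet> b T y = a y T \<bullet> a T y"
      using eq[of y T T y] K[OF T_in y(1)] K_L[OF y(1)] T_in by simp
    then have "b T T \<bullet> b y y = a T T \<bullet> a y y" using gauss[OF T_in K_L T_in K_L, OF y(1) y(1)] by simp
    then have "(b T T \<bullet> J (B T)) * (b y y \<bullet> J (B T)) = (a T T \<bullet> J (A T)) * (a y y \<bullet> J (A T))"
      using eq[of T T y y] T_in K_L[OF y(1)] AT_nz by simp
    then show ?thesis using K[OF K_L[OF y(1)] y(1)] y(2) by simp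
  qed
  have uT: "b u T \<bullet> J (B T) = a u T \<bullet> J (A T)" if u: "u \<in> L" for u
  proof -
    obtain k where k: "k \<in> K" "u = k + th u *\<^sub>R T" using L_decomp[OF u] .
    have "a T u = a T k + th u *\<^sub>R a T T" "b T u = b T k + th u *\<^sub>R b T T"
      using linear_add[OF lina, of T k "th u *\<^sub>R T"] linear_add[OF linb, of T k "th u *\<^sub>R T"]
      unfolding k(2)[symmetric] by (auto simp: linear_scale[OF lina] linear_scale[OF linb])
    then show ?thesis using K[OF T_in k(1)] TT unfolding a_sym[of u T] b_sym[of u T]
      by (simp add: inner_add_left)
  qed
  obtain k where k: "k \<in> K" "v = k + th v *\<^sub>R T" using L_decomp[OF uv(2)] .
  have "a u v = a u k + th v *\<^sub>R a u T" "b u v = b u k + th v *\<^sub>R b u T"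
    using linear_add[OF lina, of u k "th v *\<^sub>R T"] linear_add[OF linb, of u k "th v *\<^sub>R T"]
    unfolding k(2)[symmetric] by (auto simp: linear_scale[OF lina] linear_scale[OF linb])
  then show ?thesis using K[OF uv(1) k(1)] uT[OF uv(1)] by (simp add: inner_add_left)
qed

text \<open>Koszul's argument: \<open>Q\<close> is symmetric in its first two slots and skew in the
  last two, so cycling through the slots changes its sign.\<close>

lemma Q_L_zero:
  assumes koszul: "\<And>u v w. \<lbrakk>u \<in> L; v \<in> L; w \<in> L\<rbrakk> \<Longrightarrow>
      a u v \<bullet> A w + A v \<bullet> a u w = b u v \<bullet> B w + B v \<bullet> b u w"
    and "u \<in> L" "v \<in> L" "w \<in> L"
  shows "Q u v w = 0"
proof -
  have Qs: "Q u v w = - Q u w v" if "u \<in> L" "v \<in> L" "w \<in> L" for u v w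
    using koszul[OF that] unfolding Q_def by (simp add: inner_commute)
  have "Q u v w = - Q w u v" using Qs[OF assms(2-4)] Q_sym[of w u v] by simp
  also have "\<dots> = Q v w u" using Qs[of w u v] assms Q_sym[of v w u] by simp
  also have "\<dots> = - Q u v w" using Qs[of v w u] assms Q_sym[of u v w] by simp
  finally show ?thesis by simp
qed

lemma unitary_between_jets:
  assumes del: "del = 0"
    and QL: "\<And>u v w. \<lbrakk>u \<in> L; v \<in> L; w \<in> L\<rbrakk> \<Longrightarrow> Q u v w = 0"
    and gauss: "\<And>x y v w. \<lbrakk>x \<in> L; y \<in> L; v \<in> L; w \<in> L\<rbrakk> \<Longrightarrow>
      b y v \<bullet> b x w - b x v \<bullet> b y w = a y v \<bullet> a x w - a x v \<bullet> a y w"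
    and x0: "x0 \<in> K" "x0 \<noteq> 0"
  shows "\<exists>U. linear U \<and> (\<forall>p. U (J p) = J (U p)) \<and> (\<forall>p. norm (U p) = norm p) \<and>
    (\<forall>v\<in>L. U (A v) = B v) \<and> (\<forall>u\<in>L. \<forall>v\<in>L. U (a u v) = b u v)"
proof -
  have R: "B T \<bullet> B T = A T \<bullet> A T" using del unfolding del_def by simp
  have JT: "b u v \<bullet> J (B T) = a u v \<bullet> J (A T)" if "u \<in> L" "v \<in> L" for u v
    by (rule second_fundamental_forms_agree[OF del QL _ x0 that]) (use gauss in auto)
  \<comment> \<open>\<open>U\<close> will carry the frame formed by an orthonormal basis of the
    horizontal image, \<open>A T\<close> and \<open>J (A T)\<close> to the corresponding frame of
    \<open>B\<close>; \<open>\<iota>\<close> selects preimages in \<open>K\<close>.\<close>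
  obtain E where E: "E \<subseteq> A ` K" "pairwise orthogonal E" "\<And>e. e \<in> E \<Longrightarrow> norm e = 1"
    "independent E" "card E = dim (A ` K)" "span E = A ` K"
    using orthonormal_basis_subspace[OF linear_subspace_image[OF linA K_subspace]] by blast
  have "\<forall>e\<in>E. \<exists>k. k \<in> K \<and> A k = e" using E(1) by auto
  then obtain \<iota> where i: "\<And>e. e \<in> E \<Longrightarrow> \<iota> e \<in> K" "\<And>e. e \<in> E \<Longrightarrow> A (\<iota> e) = e" by metis
  define U where "U p = (\<Sum>e\<in>E. (p \<bullet> e) *\<^sub>R B (\<iota> e)) + (p \<bullet> A T / (A T \<bullet> A T)) *\<^sub>R B T
     + (p \<bullet> J (A T) / (A T \<bullet> A T)) *\<^sub>R J (B T)" for p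
  have linU: "linear U"
    unfolding U_def
    by (rule linearI) (simp_all add: inner_add_left scaleR_add_left sum.distrib add_divide_distrib
        scaleR_sum_right scaleR_add_right mult.assoc)
  have U_K: "U p \<bullet> B w = p \<bullet> A w" if w: "w \<in> K" for p w
  proof -
    have "A w = (\<Sum>e\<in>E. (A w \<bullet> e) *\<^sub>R e)"
    proof -
      have "orthogonal (A w - (\<Sum>e\<in>E. (e \<bullet> A w / (e \<bullet> e)) *\<^sub>R e)) y" if "y \<in> span E" for y
        using Gram_Schmidt_step[OF E(2) that] orthogonal_commute by blast
      moreover have "(\<Sum>e\<in>E. (e \<bullet> A w / (e \<bullet> e)) *\<^sub>R e) = (\<Sum>e\<in>E. (A w \<bullet> e) *\<^sub>R e)"
        by (rule sum.cong) (use E(3) in \<open>auto simp: norm_eq_1 inner_commute\<close>)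
      moreover have "A w - (\<Sum>e\<in>E. (A w \<bullet> e) *\<^sub>R e) \<in> span E"
        using E(6) w by (intro span_diff span_sum span_scale) (auto intro: span_base)
      ultimately show ?thesis by (metis eq_iff_diff_eq_0 orthogonal_self)
    qed
    then have "p \<bullet> A w = (\<Sum>e\<in>E. (A w \<bullet> e) * (p \<bullet> e))" by (metis (no_types, lifting) inner_scaleR_right inner_sum_right sum.cong)
    moreover have "B (\<iota> e) \<bullet> B w = A w \<bullet> e" if "e \<in> E" for e
      using inner_K[OF K_L[OF i(1)[OF that]] w] i(2)[OF that] by (simp add: inner_commute)
    ultimately show ?thesis unfolding U_def using BT_perp[OF w] B_T_J[OF w]
      by (simp add: inner_add_left inner_sum_left mult.commute cong: sum.cong)
  qed
  have sumT: "(\<Sum>e\<in>E. (p \<bullet> e) *\<^sub>R B (\<iota> e)) \<bullet> B T = 0" "(\<Sum>e\<in>E. (p \<bullet> e) *\<^sub>R B (\<iota> e)) \<bullet> J (B T) = 0" for p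
    using BT_perp[OF i(1)] B_T_J[OF i(1)]
    by (auto simp: inner_sum_left inner_commute[of "B (\<iota> _)"] intro!: sum.neutral)
  have U_T: "U p \<bullet> B T = p \<bullet> A T" for p
    unfolding U_def using sumT AT_nz by (simp add: inner_add_left R J_inner_self)
  have U_JT: "U p \<bullet> J (B T) = p \<bullet> J (A T)" for p
    unfolding U_def using sumT AT_nz by (simp add: inner_add_left R J_inner_self J_inner)
  \<comment> \<open>A vector is determined by its pairings with the frame of \<open>B\<close>, so
    the properties of \<open>U\<close> can be read off from \<open>U_K\<close>, \<open>U_T\<close>
    and \<open>U_JT\<close>.\<close>
  have U_eq: "U p = p'" if "\<And>w. w \<in> K \<Longrightarrow> p' \<bullet> B w = p \<bullet> A w" "p' \<bullet> B T = p \<bullet> A T"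
    "p' \<bullet> J (B T) = p \<bullet> J (A T)" for p p'
    using B_full[of "U p - p'"] that U_K U_T U_JT by (simp add: inner_diff_left)
  have "U (J p) = J (U p)" for p
  proof (rule U_eq)
    fix w assume w: "w \<in> K"
    show "J (U p) \<bullet> B w = J p \<bullet> A w" using U_K[OF j_K[OF w], of p] w by (simp add: J_skew A_j_K B_j_K)
  qed (use U_JT U_T in \<open>auto simp: J_skew[of _ "B T"] J_skew[of _ "A T"] J_inner\<close>)
  moreover have "norm (U p) = norm p" for p
  proof -
    have "U p \<bullet> U p = p \<bullet> p"
      using inner_horizontal_parts[of "U p" p "U p" p] U_K U_T U_JT R by simp
    then show ?thesis by (simp add: norm_eq_sqrt_inner)
  qed
  moreover have "U (A v) = B v" if "v \<in> L" for v
    by (rule U_eq) (use that inner_L[OF del that] K_L T_in A_inner_JT B_inner_JT in auto)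
  moreover have "U (a u v) = b u v" if "u \<in> L" "v \<in> L" for u v
    by (rule U_eq) (use that QL K_L T_in JT in \<open>auto simp: Q_def\<close>)
  ultimately show ?thesis using linU by blast
qed

end

section \<open>Pairs of parametrized CR maps\<close>

text \<open>Two parametrized CR maps \<open>f, g\<close> with heights \<open>\<tau>, \<tau>'\<close>.  The parameters range over the slice
  \<open>V \<inter> L\<close> of an open set by a linear subspace, and all identities hold only along that slice.\<close>
locale cr_map_pair = hermitian_space J for J :: "'f::euclidean_space \<Rightarrow> 'f" +
  fixes V L :: "'e::euclidean_space set" and f g :: "'e \<Rightarrow> 'f" and \<tau> \<tau>' :: "'e \<Rightarrow> real"
    and th :: "'e \<Rightarrow> 'e \<Rightarrow> real" and j :: "'e \<Rightarrow> 'e \<Rightarrow> 'e"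
  assumes V: "open V" and L: "subspace L"
    and sf: "smooth_on f V" and sg: "smooth_on g V" and st: "smooth_on \<tau> V" and st': "smooth_on \<tau>' V"
    and th_def: "\<And>x v. th x v = FD \<tau> x v + J (f x) \<bullet> FD f x v"
    and th_g: "\<And>x v. \<lbrakk>x \<in> V \<inter> L; v \<in> L\<rbrakk> \<Longrightarrow> th x v = FD \<tau>' x v + J (g x) \<bullet> FD g x v"
    and j_lin: "\<And>x. x \<in> V \<Longrightarrow> linear (j x)" and j_smooth: "\<And>v. smooth_on (\<lambda>x. j x v) V"
    and j_L: "\<And>x v. \<lbrakk>x \<in> V \<inter> L; v \<in> L; th x v = 0\<rbrakk> \<Longrightarrow> j x v \<in> L"
    and j_th: "\<And>x v. \<lbrakk>x \<in> V \<inter> L; v \<in> L; th x v = 0\<rbrakk> \<Longrightarrow> th x (j x v) = 0"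
    and jj: "\<And>x v. \<lbrakk>x \<in> V \<inter> L; v \<in> L; th x v = 0\<rbrakk> \<Longrightarrow> j x (j x v) = - v"
    and j_f: "\<And>x v. \<lbrakk>x \<in> V \<inter> L; v \<in> L; th x v = 0\<rbrakk> \<Longrightarrow> FD f x (j x v) = J (FD f x v)"
    and j_g: "\<And>x v. \<lbrakk>x \<in> V \<inter> L; v \<in> L; th x v = 0\<rbrakk> \<Longrightarrow> FD g x (j x v) = J (FD g x v)"
    and f_inj: "\<And>x v. \<lbrakk>x \<in> V \<inter> L; v \<in> L; FD f x v = 0\<rbrakk> \<Longrightarrow> v = 0"
    and g_nz: "\<And>x v. \<lbrakk>x \<in> V \<inter> L; v \<in> L; FD g x v = 0\<rbrakk> \<Longrightarrow> th x v = 0"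
    and dim_L: "dim L + 1 = DIM('f)"
    and dim_K: "\<And>x. x \<in> V \<inter> L \<Longrightarrow> dim {v\<in>L. th x v = 0} + 2 = DIM('f)"
    and dim_F: "DIM('f) \<ge> 3"
begin

abbreviation a where "a x u v \<equiv> FD (\<lambda>y. FD f y v) x u"
abbreviation b where "b x u v \<equiv> FD (\<lambda>y. FD g y v) x u"
abbreviation eta where "eta x u v \<equiv> FD (\<lambda>y. th y v) x u"

section \<open>Derivatives of the two maps and of the contact form\<close>

lemma df: "x \<in> V \<Longrightarrow> (f has_derivative FD f x) (at x)"
  by (rule smooth_on_has_derivative[OF V sf])

lemma dg: "x \<in> V \<Longrightarrow> (g has_derivative FD g x) (at x)"
  by (rule smooth_on_has_derivative[OF V sg])

lemma ddf: "x \<in> V \<Longrightarrow> ((\<lambda>y. FD f y v) has_derivative (\<lambda>u. a x u v)) (at x)"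
  by (rule smooth_on_has_derivative[OF V smooth_on_FD[OF sf]])

lemma ddg: "x \<in> V \<Longrightarrow> ((\<lambda>y. FD g y v) has_derivative (\<lambda>u. b x u v)) (at x)"
  by (rule smooth_on_has_derivative[OF V smooth_on_FD[OF sg]])

lemma ddt: "x \<in> V \<Longrightarrow> ((\<lambda>y. FD \<tau> y v) has_derivative (\<lambda>u. FD (\<lambda>y. FD \<tau> y v) x u)) (at x)"
  by (rule smooth_on_has_derivative[OF V smooth_on_FD[OF st]])

lemma ddt': "x \<in> V \<Longrightarrow> ((\<lambda>y. FD \<tau>' y v) has_derivative (\<lambda>u. FD (\<lambda>y. FD \<tau>' y v) x u)) (at x)"
  by (rule smooth_on_has_derivative[OF V smooth_on_FD[OF st']])

lemma a_sym: "x \<in> V \<Longrightarrow> a x u v = a x v u" by (rule FD_FD_commute[OF V sf])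

lemma b_sym: "x \<in> V \<Longrightarrow> b x u v = b x v u" by (rule FD_FD_commute[OF V sg])

lemma lin_f: "x \<in> V \<Longrightarrow> linear (FD f x)" by (rule smooth_on_linear_FD[OF V sf])

lemma lin_g: "x \<in> V \<Longrightarrow> linear (FD g x)" by (rule smooth_on_linear_FD[OF V sg])

lemma lin_t: "x \<in> V \<Longrightarrow> linear (FD \<tau> x)" by (rule smooth_on_linear_FD[OF V st])

lemma lin_a_left: "x \<in> V \<Longrightarrow> linear (\<lambda>u. a x u v)"
  by (rule smooth_on_linear_FD[OF V smooth_on_FD[OF sf]])

lemma lin_b_left: "x \<in> V \<Longrightarrow> linear (\<lambda>u. b x u v)"
  by (rule smooth_on_linear_FD[OF V smooth_on_FD[OF sg]])

lemma lin_a: assumes "x \<in> V" shows "linear (a x u)"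
proof -
  have "a x u = (\<lambda>v. a x v u)" using a_sym[OF assms] by blast
  then show ?thesis using lin_a_left[OF assms] by simp
qed

lemma lin_b: assumes "x \<in> V" shows "linear (b x u)"
proof -
  have "b x u = (\<lambda>v. b x v u)" using b_sym[OF assms] by blast
  then show ?thesis using lin_b_left[OF assms] by simp
qed

lemma lin_th: "x \<in> V \<Longrightarrow> linear (th x)"
  unfolding th_def using lin_t lin_f
  by (intro linearI) (auto simp: linear_add linear_scale inner_add_right algebra_simps)

lemma bl_J: "bounded_linear J" using J_linear linear_conv_bounded_linear by blast

lemma dJ: "(h has_derivative h') F \<Longrightarrow> ((\<lambda>x. J (h x)) has_derivative (\<lambda>u. J (h' u))) F"
  by (rule bounded_linear.has_derivative[OF bl_J])

lemma dth_explicit: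
  assumes "x \<in> V"
  shows "((\<lambda>y. th y v) has_derivative
    (\<lambda>u. FD (\<lambda>y. FD \<tau> y v) x u + (J (f x) \<bullet> a x u v + J (FD f x u) \<bullet> FD f x v))) (at x)"
  unfolding th_def by (intro has_derivative_add ddt has_derivative_inner dJ df ddf assms)

lemma eta_eq: "x \<in> V \<Longrightarrow>
  eta x u v = FD (\<lambda>y. FD \<tau> y v) x u + (J (f x) \<bullet> a x u v + J (FD f x u) \<bullet> FD f x v)"
  by (rule FD_eqI[OF dth_explicit])

lemma dth: "x \<in> V \<Longrightarrow> ((\<lambda>y. th y v) has_derivative (\<lambda>u. eta x u v)) (at x)"
  using dth_explicit eta_eq by simp

lemma J_antisym: "J p \<bullet> q - J q \<bullet> p = 2 * (J p \<bullet> q)"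
  using J_skew[of q p] by (simp add: inner_commute)

text \<open>The second derivatives are symmetric and drop out: the exterior derivative of the
  contact form is twice the Kaehler form.\<close>

lemma eta_alt:
  assumes "x \<in> V"
  shows "eta x u v - eta x v u = 2 * (J (FD f x u) \<bullet> FD f x v)"
  unfolding eta_eq[OF assms] using a_sym[OF assms, of u v] FD_FD_commute[OF V st assms, of u v]
    J_antisym[of "FD f x u" "FD f x v"] by simp

lemmas slice = has_derivative_zero_on_slice[OF V L]

text \<open>Both sides are half the exterior derivative of the same contact form, and for arguments
  in \<open>L\<close> this derivative sees the slice only.\<close>

lemma symp:
  assumes x: "x \<in> V \<inter> L" and uv: "u \<in> L" "v \<in> L"
  shows "J (FD f x u) \<bullet> FD f x v = J (FD g x u) \<bullet> FD g x v"
proof -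
  have xV: "x \<in> V" using x by simp
  have *: "eta x u v = FD (\<lambda>y. FD \<tau>' y v) x u + (J (g x) \<bullet> b x u v + J (FD g x u) \<bullet> FD g x v)"
    if uv: "u \<in> L" "v \<in> L" for u v
  proof -
    have "((\<lambda>y. th y v - (FD \<tau>' y v + J (g y) \<bullet> FD g y v)) has_derivative
       (\<lambda>u. eta x u v - (FD (\<lambda>y. FD \<tau>' y v) x u + (J (g x) \<bullet> b x u v + J (FD g x u) \<bullet> FD g x v)))) (at x)"
      by (intro has_derivative_diff dth has_derivative_add ddt' has_derivative_inner dJ dg ddg xV)
    from slice[OF x uv(1) _ this] show ?thesis using th_g uv(2) by simp
  qed
  have "2 * (J (FD f x u) \<bullet> FD f x v) = eta x u v - eta x v u" using eta_alt[OF xV] by simp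
  also have "\<dots> = 2 * (J (FD g x u) \<bullet> FD g x v)"
    unfolding *[OF uv] *[OF uv(2,1)] using b_sym[OF xV, of u v] FD_FD_commute[OF V st' xV, of u v]
     J_antisym[of "FD g x u" "FD g x v"] by simp
  finally show ?thesis by simp
qed

lemma dsymp:
  assumes x: "x \<in> V \<inter> L" and uv: "u \<in> L" "v \<in> L" "w \<in> L"
  shows "J (a x u v) \<bullet> FD f x w + J (FD f x v) \<bullet> a x u w = J (b x u v) \<bullet> FD g x w + J (FD g x v) \<bullet> b x u w"
proof -
  have xV: "x \<in> V" using x by simp
  have "((\<lambda>y. J (FD f y v) \<bullet> FD f y w - J (FD g y v) \<bullet> FD g y w) has_derivative
     (\<lambda>u. (J (FD f x v) \<bullet> a x u w + J (a x u v) \<bullet> FD f x w)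
        - (J (FD g x v) \<bullet> b x u w + J (b x u v) \<bullet> FD g x w))) (at x)"
    by (intro has_derivative_diff has_derivative_inner dJ ddf ddg xV)
  from slice[OF x uv(1) _ this] show ?thesis using symp uv by simp
qed

text \<open>Subtracting a multiple of \<open>T\<close> extends a horizontal vector at
  \<open>x\<close> to a field that is horizontal at nearby points; the quotient is there because
  \<open>th y T\<close> is known to be 1 at \<open>x\<close> only.\<close>

lemma has_derivative_horizontal:
  assumes "x \<in> V" "th x T = 1" "th x v = 0"
  shows "((\<lambda>y. v - (th y v / th y T) *\<^sub>R T) has_derivative (\<lambda>u. - (eta x u v *\<^sub>R T))) (at x)"
proof -
  have "((\<lambda>y. v - (th y v / th y T) *\<^sub>R T) has_derivative
     (\<lambda>u. 0 - (- th x v * (inverse (th x T) * eta x u T * inverse (th x T)) + eta x u v / th x T) *\<^sub>R T)) (at x)"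
    by (intro has_derivative_diff has_derivative_const has_derivative_scaleR_left has_derivative_divide dth)
      (use assms in auto)
  then show ?thesis by (rule has_derivative_eq_rhs) (simp add: fun_eq_iff assms)
qed

lemma horizontal:
  assumes "y \<in> V" "v \<in> L" "T \<in> L" "th y T \<noteq> 0"
  shows "v - (th y v / th y T) *\<^sub>R T \<in> L" "th y (v - (th y v / th y T) *\<^sub>R T) = 0"
  using assms L by (auto simp: subspace_diff subspace_mul linear_diff[OF lin_th] linear_scale[OF lin_th])

lemma open_th_nz: "open {y \<in> V. th y T \<noteq> 0}"
proof -
  have "continuous_on V (\<lambda>y. th y T)"
    by (rule differentiable_imp_continuous_on, rule differentiable_on_openI[OF V dth])
  then have "open ((\<lambda>y. th y T) -` (- {0}) \<inter> V)" using continuous_on_open_vimage[OF V] by blast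
  moreover have "(\<lambda>y. th y T) -` (- {0}) \<inter> V = {y \<in> V. th y T \<noteq> 0}" by auto
  ultimately show ?thesis by simp
qed

lemma dCR:
  assumes x: "x \<in> V \<inter> L" and T: "T \<in> L" "th x T = 1" and u: "u \<in> L" and v: "v \<in> L" "th x v = 0"
  shows "\<exists>z\<in>L. th x z = - eta x u (j x v)
      \<and> a x u (j x v) = J (a x u v) - eta x u v *\<^sub>R J (FD f x T) - FD f x z
      \<and> b x u (j x v) = J (b x u v) - eta x u v *\<^sub>R J (FD g x T) - FD g x z"
proof -
  have xV: "x \<in> V" using x by simp
  define W where "W = {y \<in> V. th y T \<noteq> 0}"
  have W: "open W" "x \<in> W \<inter> L" unfolding W_def using open_th_nz x T by auto
  have WV: "y \<in> V \<inter> L" if "y \<in> W \<inter> L" for y using that unfolding W_def by auto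
  define \<phi> where "\<phi> y = v - (th y v / th y T) *\<^sub>R T" for y
  have phx: "\<phi> x = v" unfolding \<phi>_def using v T by simp
  have dph: "(\<phi> has_derivative (\<lambda>u. - (eta x u v *\<^sub>R T))) (at x)"
    unfolding \<phi>_def by (rule has_derivative_horizontal[OF xV T(2) v(2)])
  have ph: "\<phi> y \<in> L" "th y (\<phi> y) = 0" if "y \<in> W \<inter> L" for y
    unfolding \<phi>_def using horizontal[of y v T] that T v unfolding W_def by auto
  \<comment> \<open>The derivative of this field in direction \<open>u\<close> is the witness
    \<open>z\<close>.\<close>
  define s where "s y = j y (\<phi> y)" for y
  have dj: "((\<lambda>y. j y v) has_derivative (\<lambda>u. FD (\<lambda>y. j y v) x u)) (at x)" for v
    by (rule smooth_on_has_derivative[OF V j_smooth xV])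
  obtain s' where s': "(s has_derivative s') (at x)"
    unfolding s_def using has_derivative_apply[OF dj V xV j_lin dph] by blast
  have sx: "s x = j x v" unfolding s_def phx ..
  note sl = has_derivative_zero_on_slice[OF W(1) L W(2)]
  \<comment> \<open>Along the slice \<open>s\<close> takes values in \<open>L\<close>, hence so does
    its derivative; the functionals that vanish on \<open>L\<close> are differentiated one at a
    time.\<close>
  have s'L: "s' u \<in> L"
  proof (rule mem_subspace_if_perp[OF L])
    fix p assume p: "\<And>q. q \<in> L \<Longrightarrow> q \<bullet> p = 0"
    have "((\<lambda>y. s y \<bullet> p) has_derivative (\<lambda>u. s' u \<bullet> p)) (at x)"
      by (rule has_derivative_inner_left[OF s'])
    from sl[OF u _ this] show "s' u \<bullet> p = 0"
      using p j_L[OF WV] ph unfolding s_def by blast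
  qed
  have th: "th x (s' u) = - eta x u (j x v)"
  proof -
    have "((\<lambda>y. th y (s y)) has_derivative (\<lambda>u. eta x u (s x) + th x (s' u))) (at x)"
      by (rule has_derivative_apply[OF dth[OF xV] V xV lin_th s'])
    from sl[OF u _ this] show ?thesis using j_th[OF WV] ph unfolding sx[symmetric] s_def by fastforce
  qed
  \<comment> \<open>The CR identity is differentiated once for a generic map \<open>h\<close>, to be
    used for both \<open>f\<close> and \<open>g\<close>.\<close>
  have h: "H2 u (j x v) + FD h x (s' u) - (J (H2 u v) - eta x u v *\<^sub>R J (FD h x T)) = 0"
    if H: "\<And>v. ((\<lambda>y. FD h y v) has_derivative (\<lambda>u. H2 u v)) (at x)" "\<And>y. y \<in> V \<Longrightarrow> linear (FD h y)"
      "\<And>y v. \<lbrakk>y \<in> V \<inter> L; v \<in> L; th y v = 0\<rbrakk> \<Longrightarrow> FD h y (j y v) = J (FD h y v)" for h :: "'e \<Rightarrow> 'f" and H2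
  proof -
    have 1: "((\<lambda>y. FD h y (s y) - J (FD h y (\<phi> y))) has_derivative
      (\<lambda>u. H2 u (s x) + FD h x (s' u) - J (H2 u (\<phi> x) + FD h x (- (eta x u v *\<^sub>R T))))) (at x)"
      by (intro has_derivative_diff dJ has_derivative_apply[OF H(1) V xV H(2)] s' dph)
    have "FD h y (s y) - J (FD h y (\<phi> y)) = 0" if "y \<in> W \<inter> L" for y
      unfolding s_def using H(3)[OF WV ph, OF that that that] by simp
    from sl[OF u this 1]
    show ?thesis unfolding sx phx
      by (simp add: linear_neg[OF H(2)[OF xV]] linear_scale[OF H(2)[OF xV]] linear_diff[OF J_linear]
          linear_scale[OF J_linear])
  qed
  have move: "p + q - r = 0 \<Longrightarrow> p = r - q" for p q r :: 'f
    by (simp add: eq_diff_eq)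
  have f: "a x u (j x v) + FD f x (s' u) - (J (a x u v) - eta x u v *\<^sub>R J (FD f x T)) = 0"
    by (rule h[OF ddf[OF xV] lin_f j_f])
  have g: "b x u (j x v) + FD g x (s' u) - (J (b x u v) - eta x u v *\<^sub>R J (FD g x T)) = 0"
    by (rule h[OF ddg[OF xV] lin_g j_g])
  show ?thesis
    using move[OF f] move[OF g] s'L th by (intro bexI[of _ "s' u"] conjI)
qed

text \<open>\<open>L\<close> has one dimension more than the contact hyperplane, so
  \<open>th x\<close> is not zero on \<open>L\<close>. After normalization, a horizontal preimage of
  the orthogonal projection onto the horizontal image is subtracted, which leaves
  \<open>th x\<close> unchanged.\<close>

lemma Reeb_direction:
  assumes x: "x \<in> V \<inter> L"
  obtains T where "T \<in> L" "th x T = 1" "\<And>v. \<lbrakk>v \<in> L; th x v = 0\<rbrakk> \<Longrightarrow> FD f x T \<bullet> FD f x v = 0"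
proof -
  have xV: "x \<in> V" using x by simp
  have "\<exists>t\<in>L. th x t \<noteq> 0"
  proof (rule ccontr)
    assume "\<not> ?thesis"
    then have "{v\<in>L. th x v = 0} = L" by auto
    then show False using dim_K[OF x] dim_L by simp
  qed
  then obtain t where t: "t \<in> L" "th x t \<noteq> 0" by blast
  define t0 where "t0 = (1 / th x t) *\<^sub>R t"
  have t0: "t0 \<in> L" "th x t0 = 1"
    unfolding t0_def using t L by (auto simp: subspace_mul linear_scale[OF lin_th[OF xV]])
  let ?K = "{v\<in>L. th x v = 0}"
  have K: "subspace ?K"
    using L lin_th[OF xV] unfolding subspace_def by (auto simp: linear_add linear_scale linear_0)
  obtain y z where yz: "y \<in> span (FD f x ` ?K)" "\<And>w. w \<in> span (FD f x ` ?K) \<Longrightarrow> orthogonal z w"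
    "FD f x t0 = y + z"
    using orthogonal_subspace_decomp_exists by blast
  have "span (FD f x ` ?K) = FD f x ` ?K"
    by (simp only: span_eq_iff linear_subspace_image[OF lin_f[OF xV] K])
  with yz(1) have "y \<in> FD f x ` ?K" by simp
  then obtain k where k: "k \<in> ?K" "y = FD f x k" by (rule imageE)
  show ?thesis
  proof (rule that[of "t0 - k"])
    show "FD f x (t0 - k) \<bullet> FD f x v = 0" if "v \<in> L" "th x v = 0" for v
      using yz(2)[of "FD f x v"] that yz(3) k
      by (simp add: linear_diff[OF lin_f[OF xV]] orthogonal_def span_base)
  qed (use t0 k L in \<open>auto simp: subspace_diff linear_diff[OF lin_th[OF xV]]\<close>)
qed

lemma jet:
  assumes x: "x \<in> V \<inter> L" and T: "T \<in> L" "th x T = 1"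
    "\<And>v. \<lbrakk>v \<in> L; th x v = 0\<rbrakk> \<Longrightarrow> FD f x T \<bullet> FD f x v = 0"
  shows "cr_jet_pair J L (FD f x) (FD g x) (th x) (a x) (b x) (eta x) (j x) T"
proof -
  have xV: "x \<in> V" using x by simp
  have nz: "FD f x T \<noteq> 0" "FD g x T \<noteq> 0"
    using f_inj[OF x T(1)] g_nz[OF x T(1)] T(2) linear_0[OF lin_th[OF xV]] by auto
  have eta: "eta x u v - eta x v u = 2 * (J (FD f x u) \<bullet> FD f x v)" if "u \<in> L" "v \<in> L" for u v
    by (rule eta_alt[OF xV])
  have inj: "v = 0" if "v \<in> L" "th x v = 0" "FD f x v = 0" for v
    by (rule f_inj[OF x that(1,3)])
  show ?thesis
    by (intro cr_jet_pair.intro cr_jet_pair_axioms.intro hermitian_space_axioms)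
      (fact L lin_f[OF xV] lin_g[OF xV] lin_th[OF xV] lin_a[OF xV] lin_b[OF xV] a_sym[OF xV] b_sym[OF xV]
        symp[OF x] dsymp[OF x] eta j_L[OF x] j_th[OF x] jj[OF x] j_f[OF x] j_g[OF x] T nz
        inj dim_K[OF x] dCR[OF x T(1,2)])+
qed

section \<open>The Gauss equation and equality of the induced metrics\<close>

lemma Q_zero_at:
  assumes x: "x \<in> V \<inter> L" and "u \<in> L" "th x u = 0" "v \<in> L" "th x v = 0" "w \<in> L" "th x w = 0"
  shows "b x u v \<bullet> FD g x w - a x u v \<bullet> FD f x w = 0"
proof -
  obtain T where T: "T \<in> L" "th x T = 1" "\<And>v. \<lbrakk>v \<in> L; th x v = 0\<rbrakk> \<Longrightarrow> FD f x T \<bullet> FD f x v = 0"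
    using Reeb_direction[OF x] by blast
  interpret P: cr_jet_pair J L "FD f x" "FD g x" "th x" "a x" "b x" "eta x" "j x" T
    by (rule jet[OF x T])
  show ?thesis using P.Q_zero[of u v w] assms unfolding P.Q_def P.K_def by simp
qed

lemma has_derivative_trilinear:
  fixes h :: "'e \<Rightarrow> 'f"
  assumes h: "smooth_on h V" and x: "x \<in> V"
    and p: "(p has_derivative p') (at x)" and q: "(q has_derivative q') (at x)" and r: "(r has_derivative r') (at x)"
  shows "((\<lambda>y. FD (\<lambda>z. FD h z (q y)) y (p y) \<bullet> FD h y (r y)) has_derivative
    (\<lambda>s. FD (\<lambda>z. FD h z (q x)) x (p x) \<bullet> (FD (\<lambda>z. FD h z (r x)) x s + FD h x (r' s))
      + (FD (\<lambda>y. FD (\<lambda>z. FD h z (q x)) y (p x)) x s + FD (\<lambda>z. FD h z (q x)) x (p' s)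
         + FD (\<lambda>z. FD h z (q' s)) x (p x)) \<bullet> FD h x (r x))) (at x)"
proof -
  have lin: "linear (FD h y)" if "y \<in> V" for y by (rule smooth_on_linear_FD[OF V h that])
  have lin2: "linear (FD (\<lambda>z. FD h z v) y)" if "y \<in> V" for y v
    by (rule smooth_on_linear_FD[OF V smooth_on_FD[OF h] that])
  \<comment> \<open>Linearity in the direction of the first differentiation is deduced from the
    symmetry of second derivatives.\<close>
  have lin2': "linear (\<lambda>v. FD (\<lambda>z. FD h z v) y u)" if "y \<in> V" for y u
  proof -
    have "(\<lambda>v. FD (\<lambda>z. FD h z v) y u) = FD (\<lambda>z. FD h z u) y"
      using FD_FD_commute[OF V h that] by blast
    then show ?thesis using lin2[OF that] by simp
  qed
  have d3: "((\<lambda>y. FD (\<lambda>z. FD h z v) y u) has_derivative (\<lambda>s. FD (\<lambda>y. FD (\<lambda>z. FD h z v) y u) x s)) (at x)" for u v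
    by (rule smooth_on_has_derivative[OF V smooth_on_FD[OF smooth_on_FD[OF h]] x])
  have 1: "((\<lambda>y. FD (\<lambda>z. FD h z v) y (p y)) has_derivative
     (\<lambda>s. FD (\<lambda>y. FD (\<lambda>z. FD h z v) y (p x)) x s + FD (\<lambda>z. FD h z v) x (p' s))) (at x)" for v
    by (rule has_derivative_apply[OF d3 V x lin2 p])
  have 2: "((\<lambda>y. FD (\<lambda>z. FD h z (q y)) y (p y)) has_derivative
     (\<lambda>s. FD (\<lambda>y. FD (\<lambda>z. FD h z (q x)) y (p x)) x s + FD (\<lambda>z. FD h z (q x)) x (p' s)
        + FD (\<lambda>z. FD h z (q' s)) x (p x))) (at x)"
    by (rule has_derivative_apply[OF 1 V x lin2' q])
  have 3: "((\<lambda>y. FD h y (r y)) has_derivative (\<lambda>s. FD (\<lambda>z. FD h z (r x)) x s + FD h x (r' s))) (at x)"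
    by (rule has_derivative_apply[OF smooth_on_has_derivative[OF V smooth_on_FD[OF h] x] V x lin r])
  show ?thesis by (rule has_derivative_inner[OF 2 3])
qed

text \<open>\<open>Q_zero_at\<close> is valid for horizontal arguments only, so it is differentiated
  along horizontal extensions of \<open>u\<close>, \<open>v\<close> and \<open>w\<close>. Each
  extension moves by a multiple of \<open>T\<close> with coefficient given by \<open>eta\<close>,
  which produces the three terms on the right, all with \<open>T\<close> in one slot.\<close>

lemma dQ_horizontal:
  assumes x: "x \<in> V \<inter> L" and T: "T \<in> L" "th x T = 1" and s: "s \<in> L"
    and u: "u \<in> L" "th x u = 0" and v: "v \<in> L" "th x v = 0" and w: "w \<in> L" "th x w = 0"
  shows "(FD (\<lambda>y. b y u v) x s \<bullet> FD g x w + b x u v \<bullet> b x s w)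
       - (FD (\<lambda>y. a y u v) x s \<bullet> FD f x w + a x u v \<bullet> a x s w)
    = eta x s u * (b x T v \<bullet> FD g x w - a x T v \<bullet> FD f x w)
      + eta x s v * (b x u T \<bullet> FD g x w - a x u T \<bullet> FD f x w)
      + eta x s w * (b x u v \<bullet> FD g x T - a x u v \<bullet> FD f x T)"
proof -
  have xV: "x \<in> V" using x by simp
  define W where "W = {y \<in> V. th y T \<noteq> 0}"
  have W: "open W" "x \<in> W \<inter> L" unfolding W_def using open_th_nz x T by auto
  define \<phi> where "\<phi> v y = v - (th y v / th y T) *\<^sub>R T" for v y
  have phx: "\<phi> u x = u" "\<phi> v x = v" "\<phi> w x = w" unfolding \<phi>_def using u v w by auto
  have dph: "(\<phi> v has_derivative (\<lambda>u. - (eta x u v *\<^sub>R T))) (at x)" if "th x v = 0" for v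
    unfolding \<phi>_def by (rule has_derivative_horizontal[OF xV T(2) that])
  have ph: "\<phi> v y \<in> L" "th y (\<phi> v y) = 0" if "y \<in> W \<inter> L" "v \<in> L" for y v
    unfolding \<phi>_def using horizontal[of y v T] that T unfolding W_def by auto
  have zero: "b y (\<phi> u y) (\<phi> v y) \<bullet> FD g y (\<phi> w y) - a y (\<phi> u y) (\<phi> v y) \<bullet> FD f y (\<phi> w y) = 0"
    if y: "y \<in> W \<inter> L" for y
    by (rule Q_zero_at) (use ph[OF y] u v w y in \<open>auto simp: W_def\<close>)
  have eq: "b x u v \<bullet> (b x s w + FD g x (- (eta x s w *\<^sub>R T)))
      + (FD (\<lambda>y. b y u v) x s + b x (- (eta x s u *\<^sub>R T)) v + b x u (- (eta x s v *\<^sub>R T))) \<bullet> FD g x w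
      - (a x u v \<bullet> (a x s w + FD f x (- (eta x s w *\<^sub>R T)))
      + (FD (\<lambda>y. a y u v) x s + a x (- (eta x s u *\<^sub>R T)) v + a x u (- (eta x s v *\<^sub>R T))) \<bullet> FD f x w) = 0"
    using has_derivative_zero_on_slice[OF W(1) L W(2) s zero
      has_derivative_diff[OF has_derivative_trilinear[OF sg xV dph[OF u(2)] dph[OF v(2)] dph[OF w(2)]]
        has_derivative_trilinear[OF sf xV dph[OF u(2)] dph[OF v(2)] dph[OF w(2)]]]]
    unfolding phx .
  have lins: "FD g x (- (c *\<^sub>R T)) = - (c *\<^sub>R FD g x T)" "FD f x (- (c *\<^sub>R T)) = - (c *\<^sub>R FD f x T)"
    "b x (- (c *\<^sub>R T)) v = - (c *\<^sub>R b x T v)" "a x (- (c *\<^sub>R T)) v = - (c *\<^sub>R a x T v)"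
    "b x u (- (c *\<^sub>R T)) = - (c *\<^sub>R b x u T)" "a x u (- (c *\<^sub>R T)) = - (c *\<^sub>R a x u T)" for c
    using linear_scale[OF lin_f[OF xV], of "-c" T] linear_scale[OF lin_g[OF xV], of "-c" T]
      linear_scale[OF lin_a_left[OF xV, of v], of "-c" T] linear_scale[OF lin_b_left[OF xV, of v], of "-c" T]
      linear_scale[OF lin_a[OF xV, of u], of "-c" T] linear_scale[OF lin_b[OF xV, of u], of "-c" T] by auto
  show ?thesis using eq unfolding lins by (simp add: inner_add_left inner_add_right algebra_simps)
qed

lemma third_sym:
  assumes "x \<in> V"
  shows "FD (\<lambda>y. a y u v) x s = FD (\<lambda>y. a y s v) x u" "FD (\<lambda>y. b y u v) x s = FD (\<lambda>y. b y s v) x u"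
  using FD_FD_commute[OF V smooth_on_FD[OF sf] assms] FD_FD_commute[OF V smooth_on_FD[OF sg] assms] by auto

text \<open>Positivity of the CR dimension enters here through \<open>dim_F\<close>; it provides the
  complex line on which the Gauss equation is evaluated.\<close>

lemma exists_horizontal:
  assumes "x \<in> V \<inter> L"
  shows "\<exists>v. v \<in> L \<and> th x v = 0 \<and> v \<noteq> 0"
proof (rule ccontr)
  assume "\<not> ?thesis"
  then have "{v\<in>L. th x v = 0} \<subseteq> {0}" by auto
  then have "dim {v\<in>L. th x v = 0} = 0" by (simp add: dim_eq_0)
  then show False using dim_K[OF assms] dim_F by linarith
qed

text \<open>Antisymmetrizing \<open>dQ_horizontal\<close> in the two directions of differentiation
  removes the third derivatives and leaves the Gauss equation required by
  \<open>del_zero\<close>.\<close>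

lemma isometric:
  assumes x: "x \<in> V \<inter> L" and vw: "v \<in> L" "w \<in> L"
  shows "FD f x v \<bullet> FD f x w = FD g x v \<bullet> FD g x w"
proof -
  have xV: "x \<in> V" using x by simp
  obtain T where T: "T \<in> L" "th x T = 1" "\<And>v. \<lbrakk>v \<in> L; th x v = 0\<rbrakk> \<Longrightarrow> FD f x T \<bullet> FD f x v = 0"
    using Reeb_direction[OF x] by blast
  interpret P: cr_jet_pair J L "FD f x" "FD g x" "th x" "a x" "b x" "eta x" "j x" T
    by (rule jet[OF x T])
  obtain k where k: "k \<in> P.K" "k \<noteq> 0" using exists_horizontal[OF x] unfolding P.K_def by blast
  have "P.del = 0"
  proof (rule P.del_zero[OF _ k])
    fix s y v w assume K: "s \<in> P.K" "y \<in> P.K" "v \<in> P.K" "w \<in> P.K"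
    note K' = K[unfolded P.K_def mem_Collect_eq]
    have "(FD (\<lambda>z. b z y v) x s \<bullet> FD g x w + b x y v \<bullet> b x s w)
       - (FD (\<lambda>z. a z y v) x s \<bullet> FD f x w + a x y v \<bullet> a x s w)
      = eta x s y * P.Q T v w + eta x s v * P.Q y T w + eta x s w * P.Q y v T"
      using dQ_horizontal[OF x T(1,2), of s y v w] K' unfolding P.Q_def by blast
    moreover have "(FD (\<lambda>z. b z s v) x y \<bullet> FD g x w + b x s v \<bullet> b x y w)
       - (FD (\<lambda>z. a z s v) x y \<bullet> FD f x w + a x s v \<bullet> a x y w)
      = eta x y s * P.Q T v w + eta x y v * P.Q s T w + eta x y w * P.Q s v T"
      using dQ_horizontal[OF x T(1,2), of y s v w] K' unfolding P.Q_def by blast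
    ultimately show "b x y v \<bullet> b x s w - b x s v \<bullet> b x y w - (a x y v \<bullet> a x s w - a x s v \<bullet> a x y w)
      = (eta x s y - eta x y s) * P.Q T v w + (eta x s v * P.Q y T w - eta x y v * P.Q s T w)
        + (eta x s w * P.Q y v T - eta x y w * P.Q s v T)"
      unfolding third_sym[OF xV, where u = y and v = v and s = s] left_diff_distrib by linarith
  qed
  then show ?thesis using P.inner_L vw by blast
qed

lemma koszul:
  assumes x: "x \<in> V \<inter> L" and uv: "u \<in> L" "v \<in> L" "w \<in> L"
  shows "a x u v \<bullet> FD f x w + FD f x v \<bullet> a x u w = b x u v \<bullet> FD g x w + FD g x v \<bullet> b x u w"
proof -
  have xV: "x \<in> V" using x by simp
  have "((\<lambda>y. FD f y v \<bullet> FD f y w - FD g y v \<bullet> FD g y w) has_derivative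
     (\<lambda>u. (FD f x v \<bullet> a x u w + a x u v \<bullet> FD f x w)
        - (FD g x v \<bullet> b x u w + b x u v \<bullet> FD g x w))) (at x)"
    by (intro has_derivative_diff has_derivative_inner ddf ddg xV)
  from slice[OF x uv(1) _ this] show ?thesis using isometric uv by simp
qed

lemma christoffel:
  assumes x: "x \<in> V \<inter> L" and uv: "u \<in> L" "v \<in> L" "w \<in> L"
  shows "b x u v \<bullet> FD g x w - a x u v \<bullet> FD f x w = 0"
proof -
  obtain T where T: "T \<in> L" "th x T = 1" "\<And>v. \<lbrakk>v \<in> L; th x v = 0\<rbrakk> \<Longrightarrow> FD f x T \<bullet> FD f x v = 0"
    using Reeb_direction[OF x] by blast
  interpret P: cr_jet_pair J L "FD f x" "FD g x" "th x" "a x" "b x" "eta x" "j x" T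
    by (rule jet[OF x T])
  show ?thesis using P.Q_L_zero[OF koszul[OF x] uv] unfolding P.Q_def .
qed

text \<open>With \<open>christoffel\<close> valid on all of \<open>L\<close>, constant fields can be
  used and no correction terms appear; antisymmetrizing removes the third derivatives again.\<close>

lemma gauss:
  assumes x: "x \<in> V \<inter> L" and L4: "s \<in> L" "u \<in> L" "v \<in> L" "w \<in> L"
  shows "b x u v \<bullet> b x s w - b x s v \<bullet> b x u w = a x u v \<bullet> a x s w - a x s v \<bullet> a x u w"
proof -
  have xV: "x \<in> V" using x by simp
  have *: "(FD (\<lambda>y. b y u v) x s \<bullet> FD g x w + b x u v \<bullet> b x s w)
       - (FD (\<lambda>y. a y u v) x s \<bullet> FD f x w + a x u v \<bullet> a x s w) = 0"
    if "s \<in> L" "u \<in> L" for s u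
  proof -
    have "((\<lambda>y. b y u v \<bullet> FD g y w - a y u v \<bullet> FD f y w) has_derivative
       (\<lambda>s. (b x u v \<bullet> b x s w + FD (\<lambda>y. b y u v) x s \<bullet> FD g x w)
          - (a x u v \<bullet> a x s w + FD (\<lambda>y. a y u v) x s \<bullet> FD f x w))) (at x)"
      by (intro has_derivative_diff has_derivative_inner ddf ddg xV
          smooth_on_has_derivative[OF V smooth_on_FD[OF smooth_on_FD[OF sf]]]
          smooth_on_has_derivative[OF V smooth_on_FD[OF smooth_on_FD[OF sg]]])
    from slice[OF x that(1) _ this] show ?thesis using christoffel that(2) L4(3,4) by simp
  qed
  show ?thesis using *[OF L4(1,2)] *[OF L4(2,1)] unfolding third_sym[OF xV, where u = u and v = v and s = s] by linarith
qed

section \<open>From unitary maps at single points to local rigidity\<close>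

lemma unitary_at:
  assumes x: "x \<in> V \<inter> L"
  shows "\<exists>U. linear U \<and> (\<forall>p. U (J p) = J (U p)) \<and> (\<forall>p. norm (U p) = norm p) \<and>
    (\<forall>v\<in>L. U (FD f x v) = FD g x v) \<and> (\<forall>u\<in>L. \<forall>v\<in>L. U (a x u v) = b x u v)"
proof -
  have xV: "x \<in> V" using x by simp
  obtain T where T: "T \<in> L" "th x T = 1" "\<And>v. \<lbrakk>v \<in> L; th x v = 0\<rbrakk> \<Longrightarrow> FD f x T \<bullet> FD f x v = 0"
    using Reeb_direction[OF x] by blast
  interpret P: cr_jet_pair J L "FD f x" "FD g x" "th x" "a x" "b x" "eta x" "j x" T
    by (rule jet[OF x T])
  obtain k where k: "k \<in> P.K" "k \<noteq> 0" using exists_horizontal[OF x] unfolding P.K_def by blast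
  have "P.del = 0" unfolding P.del_def using isometric[OF x T(1,1)] by simp
  moreover have "P.Q u v w = 0" if "u \<in> L" "v \<in> L" "w \<in> L" for u v w
    using christoffel[OF x that] unfolding P.Q_def .
  ultimately show ?thesis by (rule P.unitary_between_jets[OF _ _ gauss[OF x] k])
qed

text \<open>A vector orthogonal to \<open>P\<close> is orthogonal to the tangential image and to the
  normal \<open>J (FD f x T)\<close>, hence zero. A property of vectors closed under linear
  combinations and \<open>J\<close> thus needs checking on tangent vectors only.\<close>

lemma f_spans:
  assumes x: "x \<in> V \<inter> L" and P: "subspace P" "\<And>v. v \<in> L \<Longrightarrow> FD f x v \<in> P" "\<And>p. p \<in> P \<Longrightarrow> J p \<in> P"
  shows "P = UNIV"
proof -
  obtain T where T: "T \<in> L" "th x T = 1" "\<And>v. \<lbrakk>v \<in> L; th x v = 0\<rbrakk> \<Longrightarrow> FD f x T \<bullet> FD f x v = 0"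
    using Reeb_direction[OF x] by blast
  interpret P: cr_jet_pair J L "FD f x" "FD g x" "th x" "a x" "b x" "eta x" "j x" T
    by (rule jet[OF x T])
  have "p \<in> P" for p
  proof -
    obtain y z where yz: "y \<in> span P" "\<And>w. w \<in> span P \<Longrightarrow> orthogonal z w" "p = y + z"
      using orthogonal_subspace_decomp_exists by blast
    have "z \<bullet> w = 0" if "w \<in> P" for w using yz(2)[of w] that by (simp add: span_base orthogonal_def)
    then have "z = 0" by (intro P.A_full) (use P T P.K_L in auto)
    then show ?thesis using yz P(1) span_eq_iff by fastforce
  qed
  then show ?thesis by auto
qed

text \<open>The maps of \<open>unitary_at\<close> are chosen point by point and a priori depend on
  the point in no regular way. They are shown to be continuous, then differentiable with derivative
  zero along the slice, hence constant on a convex piece of it.\<close>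

lemma local_rigidity:
  assumes x0: "x0 \<in> V \<inter> L"
  shows "\<exists>r U c t. r > 0 \<and> ball x0 r \<subseteq> V \<and> linear U \<and> (\<forall>p. U (J p) = J (U p)) \<and> (\<forall>p. norm (U p) = norm p) \<and>
    (\<forall>x\<in>ball x0 r \<inter> L. g x = U (f x) + c \<and> \<tau>' x = \<tau> x + t - J c \<bullet> U (f x))"
proof -
  let ?S = "V \<inter> L"
  have "\<forall>x. \<exists>U. linear U \<and> (\<forall>p. U (J p) = J (U p)) \<and> (\<forall>p. norm (U p) = norm p) \<and>
    (x \<in> ?S \<longrightarrow> (\<forall>v\<in>L. U (FD f x v) = FD g x v) \<and> (\<forall>u\<in>L. \<forall>v\<in>L. U (a x u v) = b x u v))"
  proof
    fix x
    show "\<exists>U. linear U \<and> (\<forall>p. U (J p) = J (U p)) \<and> (\<forall>p. norm (U p) = norm p) \<and>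
      (x \<in> ?S \<longrightarrow> (\<forall>v\<in>L. U (FD f x v) = FD g x v) \<and> (\<forall>u\<in>L. \<forall>v\<in>L. U (a x u v) = b x u v))"
    proof (cases "x \<in> ?S")
      case True
      then show ?thesis using unitary_at[OF True] by blast
    next
      case False
      \<comment> \<open>A dummy value off the slice, which makes the choice total.\<close>
      then show ?thesis by (intro exI[of _ "\<lambda>p. p"]) (auto simp: linear_id[unfolded id_def])
    qed
  qed
  then obtain U where linU: "\<And>x. linear (U x)" and UJ: "\<And>x p. U x (J p) = J (U x p)"
    and Un: "\<And>x p. norm (U x p) = norm p" and Uf: "\<And>x v. \<lbrakk>x \<in> ?S; v \<in> L\<rbrakk> \<Longrightarrow> U x (FD f x v) = FD g x v"
    and Ua: "\<And>x u v. \<lbrakk>x \<in> ?S; u \<in> L; v \<in> L\<rbrakk> \<Longrightarrow> U x (a x u v) = b x u v"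
    by metis
  have inS: "\<forall>\<^sub>F y in at x within ?S. y \<in> ?S" for x by (simp add: eventually_at_filter)
  \<comment> \<open>This rewrites \<open>U y\<close> at a fixed vector as a smooth term minus a
    small one, which is controlled because \<open>U y\<close> is an isometry.\<close>
  have Ueq: "U y (FD f x v) = FD g y v - U y (FD f y v - FD f x v)" if "y \<in> ?S" "v \<in> L" for x y v
    using Uf[OF that] by (simp add: linear_diff[OF linU])
  have cont: "((\<lambda>y. U y p) \<longlongrightarrow> U x p) (at x within ?S)" if x: "x \<in> ?S" for x p
  proof -
    have xV: "x \<in> V" using x by simp
    define P where "P = {p. ((\<lambda>y. U y p) \<longlongrightarrow> U x p) (at x within ?S)}"
    have "P = UNIV"
    proof (rule f_spans[OF x])
      show "subspace P" unfolding P_def subspace_def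
        by (auto simp: linear_0[OF linU] linear_add[OF linU] linear_scale[OF linU] intro!: tendsto_intros)
      show "J p \<in> P" if "p \<in> P" for p
        using bounded_linear.tendsto[OF bl_J, of "\<lambda>y. U y p" "U x p"] that by (simp add: P_def UJ)
      show "FD f x v \<in> P" if v: "v \<in> L" for v
      proof -
        have g: "((\<lambda>y. FD g y v) \<longlongrightarrow> FD g x v) (at x within ?S)"
          by (rule continuous_within[THEN iffD1], rule continuous_at_imp_continuous_within)
            (rule has_derivative_continuous[OF ddg[OF xV]])
        have "((\<lambda>y. FD f y v) \<longlongrightarrow> FD f x v) (at x within ?S)"
          by (rule continuous_within[THEN iffD1], rule continuous_at_imp_continuous_within)
            (rule has_derivative_continuous[OF ddf[OF xV]])
        then have "((\<lambda>y. norm (U y (FD f y v - FD f x v))) \<longlongrightarrow> 0) (at x within ?S)"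
          unfolding Un by (intro tendsto_norm_zero LIM_zero)
        then have "((\<lambda>y. U y (FD f y v - FD f x v)) \<longlongrightarrow> 0) (at x within ?S)"
          by (rule tendsto_norm_zero_cancel)
        from tendsto_diff[OF g this]
        have "((\<lambda>y. FD g y v - U y (FD f y v - FD f x v)) \<longlongrightarrow> U x (FD f x v)) (at x within ?S)"
          using Uf[OF x v] by simp
        moreover have "\<forall>\<^sub>F y in at x within ?S. FD g y v - U y (FD f y v - FD f x v) = U y (FD f x v)"
          using inS by eventually_elim (use Ueq v in simp)
        ultimately show ?thesis unfolding P_def by (simp add: Lim_transform_eventually)
      qed
    qed
    then show ?thesis unfolding P_def by blast
  qed
  have deriv: "((\<lambda>y. U y p) has_derivative (\<lambda>_. 0)) (at x within ?S)" if x: "x \<in> ?S" for x p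
  proof -
    have xV: "x \<in> V" using x by simp
    define P where "P = {p. ((\<lambda>y. U y p) has_derivative (\<lambda>_. 0)) (at x within ?S)}"
    have "P = UNIV"
    proof (rule f_spans[OF x])
      show "subspace P" unfolding P_def subspace_def
      proof (safe)
        fix p q assume "((\<lambda>y. U y p) has_derivative (\<lambda>_. 0)) (at x within ?S)"
          "((\<lambda>y. U y q) has_derivative (\<lambda>_. 0)) (at x within ?S)"
        from has_derivative_add[OF this] show "((\<lambda>y. U y (p + q)) has_derivative (\<lambda>_. 0)) (at x within ?S)"
          by (simp add: linear_add[OF linU])
      next
        fix p c assume "((\<lambda>y. U y p) has_derivative (\<lambda>_. 0)) (at x within ?S)"
        from has_derivative_scaleR_right[OF this, of c]
        show "((\<lambda>y. U y (c *\<^sub>R p)) has_derivative (\<lambda>_. 0)) (at x within ?S)"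
          by (simp add: linear_scale[OF linU])
      qed (simp add: linear_0[OF linU])
      show "J p \<in> P" if "p \<in> P" for p
        using that dJ[of "\<lambda>y. U y p" "\<lambda>_. 0"] linear_0[OF J_linear] by (simp add: P_def UJ)
      show "FD f x v \<in> P" if v: "v \<in> L" for v
      proof -
        define k where "k y = FD f y v - FD f x v" for y
        have dk: "(k has_derivative (\<lambda>h. a x h v)) (at x within ?S)"
          unfolding k_def using has_derivative_diff[OF has_derivative_at_withinI[OF ddf[OF xV]] has_derivative_const]
          by simp
        \<comment> \<open>The vector \<open>k y\<close> vanishes at \<open>x\<close>, so the product
          rule needs only the continuity of \<open>U\<close> just shown.\<close>
        have "((\<lambda>y. \<Sum>i\<in>Basis. (k y \<bullet> i) *\<^sub>R U y i) has_derivative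
          (\<lambda>h. \<Sum>i\<in>Basis. (a x h v \<bullet> i) *\<^sub>R U x i)) (at x within ?S)"
          by (intro has_derivative_sum has_derivative_vanishing_scaleR has_derivative_inner_left dk cont x)
            (simp add: k_def)
        then have Uk: "((\<lambda>y. U y (k y)) has_derivative (\<lambda>h. U x (a x h v))) (at x within ?S)"
          unfolding linear_euclidean_sum[OF linU, symmetric] .
        have "((\<lambda>y. FD g y v - U y (k y)) has_derivative (\<lambda>h. b x h v - U x (a x h v))) (at x within ?S)"
          by (rule has_derivative_diff[OF has_derivative_at_withinI[OF ddg[OF xV]] Uk])
        then have "((\<lambda>y. U y (FD f x v)) has_derivative (\<lambda>h. b x h v - U x (a x h v))) (at x within ?S)"
          by (rule has_derivative_transform[OF x, rotated]) (use Ueq v in \<open>simp add: k_def\<close>)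
        \<comment> \<open>The second-order part of \<open>unitary_at\<close> makes this derivative
          vanish on \<open>L\<close>.\<close>
        then show ?thesis unfolding P_def mem_Collect_eq
          by (rule has_derivative_zero_within_subspace[OF _ L _ x]) (use Ua x v in auto)
      qed
    qed
    then show ?thesis unfolding P_def by blast
  qed
  obtain r where r: "r > 0" "ball x0 r \<subseteq> V" using x0 V open_contains_ball by blast
  define S where "S = ball x0 r \<inter> L"
  have S: "convex S" "x0 \<in> S" "S \<subseteq> ?S" "S \<subseteq> L"
    unfolding S_def using r x0 L by (auto intro: convex_Int subspace_imp_convex)
  define W where "W = U x0"
  have Uc: "U y p = W p" if "y \<in> S" for y p
    unfolding W_def by (rule has_derivative_zero_eq[OF S(1) _ S(2) that], rule has_derivative_subset[OF deriv]) (use S in auto)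
  have W: "linear W" "\<And>p. W (J p) = J (W p)" "\<And>p. norm (W p) = norm p" unfolding W_def using linU UJ Un by auto
  have blW: "bounded_linear W" using W(1) linear_conv_bounded_linear by blast
  have Wf: "W (FD f y v) = FD g y v" if "y \<in> S" "v \<in> L" for y v
    using Uf[of y v] Uc that S by auto
  have dWf: "((\<lambda>y. W (f y)) has_derivative (\<lambda>h. W (FD f y h))) (at y within S)" if "y \<in> S" for y
    by (rule bounded_linear.has_derivative[OF blW has_derivative_at_withinI[OF df]]) (use that S in auto)
  define c where "c = g x0 - W (f x0)"
  have gc: "g y = W (f y) + c" if "y \<in> S" for y
  proof -
    have "g y - W (f y) = g x0 - W (f x0)"
    proof (rule has_derivative_zero_eq[OF S(1) _ S(2) that])
      fix x assume x: "x \<in> S"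
      have "((\<lambda>y. g y - W (f y)) has_derivative (\<lambda>h. FD g x h - W (FD f x h))) (at x within S)"
        by (rule has_derivative_diff[OF has_derivative_at_withinI[OF dg] dWf]) (use x S in auto)
      then show "((\<lambda>y. g y - W (f y)) has_derivative (\<lambda>_. 0)) (at x within S)"
        by (rule has_derivative_zero_within_subspace[OF _ L S(4) x]) (use Wf x in auto)
    qed
    then show ?thesis unfolding c_def by (simp add: algebra_simps)
  qed
  define t where "t = \<tau>' x0 - \<tau> x0 + J c \<bullet> W (f x0)"
  have tc: "\<tau>' y = \<tau> y + t - J c \<bullet> W (f y)" if "y \<in> S" for y
  proof -
    have "\<tau>' y - \<tau> y + J c \<bullet> W (f y) = \<tau>' x0 - \<tau> x0 + J c \<bullet> W (f x0)"
    proof (rule has_derivative_zero_eq[OF S(1) _ S(2) that])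
      fix x assume x: "x \<in> S"
      have xV: "x \<in> V" using x S by auto
      have "((\<lambda>y. \<tau>' y - \<tau> y + J c \<bullet> W (f y)) has_derivative
         (\<lambda>h. FD \<tau>' x h - FD \<tau> x h + J c \<bullet> W (FD f x h))) (at x within S)"
        by (intro has_derivative_add has_derivative_diff has_derivative_inner_right dWf x
            has_derivative_at_withinI[OF smooth_on_has_derivative[OF V st' xV]]
            has_derivative_at_withinI[OF smooth_on_has_derivative[OF V st xV]])
      then show "((\<lambda>y. \<tau>' y - \<tau> y + J c \<bullet> W (f y)) has_derivative (\<lambda>_. 0)) (at x within S)"
      proof (rule has_derivative_zero_within_subspace[OF _ L S(4) x])
        fix v assume v: "v \<in> L"
        have "FD \<tau> x v + J (f x) \<bullet> FD f x v = FD \<tau>' x v + J (g x) \<bullet> FD g x v"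
          using th_g[of x v] x S v unfolding th_def by auto
        \<comment> \<open>The translation by \<open>c\<close> contributes the last summand, which is
          the derivative of the correction \<open>J c \<bullet> W (f y)\<close> in the
          height.\<close>
        moreover have "J (g x) \<bullet> FD g x v = J (f x) \<bullet> FD f x v + J c \<bullet> W (FD f x v)"
          unfolding gc[OF x] Wf[OF x v, symmetric]
          by (simp add: linear_add[OF J_linear] inner_add_left W(2)[symmetric] isometry_inner[OF W(1,3)])
        ultimately show "FD \<tau>' x v - FD \<tau> x v + J c \<bullet> W (FD f x v) = 0" by simp
      qed
    qed
    then show ?thesis unfolding t_def by (simp add: algebra_simps)
  qed
  show ?thesis using r W gc tc unfolding S_def by blast
qed

end

section \<open>Submanifolds and tangent spaces\<close>

lemma curve_eventually_in_open:
  fixes \<gamma> :: "real \<Rightarrow> 'a::real_normed_vector"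
  assumes "(\<gamma> has_vector_derivative v) (at 0)" "open W" "\<gamma> 0 \<in> W" "\<epsilon> > 0"
  obtains \<delta> where "\<delta> > 0" "\<delta> \<le> \<epsilon>" "\<gamma> ` {-\<delta><..<\<delta>} \<subseteq> W"
proof -
  have "isCont \<gamma> 0" using assms(1) has_vector_derivative_continuous by blast
  then have "\<forall>\<^sub>F t in at 0. \<gamma> t \<in> W" using assms(2,3) unfolding isCont_def by (rule topological_tendstoD)
  then obtain d where d: "d > 0" "\<And>t. t \<noteq> 0 \<Longrightarrow> dist t 0 < d \<Longrightarrow> \<gamma> t \<in> W"
    unfolding eventually_at by blast
  have "\<gamma> t \<in> W" if "\<bar>t\<bar> < d" for t using d(2)[of t] that assms(3) by (cases "t = 0") auto
  then show ?thesis using d(1) assms(4) by (intro that[of "min d \<epsilon>"]) (auto simp: abs_less_iff)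
qed

lemma has_vector_derivative_compose:
  assumes "(\<gamma> has_vector_derivative v) (at t)" "(g has_derivative g') (at (\<gamma> t))"
  shows "((\<lambda>s. g (\<gamma> s)) has_vector_derivative g' v) (at t)"
proof -
  have "((\<lambda>s. g (\<gamma> s)) has_derivative (\<lambda>s. g' (s *\<^sub>R v))) (at t)"
    using diff_chain_at[OF assms(1)[unfolded has_vector_derivative_def] assms(2)] by (simp add: o_def)
  then show ?thesis unfolding has_vector_derivative_def
    using linear_scale[OF has_derivative_linear[OF assms(2)]] by simp
qed

lemma has_vector_derivative_eventually_const:
  fixes h :: "real \<Rightarrow> 'a::real_normed_vector"
  assumes "(h has_vector_derivative v) (at 0)" "\<delta> > 0" "\<And>t. t \<in> {-\<delta><..<\<delta>} \<Longrightarrow> h t = 0"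
  shows "v = 0"
proof -
  have "(h has_vector_derivative 0) (at 0)"
    by (rule has_vector_derivative_transform_within_open[where S = "{-\<delta><..<\<delta>}" and f = "\<lambda>_. 0"])
      (use assms in auto)
  then show ?thesis using vector_derivative_unique_at assms(1) by blast
qed

text \<open>Both functions coincide along a curve representing \<open>v\<close>. Hence derivatives
  of ambient extensions depend, on tangent vectors, only on the values on \<open>M\<close>.\<close>

lemma FD_tangent_unique:
  assumes v: "v \<in> tangent_space M p" and W: "open W" "p \<in> W" "\<And>q. q \<in> M \<inter> W \<Longrightarrow> g q = h q"
    and g: "(g has_derivative g') (at p)" and h: "(h has_derivative h') (at p)"
  shows "g' v = h' v"
proof -
  obtain \<gamma> \<epsilon> where \<gamma>: "\<epsilon> > 0" "\<gamma> ` {-\<epsilon><..<\<epsilon>} \<subseteq> M" "\<gamma> 0 = p" "(\<gamma> has_vector_derivative v) (at 0)"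
    using v unfolding tangent_space_def by blast
  have "\<gamma> 0 \<in> W" using \<gamma>(3) W(2) by simp
  then obtain \<delta> where \<delta>: "\<delta> > 0" "\<delta> \<le> \<epsilon>" "\<gamma> ` {-\<delta><..<\<delta>} \<subseteq> W"
    by (rule curve_eventually_in_open[OF \<gamma>(4) W(1) _ \<gamma>(1)])
  have "((\<lambda>s. g (\<gamma> s) - h (\<gamma> s)) has_vector_derivative g' v - h' v) (at 0)"
    by (rule has_vector_derivative_diff[OF has_vector_derivative_compose[OF \<gamma>(4)]
          has_vector_derivative_compose[OF \<gamma>(4)]]) (use \<gamma>(3) g h in auto)
  then have "g' v - h' v = 0"
    by (rule has_vector_derivative_eventually_const[OF _ \<delta>(1)]) (use \<delta> \<gamma> W(3) in force)
  then show ?thesis by simp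
qed

text \<open>\<open>dmap\<close> selects some extension; on tangent vectors the choice is immaterial
  by \<open>FD_tangent_unique\<close>.\<close>

lemma dmap_eq:
  assumes "v \<in> tangent_space M p" "open W" "p \<in> W" "smooth_on g W" "\<And>q. q \<in> M \<inter> W \<Longrightarrow> g q = f q"
  shows "dmap M f p v = FD g p v"
proof -
  have "\<exists>g W. open W \<and> p \<in> W \<and> smooth_on g W \<and> (\<forall>q\<in>M \<inter> W. g q = f q) \<and> dmap M f p v = FD g p v"
    unfolding dmap_def by (rule someI) (use assms in blast)
  then obtain h W' where h: "open W'" "p \<in> W'" "smooth_on h W'" "\<forall>q\<in>M \<inter> W'. h q = f q" "dmap M f p v = FD h p v"
    by blast
  have "FD h p v = FD g p v"
    by (rule FD_tangent_unique[OF assms(1), of "W \<inter> W'" h g])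
      (use assms h smooth_on_has_derivative in auto)
  then show ?thesis using h by simp
qed

lemma tangent_space_push:
  assumes "v \<in> tangent_space M p" "open W" "p \<in> W" "(g has_derivative g') (at p)"
    "\<And>q. q \<in> M \<inter> W \<Longrightarrow> g q \<in> N"
  shows "g' v \<in> tangent_space N (g p)"
proof -
  obtain \<gamma> \<epsilon> where \<gamma>: "\<epsilon> > 0" "\<gamma> ` {-\<epsilon><..<\<epsilon>} \<subseteq> M" "\<gamma> 0 = p" "(\<gamma> has_vector_derivative v) (at 0)"
    using assms(1) unfolding tangent_space_def by blast
  have "\<gamma> 0 \<in> W" using \<gamma>(3) assms(3) by simp
  then obtain \<delta> where \<delta>: "\<delta> > 0" "\<delta> \<le> \<epsilon>" "\<gamma> ` {-\<delta><..<\<delta>} \<subseteq> W"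
    by (rule curve_eventually_in_open[OF \<gamma>(4) assms(2) _ \<gamma>(1)])
  have "((\<lambda>s. g (\<gamma> s)) has_vector_derivative g' v) (at 0)"
    by (rule has_vector_derivative_compose[OF \<gamma>(4)]) (use \<gamma>(3) assms(4) in simp)
  moreover have "(\<lambda>s. g (\<gamma> s)) ` {-\<delta><..<\<delta>} \<subseteq> N" using \<delta> \<gamma> assms(5) by force
  ultimately show ?thesis unfolding tangent_space_def using \<delta>(1) \<gamma>(3) by blast
qed

locale slice_chart =
  fixes M W V :: "'a::euclidean_space set" and \<psi> :: "'a \<Rightarrow> 'a" and L :: "'a set"
  assumes W: "open W" and V: "open V" and L: "subspace L" and s_psi: "smooth_on \<psi> W"
    and bij: "bij_betw \<psi> W V" and s_par: "smooth_on (inv_into W \<psi>) V" and image: "\<psi> ` (M \<inter> W) = V \<inter> L"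
begin

definition par where "par = inv_into W \<psi>"

lemma smooth_par: "smooth_on par V" unfolding par_def by (rule s_par)

lemma psi_par: "x \<in> V \<Longrightarrow> \<psi> (par x) = x"
  unfolding par_def using bij by (simp add: bij_betw_inv_into_right)

lemma par_psi: "q \<in> W \<Longrightarrow> par (\<psi> q) = q"
  unfolding par_def using bij by (simp add: bij_betw_inv_into_left)

lemma par_W: "x \<in> V \<Longrightarrow> par x \<in> W"
  unfolding par_def using bij bij_betw_imp_surj_on inv_into_into by metis

lemma par_M: "x \<in> V \<inter> L \<Longrightarrow> par x \<in> M" using image par_psi by (metis (no_types, lifting) IntE imageE)

lemma psi_L: "q \<in> M \<inter> W \<Longrightarrow> \<psi> q \<in> V \<inter> L" using image by blast

lemma d_par: "x \<in> V \<Longrightarrow> (par has_derivative FD par x) (at x)"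
  by (rule smooth_on_has_derivative[OF V smooth_par])

lemma d_psi: "q \<in> W \<Longrightarrow> (\<psi> has_derivative FD \<psi> q) (at q)"
  by (rule smooth_on_has_derivative[OF W s_psi])

lemma FD_psi_par: assumes "x \<in> V" shows "FD \<psi> (par x) (FD par x v) = v"
proof -
  have "((\<lambda>y. \<psi> (par y)) has_derivative (\<lambda>v. FD \<psi> (par x) (FD par x v))) (at x)"
    using diff_chain_at[OF d_par[OF assms] d_psi[OF par_W[OF assms]]] by (simp add: o_def)
  then have "((\<lambda>y. y) has_derivative (\<lambda>v. FD \<psi> (par x) (FD par x v))) (at x)"
    by (rule has_derivative_transform_within_open[OF _ V assms]) (rule psi_par)
  from has_derivative_unique[OF this has_derivative_ident] show ?thesis by metis
qed

lemma FD_par_psi: assumes "x \<in> V" shows "FD par x (FD \<psi> (par x) v) = v"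
proof -
  note q = par_W[OF assms]
  have "((\<lambda>y. par (\<psi> y)) has_derivative (\<lambda>v. FD par x (FD \<psi> (par x) v))) (at (par x))"
    using diff_chain_at[OF d_psi[OF q]] d_par[OF assms] psi_par[OF assms] by (simp add: o_def)
  then have "((\<lambda>y. y) has_derivative (\<lambda>v. FD par x (FD \<psi> (par x) v))) (at (par x))"
    by (rule has_derivative_transform_within_open[OF _ W q]) (rule par_psi)
  from has_derivative_unique[OF this has_derivative_ident] show ?thesis by metis
qed

text \<open>One inclusion moves along straight lines in the slice. For the other, functionals that
  vanish on \<open>L\<close> vanish on the image of \<open>M \<inter> W\<close> under
  \<open>\<psi>\<close>, so their derivatives vanish on tangent vectors.\<close>

lemma tangent_space_eq:
  assumes x: "x \<in> V \<inter> L"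
  shows "tangent_space M (par x) = FD par x ` L"
proof
  have xV: "x \<in> V" using x by simp
  show "FD par x ` L \<subseteq> tangent_space M (par x)"
  proof
    fix w assume "w \<in> FD par x ` L"
    then obtain v where v: "v \<in> L" "w = FD par x v" by blast
    have l: "((\<lambda>s::real. x + s *\<^sub>R v) has_vector_derivative v) (at 0)"
      by (auto intro!: derivative_eq_intros)
    have "v \<in> tangent_space L x"
      unfolding tangent_space_def using l v x L
      by (auto intro!: exI[of _ "\<lambda>s::real. x + s *\<^sub>R v"] exI[of _ "1::real"] simp: subspace_add subspace_mul)
    then show "w \<in> tangent_space M (par x)" unfolding v(2)
      by (rule tangent_space_push[OF _ V xV d_par[OF xV]]) (use par_M in auto)
  qed
  show "tangent_space M (par x) \<subseteq> FD par x ` L"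
  proof
    fix w assume w: "w \<in> tangent_space M (par x)"
    have "FD \<psi> (par x) w \<in> L"
    proof (rule mem_subspace_if_perp[OF L])
      fix p assume p: "\<And>q. q \<in> L \<Longrightarrow> q \<bullet> p = 0"
      show "FD \<psi> (par x) w \<bullet> p = 0"
        by (rule FD_tangent_unique[OF w W par_W[OF xV], of "\<lambda>q. \<psi> q \<bullet> p" "\<lambda>_. 0" _ "\<lambda>_. 0"])
          (use p psi_L in \<open>auto intro!: has_derivative_inner_left d_psi par_W xV\<close>)
    qed
    then show "w \<in> FD par x ` L" using FD_par_psi[OF xV, of w] by (metis imageI)
  qed
qed

lemma tangent_space_subspace: "x \<in> V \<inter> L \<Longrightarrow> subspace (tangent_space M (par x))"
  using tangent_space_eq linear_subspace_image[OF has_derivative_linear[OF d_par] L] by simp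

end

lemma embedded_submanifold_chart:
  fixes M :: "'a::euclidean_space set"
  assumes "embedded_submanifold M k" "p \<in> M"
  obtains W V \<psi> L where "slice_chart M W V \<psi> L" "p \<in> W" "dim L = k"
proof -
  obtain W V L and \<psi> :: "'a \<Rightarrow> 'a" where c: "open W" "p \<in> W" "open V" "subspace L" "dim L = k" "smooth_on \<psi> W"
    "bij_betw \<psi> W V" "smooth_on (inv_into W \<psi>) V" "\<psi> ` (M \<inter> W) = V \<inter> L"
    using assms(1)[unfolded embedded_submanifold_def, THEN bspec, OF assms(2)]
    by (elim exE conjE) (rule that)
  have "slice_chart M W V \<psi> L" by (rule slice_chart.intro) (fact c)+
  then show ?thesis using c(2,5) by (rule that)
qed

lemma embedded_tangent_subspace:
  assumes "embedded_submanifold M k" "p \<in> M"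
  shows "subspace (tangent_space M p)"
proof -
  obtain W V \<psi> L where c: "slice_chart M W V \<psi> L" "p \<in> W" using embedded_submanifold_chart[OF assms] by metis
  interpret slice_chart M W V \<psi> L by (rule c)
  show ?thesis using tangent_space_subspace[OF psi_L, of p] par_psi c assms by simp
qed

section \<open>Heisenberg rigid motions\<close>

definition mulI :: "complex ^ 'n::finite \<Rightarrow> complex ^ 'n" where
  "mulI p = (\<chi> \<beta>. \<i> * p $ \<beta>)"

interpretation mulI: hermitian_space "mulI :: complex ^ 'n::finite \<Rightarrow> complex ^ 'n"
proof
  show "mulI (p + q) = mulI p + mulI q" for p q :: "complex ^ 'n"
    by (simp add: mulI_def vec_eq_iff algebra_simps)
  show "mulI (r *\<^sub>R p) = r *\<^sub>R mulI p" for r and p :: "complex ^ 'n"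
    by (simp add: mulI_def vec_eq_iff)
  show "mulI (mulI p) = - p" for p :: "complex ^ 'n"
    by (simp add: mulI_def vec_eq_iff mult.assoc[symmetric])
  show "mulI p \<bullet> mulI q = p \<bullet> q" for p q :: "complex ^ 'n"
    by (simp add: mulI_def inner_vec_def inner_complex_def algebra_simps)
qed

section \<open>The Heisenberg structure in terms of the real inner product\<close>

lemma Theta_eq: "Theta p v = snd v + mulI (fst p) \<bullet> fst v"
  by (simp add: Theta_def mulI_def inner_vec_def inner_complex_def algebra_simps)

lemma Jst_eq: "Jst p v = (mulI (fst v), - (fst p \<bullet> fst v))"
  by (simp add: Jst_def mulI_def inner_vec_def inner_complex_def)

lemma levi_eq: "levi v w = fst v \<bullet> fst w"
  by (simp add: levi_def inner_vec_def inner_complex_def)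

lemma Theta_linear: "linear (Theta p)"
  by (rule linearI) (simp_all add: Theta_eq inner_add_right algebra_simps)

lemma Jst_linear: "linear (Jst p)"
  by (rule linearI) (simp_all add: Jst_eq inner_add_right linear_add[OF mulI.J_linear] linear_scale[OF mulI.J_linear])

text \<open>In the t-component this is exactly the horizontality condition on
  \<open>v\<close>.\<close>

lemma Jst_Jst: "v \<in> xi p \<Longrightarrow> Jst p (Jst p v) = - v"
  unfolding xi_def Theta_eq by (auto simp: Jst_eq mulI.J_J mulI.J_skew prod_eq_iff)

text \<open>If \<open>Reeb\<close> were tangent, 0 would satisfy the description of the fundamental
  field and be the only solution: any solution is then itself tangent and horizontal, thus
  orthogonal to itself.\<close>

lemma Reeb_notin_tangent_space:
  assumes T: "subspace (tangent_space M p)" and nz: "fundamental_field M p \<noteq> 0"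
  shows "Reeb \<notin> tangent_space M p"
proof
  assume R: "Reeb \<in> tangent_space M p"
  have "fundamental_field M p = 0"
    unfolding fundamental_field_def
  proof (rule the_equality)
    show "0 \<in> xi p \<and> (\<forall>X\<in>xi_hat M p. levi 0 X = 0) \<and> Reeb + 0 \<in> tangent_space M p"
      using R by (simp add: xi_def levi_eq linear_0[OF Theta_linear])
    fix \<nu> assume \<nu>: "\<nu> \<in> xi p \<and> (\<forall>X\<in>xi_hat M p. levi \<nu> X = 0) \<and> Reeb + \<nu> \<in> tangent_space M p"
    then have "\<nu> \<in> tangent_space M p" using subspace_diff[OF T, of "Reeb + \<nu>" Reeb] R by simp
    then have "levi \<nu> \<nu> = 0" using \<nu> unfolding xi_hat_def by blast
    then have f: "fst \<nu> = 0" unfolding levi_eq by simp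
    then have "snd \<nu> = 0" using \<nu> unfolding xi_def Theta_eq by simp
    with f show "\<nu> = 0" by (simp add: prod_eq_iff)
  qed
  then show False using nz by simp
qed

text \<open>A nonzero vector of this kind is a multiple of \<open>Reeb\<close>. This makes the
  projection of \<open>M\<close> to C^n an immersion.\<close>

lemma vertical_tangent_zero:
  assumes "subspace (tangent_space M p)" "fundamental_field M p \<noteq> 0" "w \<in> tangent_space M p" "fst w = 0"
  shows "w = 0"
proof (rule ccontr)
  assume "w \<noteq> 0"
  then have s: "snd w \<noteq> 0" using assms(4) by (simp add: prod_eq_iff)
  have "(1 / snd w) *\<^sub>R w = Reeb" using s assms(4) by (simp add: Reeb_def prod_eq_iff)
  then have "Reeb \<in> tangent_space M p" using subspace_mul[OF assms(1,3)] by metis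
  then show False using Reeb_notin_tangent_space assms by blast
qed

section \<open>Rigid motions as affine maps\<close>

text \<open>The \<open>t\<close>-component is forced, up to the constant \<open>t\<close>, by invariance of \<open>Theta\<close>.\<close>
definition rigid_motion :: "(complex ^ 'n::finite \<Rightarrow> complex ^ 'n) \<Rightarrow> complex ^ 'n \<Rightarrow> real \<Rightarrow> 'n heis \<Rightarrow> 'n heis" where
  "rigid_motion U c t q = (U (fst q) + c, snd q + t - mulI c \<bullet> U (fst q))"

definition unitary_map :: "(complex ^ 'n::finite \<Rightarrow> complex ^ 'n) \<Rightarrow> bool" where
  "unitary_map U \<longleftrightarrow> linear U \<and> (\<forall>p. U (mulI p) = mulI (U p)) \<and> (\<forall>p. norm (U p) = norm p)"

lemma rigid_motion_linear_part:
  fixes U :: "complex ^ 'n::finite \<Rightarrow> complex ^ 'n"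
  assumes "linear U"
  shows "bounded_linear (\<lambda>v. (U (fst v), snd v - mulI c \<bullet> U (fst v)))"
  by (rule linear_conv_bounded_linear[THEN iffD1], rule linearI)
    (simp_all add: linear_add[OF assms] linear_scale[OF assms] inner_add_right algebra_simps)

lemma rigid_motion_affine:
  "rigid_motion U c t = (\<lambda>v. (U (fst v), snd v - mulI c \<bullet> U (fst v)) + (c, t))"
  by (simp add: rigid_motion_def fun_eq_iff)

lemma rigid_motion_has_derivative:
  assumes "linear U"
  shows "(rigid_motion U c t has_derivative (\<lambda>v. (U (fst v), snd v - mulI c \<bullet> U (fst v)))) F"
  unfolding rigid_motion_affine
  using has_derivative_add_const bounded_linear_imp_has_derivative[OF rigid_motion_linear_part[OF assms]] by blast

lemma rigid_motion_PSH:
  assumes "unitary_map U"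
  shows "rigid_motion U c t \<in> PSH"
proof -
  have U: "linear U" "\<And>p. U (mulI p) = mulI (U p)" "\<And>p. norm (U p) = norm p"
    using assms unfolding unitary_map_def by auto
  have ot: "orthogonal_transformation U" using U(1,3) orthogonal_transformation by blast
  define U' where "U' = inv U"
  have bij: "bij U" using ot by (rule orthogonal_transformation_bij)
  have U': "linear U'" "\<And>p. U (U' p) = p" "\<And>p. U' (U p) = p"
    unfolding U'_def using orthogonal_transformation_inv[OF ot] bij
    by (auto simp: orthogonal_transformation_def bij_is_surj surj_f_inv_f bij_is_inj)
  \<comment> \<open>The inverse; composing it with the motion leaves a term
    \<open>mulI c \<bullet> c\<close>, which is zero.\<close>
  define G where "G q = (U' (fst q), snd q + mulI c \<bullet> fst q) + (U' (- c), - t)" for q :: "'a heis"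
  have blG: "bounded_linear (\<lambda>q::'a heis. (U' (fst q), snd q + mulI c \<bullet> fst q))"
    by (rule linear_conv_bounded_linear[THEN iffD1], rule linearI)
      (simp_all add: linear_add[OF U'(1)] linear_scale[OF U'(1)] inner_add_right algebra_simps)
  have inv: "G (rigid_motion U c t q) = q" "rigid_motion U c t (G q) = q" for q
    by (simp_all add: G_def rigid_motion_def prod_eq_iff linear_add[OF U(1)] linear_add[OF U'(1)]
        linear_neg[OF U'(1)] linear_neg[OF U(1)] linear_diff[OF U(1)] inner_diff_right U' inner_add_right mulI.J_inner_self)
  have "bij (rigid_motion U c t)" by (rule o_bij[of G]) (use inv in \<open>auto simp: fun_eq_iff\<close>)
  moreover have "inv (rigid_motion U c t) = G" by (rule inv_equality) (use inv in auto)
  moreover have "smooth_on (rigid_motion U c t) UNIV"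
    unfolding rigid_motion_affine by (rule smooth_on_affine[OF open_UNIV rigid_motion_linear_part[OF U(1)]])
  moreover have "smooth_on G UNIV" unfolding G_def by (rule smooth_on_affine[OF open_UNIV blG])
  moreover have FD: "FD (rigid_motion U c t) p v = (U (fst v), snd v - mulI c \<bullet> U (fst v))" for p v
    by (rule FD_eqI[OF rigid_motion_has_derivative[OF U(1)]])
  moreover have "Theta (rigid_motion U c t p) (U (fst v), snd v - mulI c \<bullet> U (fst v)) = Theta p v" for p v
    by (simp add: Theta_eq rigid_motion_def linear_add[OF mulI.J_linear] inner_add_left
        U(2)[symmetric] isometry_inner[OF U(1,3)])
  moreover have "(U (fst (Jst p v)), snd (Jst p v) - mulI c \<bullet> U (fst (Jst p v)))
      = Jst (rigid_motion U c t p) (U (fst v), snd v - mulI c \<bullet> U (fst v))" for p v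
    by (simp add: Jst_eq rigid_motion_def U(2) mulI.J_inner inner_add_left isometry_inner[OF U(1,3)])
  ultimately show ?thesis unfolding PSH_def by (simp del: split_paired_All)
qed

text \<open>The last conjunct, that the projected tangent space spans C^n over the complex numbers,
  is carried along so that overlapping local motions can be compared by
  \<open>rigid_motion_unique\<close>.\<close>

lemma local_rigid_motion:
  fixes M N :: "('n::finite) heis set" and \<phi> :: "'n heis \<Rightarrow> 'n heis" and m :: nat
  assumes card: "CARD('n) \<ge> 2"
    and m: "m = CARD('n) - 1"
    and M: "pseudohermitian_submanifold M m"
    and N: "pseudohermitian_submanifold N m"
    and nzM: "\<forall>p\<in>M. fundamental_field M p \<noteq> 0"
    and nzN: "\<forall>p\<in>N. fundamental_field N p \<noteq> 0"
    and \<phi>: "ph_transformation M N \<phi>" and p: "p \<in> M"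
  shows "\<exists>S U c t. open S \<and> p \<in> S \<and> unitary_map U \<and> (\<forall>q\<in>M \<inter> S. \<phi> q = rigid_motion U c t q) \<and>
    (\<forall>P. subspace P \<longrightarrow> (\<forall>z\<in>P. mulI z \<in> P) \<longrightarrow> fst ` tangent_space M p \<subseteq> P \<longrightarrow> P = UNIV)"
proof -
  have eM: "embedded_submanifold M (2 * m + 1)" and eN: "embedded_submanifold N (2 * m + 1)"
    using M N unfolding pseudohermitian_submanifold_def by auto
  have hat: "\<And>q. q \<in> M \<Longrightarrow> Jst q ` xi_hat M q \<subseteq> xi_hat M q" "\<And>q. q \<in> M \<Longrightarrow> dim (xi_hat M q) = 2 * m"
    using M unfolding pseudohermitian_submanifold_def by auto
  have \<phi>N: "\<And>q. q \<in> M \<Longrightarrow> \<phi> q \<in> N" and sm: "smooth_map_on M \<phi>"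
    and \<phi>T: "\<And>q v. q \<in> M \<Longrightarrow> v \<in> tangent_space M q \<Longrightarrow> Theta (\<phi> q) (dmap M \<phi> q v) = Theta q v"
    and \<phi>J: "\<And>q v. q \<in> M \<Longrightarrow> v \<in> xi_hat M q \<Longrightarrow> dmap M \<phi> q (Jst q v) = Jst (\<phi> q) (dmap M \<phi> q v)"
    using \<phi> unfolding ph_transformation_def by (auto dest: bij_betwE)
  obtain W V \<psi> L where ch: "slice_chart M W V \<psi> L" "p \<in> W" "dim L = 2 * m + 1"
    by (rule embedded_submanifold_chart[OF eM p])
  interpret slice_chart M W V \<psi> L by (rule ch(1))
  obtain h W0 where h: "open W0" "p \<in> W0" "smooth_on h W0" "\<And>q. q \<in> M \<inter> W0 \<Longrightarrow> h q = \<phi> q"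
    using sm[unfolded smooth_map_on_def, THEN bspec, OF p] by blast
  \<comment> \<open>Parameters whose image lies in the domain of \<open>h\<close>, a smooth ambient
    extension of \<open>\<phi>\<close> near \<open>p\<close>.\<close>
  define V0 where "V0 = V \<inter> par -` W0"
  have V0: "open V0"
    unfolding V0_def using continuous_on_open_vimage[OF V] smooth_on_continuous_on[OF smooth_par] h(1)
    by (metis Int_commute)
  have V0V: "V0 \<subseteq> V" unfolding V0_def by blast
  have sp: "smooth_on par V0" using smooth_par V0V by (rule smooth_on_subset)
  define G where "G x = h (par x)" for x
  have parW0: "par ` V0 \<subseteq> W0" unfolding V0_def by blast
  have sG: "smooth_on G V0" unfolding G_def by (rule smooth_on_compose[OF V0 h(1) parW0 sp h(3)])
  have FDG: "FD G x v = FD h (par x) (FD par x v)" if "x \<in> V0" for x v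
    unfolding G_def by (rule FD_compose[OF V0 h(1) parW0 sp h(3) that])
  define f where "f x = fst (par x)" for x
  define g where "g x = fst (G x)" for x
  define \<tau> where "\<tau> x = snd (par x)" for x
  define \<tau>' where "\<tau>' x = snd (G x)" for x
  define th where "th x v = FD \<tau> x v + mulI (f x) \<bullet> FD f x v" for x v
  \<comment> \<open>The CR structure read in the chart. Using the formula of \<open>Jst\<close> for
    all \<open>v\<close> makes \<open>j\<close> a smooth field of linear maps on an open set; it
    acts as a complex structure on horizontal vectors at points of the slice.\<close>
  define j where "j x v = FD \<psi> (par x) (Jst (par x) (FD par x v))" for x v
  have FDs: "FD f x v = fst (FD par x v)" "FD \<tau> x v = snd (FD par x v)"
    "FD g x v = fst (FD G x v)" "FD \<tau>' x v = snd (FD G x v)" if "x \<in> V0" for x v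
    unfolding f_def g_def \<tau>_def \<tau>'_def
    by (rule FD_bounded_linear[OF V0 bounded_linear_fst sp that] FD_bounded_linear[OF V0 bounded_linear_snd sp that]
        FD_bounded_linear[OF V0 bounded_linear_fst sG that] FD_bounded_linear[OF V0 bounded_linear_snd sG that])+
  have th_eq: "th x v = Theta (par x) (FD par x v)" if "x \<in> V0" for x v
    unfolding th_def Theta_eq FDs[OF that] f_def by simp
  have linpar: "linear (FD par x)" if "x \<in> V0" for x by (rule smooth_on_linear_FD[OF V0 sp that])
  have sl: "x \<in> V \<inter> L" "x \<in> V" "par x \<in> M" "par x \<in> W0" "h (par x) = \<phi> (par x)" if "x \<in> V0 \<inter> L" for x
    using that V0V par_M[of x] h(4)[of "par x"] parW0 by auto
  have tan: "FD par x v \<in> tangent_space M (par x)" if "x \<in> V0 \<inter> L" "v \<in> L" for x v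
    unfolding tangent_space_eq[OF sl(1)[OF that(1)]] using that(2) by blast
  have tan_L: "FD \<psi> (par x) w \<in> L" if "x \<in> V0 \<inter> L" "w \<in> tangent_space M (par x)" for x w
    using that(2) unfolding tangent_space_eq[OF sl(1)[OF that(1)]]
    using FD_psi_par[OF sl(2)[OF that(1)]] by auto
  have dmap_h: "dmap M \<phi> (par x) w = FD h (par x) w" if "x \<in> V0 \<inter> L" "w \<in> tangent_space M (par x)" for x w
    by (rule dmap_eq[OF that(2) h(1) sl(4)[OF that(1)] h(3,4)])
  have hat_in: "FD par x v \<in> xi_hat M (par x)" if "x \<in> V0 \<inter> L" "v \<in> L" "th x v = 0" for x v
    using tan[OF that(1,2)] that(1,3) th_eq[of x v] unfolding xi_hat_def xi_def by simp
  have Jhat: "Jst (par x) (FD par x v) \<in> xi_hat M (par x)" if "x \<in> V0 \<inter> L" "v \<in> L" "th x v = 0" for x v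
    using hat(1)[OF sl(3)[OF that(1)]] hat_in[OF that] by blast
  have par_j: "FD par x (j x v) = Jst (par x) (FD par x v)" if "x \<in> V0 \<inter> L" for x v
    unfolding j_def by (rule FD_par_psi[OF sl(2)[OF that]])
  have subM: "subspace (tangent_space M q)" if "q \<in> M" for q by (rule embedded_tangent_subspace[OF eM that])
  have subN: "subspace (tangent_space N q)" if "q \<in> N" for q by (rule embedded_tangent_subspace[OF eN that])
  have Th_G: "Theta (G x) (FD G x v) = th x v" if "x \<in> V0 \<inter> L" "v \<in> L" for x v
  proof -
    have xV: "x \<in> V0" using that by simp
    have "Theta (G x) (FD G x v) = Theta (\<phi> (par x)) (dmap M \<phi> (par x) (FD par x v))"
      unfolding FDG[OF xV] G_def sl(5)[OF that(1)] dmap_h[OF that(1) tan[OF that]] ..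
    also have "\<dots> = th x v" unfolding th_eq[OF xV] by (rule \<phi>T[OF sl(3)[OF that(1)] tan[OF that]])
    finally show ?thesis .
  qed
  have dims: "DIM(complex ^ 'n) = 2 * CARD('n)" by simp
  interpret cr_map_pair mulI V0 L f g \<tau> \<tau>' th j
  proof (intro cr_map_pair.intro cr_map_pair_axioms.intro mulI.hermitian_space_axioms)
    show "open V0" by (rule V0)
    show "subspace L" by (rule L)
    show "smooth_on f V0" unfolding f_def by (rule smooth_on_bounded_linear[OF V0 bounded_linear_fst sp])
    show "smooth_on g V0" unfolding g_def by (rule smooth_on_bounded_linear[OF V0 bounded_linear_fst sG])
    show "smooth_on \<tau> V0" unfolding \<tau>_def by (rule smooth_on_bounded_linear[OF V0 bounded_linear_snd sp])
    show "smooth_on \<tau>' V0" unfolding \<tau>'_def by (rule smooth_on_bounded_linear[OF V0 bounded_linear_snd sG])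
    show "th x v = FD \<tau> x v + mulI (f x) \<bullet> FD f x v" for x v by (rule th_def)
    show "th x v = FD \<tau>' x v + mulI (g x) \<bullet> FD g x v" if "x \<in> V0 \<inter> L" "v \<in> L" for x v
      using Th_G[OF that] that(1) by (simp add: Theta_eq FDs g_def)
    show "linear (j x)" if x: "x \<in> V0" for x
    proof -
      have "par x \<in> W" using par_W x V0V by blast
      then have l: "linear (FD \<psi> (par x))" by (rule smooth_on_linear_FD[OF W s_psi])
      show ?thesis unfolding j_def
        by (rule linearI) (simp_all add: linear_add[OF l] linear_scale[OF l] linear_add[OF linpar[OF x]]
            linear_scale[OF linpar[OF x]] linear_add[OF Jst_linear] linear_scale[OF Jst_linear])
    qed
    show "smooth_on (\<lambda>x. j x v) V0" for v
      unfolding j_def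
    proof (rule smooth_on_apply[OF V0, where F = "\<lambda>x. FD \<psi> (par x)" and Y = "\<lambda>x. Jst (par x) (FD par x v)"])
      show "smooth_on (\<lambda>x. FD \<psi> (par x) w) V0" for w
        by (rule smooth_on_compose[OF V0 W _ sp smooth_on_FD[OF s_psi]]) (use par_W V0V in blast)
      show "linear (FD \<psi> (par x))" if "x \<in> V0" for x
        by (rule smooth_on_linear_FD[OF W s_psi]) (use that par_W V0V in blast)
      note spv = smooth_on_FD[OF sp, of v]
      have blm: "bounded_linear (\<lambda>w::'n heis. mulI (fst w))"
        using bounded_linear_compose[OF mulI.J_linear[unfolded linear_conv_bounded_linear] bounded_linear_fst] .
      have i: "smooth_on (\<lambda>x. fst (par x) \<bullet> fst (FD par x v)) V0"
        by (rule smooth_on_bounded_bilinear[OF V0 bounded_bilinear_inner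
              smooth_on_bounded_linear[OF V0 bounded_linear_fst sp] smooth_on_bounded_linear[OF V0 bounded_linear_fst spv]])
      show "smooth_on (\<lambda>x. Jst (par x) (FD par x v)) V0"
        unfolding Jst_eq
        by (rule smooth_on_Pair[OF V0 smooth_on_bounded_linear[OF V0 blm spv]
              smooth_on_bounded_linear[OF V0 bounded_linear_minus[OF bounded_linear_ident] i]])
    qed
    fix x assume x: "x \<in> V0 \<inter> L"
    then have xV: "x \<in> V0" by simp
    show "dim {v \<in> L. th x v = 0} + 2 = DIM(complex ^ 'n)"
    proof -
      let ?K = "{v \<in> L. th x v = 0}"
      have img: "FD par x ` ?K = xi_hat M (par x)"
        unfolding xi_hat_def tangent_space_eq[OF sl(1)[OF x]] xi_def using th_eq[OF xV] by auto
      have inj: "inj_on (FD par x) (span ?K)"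
        by (rule inj_on_inverseI[of _ "FD \<psi> (par x)"]) (rule FD_psi_par[OF sl(2)[OF x]])
      have "dim ?K = 2 * m"
        using dim_image_eq[OF linpar[OF xV] inj] hat(2)[OF sl(3)[OF x]] unfolding img by simp
      then show ?thesis unfolding dims using m card by simp
    qed
    fix v assume v: "v \<in> L"
    show "v = 0" if "FD f x v = 0"
    proof -
      have "FD par x v = 0"
        by (rule vertical_tangent_zero[OF subM[OF sl(3)[OF x]] _ tan[OF x v]])
          (use that FDs(1)[OF xV] nzM sl(3)[OF x] in auto)
      then show ?thesis using FD_psi_par[OF sl(2)[OF x], of v] FD_psi_par[OF sl(2)[OF x], of 0]
          linear_0[OF linpar[OF xV]] by simp
    qed
    \<comment> \<open>A vector killed by \<open>FD g x\<close> is sent by \<open>FD G x\<close> to a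
      vertical tangent vector of \<open>N\<close>, which is zero, and \<open>\<phi>\<close>
      preserves \<open>Theta\<close>.\<close>
    show "th x v = 0" if "FD g x v = 0"
    proof -
      have "FD G x v \<in> tangent_space N (G x)"
        unfolding FDG[OF xV] G_def
        by (rule tangent_space_push[OF tan[OF x v] h(1) sl(4)[OF x]
              smooth_on_has_derivative[OF h(1,3) sl(4)[OF x]]]) (use h(4) \<phi>N in auto)
      moreover have "G x \<in> N" unfolding G_def sl(5)[OF x] by (rule \<phi>N[OF sl(3)[OF x]])
      ultimately have "FD G x v = 0"
        using vertical_tangent_zero[OF subN, of "G x" "FD G x v"] nzN that FDs(3)[OF xV] by simp
      then show ?thesis using Th_G[OF x v] linear_0[OF Theta_linear[of "G x"]] by simp
    qed
    assume th0: "th x v = 0"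
    show "j x v \<in> L" unfolding j_def
      by (rule tan_L[OF x]) (use Jhat[OF x v th0] in \<open>simp add: xi_hat_def\<close>)
    show "th x (j x v) = 0"
      unfolding th_eq[OF xV] par_j[OF x] using Jhat[OF x v th0] by (simp add: xi_hat_def xi_def)
    have "Jst (par x) (FD par x (j x v)) = - FD par x v"
      unfolding par_j[OF x] by (rule Jst_Jst) (use hat_in[OF x v th0] in \<open>simp add: xi_hat_def\<close>)
    then have "j x (j x v) = FD \<psi> (par x) (FD par x (- v))"
      unfolding j_def[of x "j x v"] by (simp add: linear_neg[OF linpar[OF xV]])
    then show "j x (j x v) = - v" using FD_psi_par[OF sl(2)[OF x]] by simp
    show "FD f x (j x v) = mulI (FD f x v)"
      unfolding FDs[OF xV] par_j[OF x] by (simp add: Jst_eq)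
    have "FD G x (j x v) = dmap M \<phi> (par x) (Jst (par x) (FD par x v))"
      unfolding FDG[OF xV] par_j[OF x]
      by (rule dmap_h[OF x, symmetric]) (use Jhat[OF x v th0] in \<open>simp add: xi_hat_def\<close>)
    also have "\<dots> = Jst (\<phi> (par x)) (FD G x v)"
      unfolding \<phi>J[OF sl(3)[OF x] hat_in[OF x v th0]] FDG[OF xV] dmap_h[OF x tan[OF x v]] ..
    finally show "FD g x (j x v) = mulI (FD g x v)"
      unfolding FDs[OF xV] by (simp add: Jst_eq)
  qed (use ch(3) m card in \<open>auto simp: dims\<close>)
  define x0 where "x0 = \<psi> p"
  have parx0: "par x0 = p" unfolding x0_def by (rule par_psi[OF ch(2)])
  have x0: "x0 \<in> V0 \<inter> L"
    using psi_L[of p] p ch(2) h(2) parx0 unfolding V0_def x0_def by auto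
  obtain r U c t where r: "r > 0" "ball x0 r \<subseteq> V0" and U: "linear U" "\<forall>p. U (mulI p) = mulI (U p)" "\<forall>p. norm (U p) = norm p"
    and eq: "\<forall>x\<in>ball x0 r \<inter> L. g x = U (f x) + c \<and> \<tau>' x = \<tau> x + t - mulI c \<bullet> U (f x)"
    using local_rigidity[OF x0] by blast
  define S where "S = W \<inter> \<psi> -` ball x0 r"
  have "open S"
    unfolding S_def using continuous_on_open_vimage[OF W] smooth_on_continuous_on[OF s_psi] open_ball
    by (metis Int_commute)
  moreover have "p \<in> S" unfolding S_def using ch(2) r(1) x0_def by simp
  moreover have "unitary_map U" unfolding unitary_map_def using U by blast
  moreover have "\<phi> q = rigid_motion U c t q" if q: "q \<in> M \<inter> S" for q
  proof -
    have x: "\<psi> q \<in> ball x0 r \<inter> L" "q \<in> W" using q psi_L[of q] unfolding S_def by auto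
    then have "\<psi> q \<in> V0 \<inter> L" using r by auto
    from sl(5)[OF this] have "G (\<psi> q) = \<phi> q" unfolding G_def par_psi[OF x(2)] .
    then show ?thesis
      using eq[THEN bspec, OF x(1)] par_psi[OF x(2)]
      unfolding g_def \<tau>'_def f_def \<tau>_def rigid_motion_def by (simp add: prod_eq_iff)
  qed
  moreover have "P = UNIV" if "subspace P" "\<forall>z\<in>P. mulI z \<in> P" "fst ` tangent_space M p \<subseteq> P" for P
  proof (rule f_spans[OF x0 that(1)])
    fix v assume "v \<in> L"
    from tan[OF x0 this] show "FD f x0 v \<in> P" using that(3) x0 FDs(1)[of x0] unfolding parx0 by auto
  qed (use that in auto)
  ultimately show ?thesis by blast
qed

text \<open>Equality on an open part of \<open>M\<close> gives equality of derivatives on tangent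
  vectors. The set where the linear parts agree is a complex subspace, so the spanning hypothesis
  makes it everything, and evaluation at \<open>p\<close> then fixes the translations.\<close>

lemma rigid_motion_unique:
  assumes "open S" "p \<in> M \<inter> S" "unitary_map U" "unitary_map U'"
    and eq: "\<And>q. q \<in> M \<inter> S \<Longrightarrow> rigid_motion U c t q = rigid_motion U' c' t' q"
    and span: "\<forall>P. subspace P \<longrightarrow> (\<forall>z\<in>P. mulI z \<in> P) \<longrightarrow> fst ` tangent_space M p \<subseteq> P \<longrightarrow> P = UNIV"
  shows "rigid_motion U c t = rigid_motion U' c' t'"
proof -
  have U: "linear U" "linear U'" "\<And>p. U (mulI p) = mulI (U p)" "\<And>p. U' (mulI p) = mulI (U' p)"
    using assms(3,4) unfolding unitary_map_def by auto
  have "{z. U z = U' z} = UNIV"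
  proof (rule span[rule_format])
    show "subspace {z. U z = U' z}"
      unfolding subspace_def using U(1,2) by (auto simp: linear_0 linear_add linear_scale)
    show "fst ` tangent_space M p \<subseteq> {z. U z = U' z}"
    proof safe
      fix v assume v: "v \<in> tangent_space M p"
      have "(U (fst v), snd v - mulI c \<bullet> U (fst v)) = (U' (fst v), snd v - mulI c' \<bullet> U' (fst v))"
        by (rule FD_tangent_unique[OF v assms(1) _ eq rigid_motion_has_derivative[OF U(1)]
              rigid_motion_has_derivative[OF U(2)]]) (use assms(2) in auto)
      then show "U (fst v) = U' (fst v)" by simp
    qed
  qed (use U in auto)
  then have UU: "U = U'" by auto
  have "c = c'" "t = t'" using eq[OF assms(2)] unfolding rigid_motion_def UU by auto
  then show ?thesis using UU by simp
qed

theorem theorem7p3: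
  fixes M N :: "('n::finite) heis set" and \<phi> :: "'n heis \<Rightarrow> 'n heis" and m :: nat
  assumes "CARD('n) \<ge> 2"
    and "m = CARD('n) - 1"
    and "pseudohermitian_submanifold M m"
    and "pseudohermitian_submanifold N m"
    and "simply_connected M"
    and "simply_connected N"
    and "\<forall>p\<in>M. fundamental_field M p \<noteq> 0"
    and "\<forall>p\<in>N. fundamental_field N p \<noteq> 0"
    and "ph_transformation M N \<phi>"
  shows "\<exists>\<Phi>\<in>PSH. \<forall>p\<in>M. \<phi> p = \<Phi> p"
proof -
  let ?R = "\<lambda>p \<Phi> S. open S \<and> p \<in> S \<and> (\<exists>U c t. unitary_map U \<and> \<Phi> = rigid_motion U c t) \<and> (\<forall>q\<in>M \<inter> S. \<phi> q = \<Phi> q)"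
  have span: "\<forall>P. subspace P \<longrightarrow> (\<forall>z\<in>P. mulI z \<in> P) \<longrightarrow> fst ` tangent_space M p \<subseteq> P \<longrightarrow> P = UNIV"
    if "p \<in> M" for p
    using local_rigid_motion[OF assms(1-4,7-9) that] by blast
  have "\<forall>p\<in>M. \<exists>\<Phi> S. ?R p \<Phi> S"
  proof
    fix p assume "p \<in> M"
    from local_rigid_motion[OF assms(1-4,7-9) this]
    obtain S U c t where "open S" "p \<in> S" "unitary_map U" "\<forall>q\<in>M \<inter> S. \<phi> q = rigid_motion U c t q"
      by (elim exE conjE) (rule that)
    then show "\<exists>\<Phi> S. ?R p \<Phi> S"
      by (intro exI[of _ "rigid_motion U c t"] exI[of _ S] conjI) (assumption | rule exI conjI refl)+
  qed
  \<comment> \<open>\<open>F\<close> assigns a rigid motion to each point, not yet related to the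
    choices at neighbouring points.\<close>
  then obtain F where "\<forall>p\<in>M. \<exists>S. ?R p (F p) S" by metis
  then obtain S where R: "\<And>p. p \<in> M \<Longrightarrow> ?R p (F p) (S p)" by metis
  \<comment> \<open>Near \<open>q\<close> both motions agree with \<open>\<phi>\<close> on
    \<open>M\<close>, so \<open>rigid_motion_unique\<close> applies; thus \<open>F\<close> is
    locally constant on \<open>M\<close>.\<close>
  have local: "F q = F p" if p: "p \<in> M" and q: "q \<in> M \<inter> S p" for p q
  proof -
    obtain U c t where U: "unitary_map U" "F p = rigid_motion U c t" using R[OF p] by blast
    obtain U' c' t' where U': "unitary_map U'" "F q = rigid_motion U' c' t'" using R[of q] q by blast
    have qM: "q \<in> M" using q by simp
    have "rigid_motion U' c' t' = rigid_motion U c t"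
    proof (rule rigid_motion_unique[OF _ _ U'(1) U(1) _ span[OF qM]])
      show "open (S p \<inter> S q)" using R[OF p] R[OF qM] by blast
      show "q \<in> M \<inter> (S p \<inter> S q)" using R[OF qM] q by blast
      show "rigid_motion U' c' t' x = rigid_motion U c t x" if "x \<in> M \<inter> (S p \<inter> S q)" for x
        using R[OF p] R[OF qM] that unfolding U(2)[symmetric] U'(2)[symmetric] by (metis IntD1 IntD2 IntI)
    qed
    then show ?thesis using U U' by simp
  qed
  show ?thesis
  proof (cases "M = {}")
    case True
    \<comment> \<open>With no point to take a motion from, any rigid motion will do.\<close>
    have "unitary_map (\<lambda>p. p :: complex ^ 'n)" unfolding unitary_map_def by (simp add: linear_id[unfolded id_def])
    then show ?thesis using rigid_motion_PSH True by blast
  next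
    case False
    then obtain p0 where p0: "p0 \<in> M" by blast
    have conn: "connected M" using assms(5) by (rule simply_connected_imp_connected)
    have "F p0 = F q" if q: "q \<in> M" for q
    proof (rule connected_local_const[OF conn p0 q], intro ballI)
      fix a assume a: "a \<in> M"
      have "\<forall>\<^sub>F b in at a within M. b \<in> S a"
        using R[OF a] by (simp add: eventually_at_topological) blast
      moreover have "\<forall>\<^sub>F b in at a within M. b \<in> M" by (simp add: eventually_at_filter)
      ultimately show "\<forall>\<^sub>F b in at a within M. F a = F b"
        by eventually_elim (use local[OF a] in simp)
    qed
    then have "\<phi> q = F p0 q" if "q \<in> M" for q using R[OF that] that by simp
    moreover have "F p0 \<in> PSH" using R[OF p0] rigid_motion_PSH by auto
    ultimately show ?thesis by blast
  qed
qed

end
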